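(* Let $B\subseteq\mathbb R^n$ be a nonempty open connected set, let $T_B=\{z=x+iy\in\mathbb C^n: x\in\mathbb R^n,\ y\in B\}$, and let $\rho$ be a positive continuous function on $T_B$ such that $\rho(x+iy)=\rho(iy)$ for all $x\in\mathbb R^n$, $y\in B$. For $t\in\mathbb R^n$ put $$I(t)=\int_B\rho(iy)e^{-4\pi y\cdot t}\,dy\in(0,\infty].$$ Then the weighted Bergman kernel $K(z,w)$ of $A^2_\rho$ is given, for all $z,w\in T_B$, by $$K(z,w)=\int_{\mathbb R^n}e^{2\pi i\, t\cdot(z-\overline w)}\,I^{-1}(t)\,dt,$$ where $I^{-1}(t)=1/I(t)$, with $I^{-1}(t)=0$ when $I(t)=\infty$.
   Context: For $z\in\mathbb C^n$ and $t\in\mathbb R^n$, $z\cdot t=\sum_{k=1}^n z_kt_k$. $A^2_\rho$ is the Hilbert space of holomorphic functions $F$ on $T_B$ with $\int_B\int_{\mathbb R^n}|F(x+iy)|^2\rho(iy)\,dx\,dy<\infty$, with inner product $\langle F,G\rangle_\rho=\int_B\int_{\mathbb R^n}F(x+iy)\overline{G(x+iy)}\rho(iy)\,dx\,dy$. Point evaluations are bounded on $A^2_\rho$; the weighted Bergman kernel (reproducing kernel) of $A^2_\rho$ is the unique function $K(z,w)$ on $T_B\times T_B$ such that for every $w\in T_B$ the function $K_w=K(\cdot,w)$ belongs to $A^2_\rho$ and $F(w)=\langle F,K_w\rangle_\rho$ for every $F\in A^2_\rho$. *)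

theory Defs
  imports "HOL-Analysis.Analysis"
begin

definition cvec :: "real ^ 'n \<Rightarrow> real ^ 'n \<Rightarrow> complex ^ 'n" where
  "cvec x y = (\<chi> k. complex_of_real (x $ k) + \<i> * complex_of_real (y $ k))"

definition tube :: "(real ^ 'n) set \<Rightarrow> (complex ^ 'n) set" where
  "tube B = {cvec x y | x y. y \<in> B}"

text \<open>The bilinear product, not the Hermitian one.\<close>

definition cdot :: "complex ^ 'n \<Rightarrow> real ^ 'n \<Rightarrow> complex" where
  "cdot z t = (\<Sum>k\<in>UNIV. z $ k * complex_of_real (t $ k))"

definition vcnj :: "complex ^ 'n \<Rightarrow> complex ^ 'n" where
  "vcnj w = (\<chi> k. cnj (w $ k))"

text \<open>Holomorphy in several variables, for open \<open>U\<close>: at each point the real Frechet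
  derivative exists and is complex linear, with the complex partial derivatives \<open>c $ k\<close>
  as coefficients.\<close>

definition sholomorphic_on :: "(complex ^ 'n \<Rightarrow> complex) \<Rightarrow> (complex ^ 'n) set \<Rightarrow> bool" where
  "sholomorphic_on F U \<longleftrightarrow>
     (\<forall>z\<in>U. \<exists>c :: complex ^ 'n. (F has_derivative (\<lambda>h. \<Sum>k\<in>UNIV. c $ k * h $ k)) (at z))"

text \<open>Functions on \<open>tube B\<close> are represented by total functions whose values outside
  \<open>tube B\<close> are irrelevant.\<close>

definition A2 :: "(real ^ 'n) set \<Rightarrow> (complex ^ 'n \<Rightarrow> real) \<Rightarrow> (complex ^ 'n \<Rightarrow> complex) set" where
  "A2 B \<rho> = {F. sholomorphic_on F (tube B) \<and>
     (\<integral>\<^sup>+y\<in>B. (\<integral>\<^sup>+x. ennreal ((cmod (F (cvec x y)))\<^sup>2 * \<rho> (cvec 0 y)) \<partial>lborel) \<partial>lborel) < \<infinity>}"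

definition A2_inner ::
  "(real ^ 'n) set \<Rightarrow> (complex ^ 'n \<Rightarrow> real) \<Rightarrow> (complex ^ 'n \<Rightarrow> complex) \<Rightarrow> (complex ^ 'n \<Rightarrow> complex) \<Rightarrow> complex"
where
  "A2_inner B \<rho> F G =
     (LINT y:B|lborel. (LINT x|lborel.
        F (cvec x y) * cnj (G (cvec x y)) * complex_of_real (\<rho> (cvec 0 y))))"

text \<open>The kernel is a function on \<open>tube B \<times> tube B\<close>; normalising the irrelevant values
  to \<open>0\<close> makes it unique as a total function.\<close>

definition is_weighted_bergman_kernel ::
  "(real ^ 'n) set \<Rightarrow> (complex ^ 'n \<Rightarrow> real) \<Rightarrow> (complex ^ 'n \<Rightarrow> complex ^ 'n \<Rightarrow> complex) \<Rightarrow> bool"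
where
  "is_weighted_bergman_kernel B \<rho> K \<longleftrightarrow>
     (\<forall>z w. z \<notin> tube B \<or> w \<notin> tube B \<longrightarrow> K z w = 0) \<and>
     (\<forall>w\<in>tube B. (\<lambda>z. K z w) \<in> A2 B \<rho> \<and>
        (\<forall>F\<in>A2 B \<rho>. F w = A2_inner B \<rho> F (\<lambda>z. K z w)))"

definition weighted_bergman_kernel ::
  "(real ^ 'n) set \<Rightarrow> (complex ^ 'n \<Rightarrow> real) \<Rightarrow> complex ^ 'n \<Rightarrow> complex ^ 'n \<Rightarrow> complex"
where
  "weighted_bergman_kernel B \<rho> = (THE K. is_weighted_bergman_kernel B \<rho> K)"

definition I_weight :: "(real ^ 'n) set \<Rightarrow> (complex ^ 'n \<Rightarrow> real) \<Rightarrow> real ^ 'n \<Rightarrow> ennreal" where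
  "I_weight B \<rho> t = (\<integral>\<^sup>+y\<in>B. ennreal (\<rho> (cvec 0 y) * exp (- 4 * pi * (y \<bullet> t))) \<partial>lborel)"

definition I_weight_inv :: "(real ^ 'n) set \<Rightarrow> (complex ^ 'n \<Rightarrow> real) \<Rightarrow> real ^ 'n \<Rightarrow> real" where
  "I_weight_inv B \<rho> t = (if I_weight B \<rho> t = \<infinity> then 0 else 1 / enn2real (I_weight B \<rho> t))"

end

theory Submission
  imports Defs "HOL-Probability.Characteristic_Functions" "HOL-Complex_Analysis.Conformal_Mappings"
begin

text \<open>
  Write \<open>I\<close> for the weight integral. On a ball around \<open>v \<in> B\<close> the weight is bounded below, which gives
  \<open>exp (- 4 pi v\<cdot>t) / I t \<le> C exp (- a \<bar>t\<bar>)\<close>; since \<open>exp (- 2 pi (y + v)\<cdot>t)\<close> is at most the mean of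
  \<open>exp (- 4 pi y\<cdot>t)\<close> and \<open>exp (- 4 pi v\<cdot>t)\<close>, the kernel integral converges although \<open>B\<close> need not be convex.
  Bessel's inequality on each slice \<open>Im z = y\<close> puts \<open>K\<^sub>w\<close> into \<open>A\<^sup>2\<close>.

  For \<open>F \<in> A\<^sup>2\<close> a mean value estimate shows that \<open>F\<close> is bounded on slices locally uniformly in \<open>y\<close>.
  Hence \<open>F\<^sub>m z = F z exp (- \<epsilon>\<^sub>m z\<cdot>z)\<close> decays like a Gaussian, and shifting the contour within the connected
  set \<open>B\<close> shows that \<open>exp (2 pi y\<cdot>t)\<close> times the Fourier transform of the slice of \<open>F\<^sub>m\<close> is a function \<open>\<phi>\<^sub>m t\<close>
  not depending on \<open>y\<close>. Let \<open>I\<^sub>m\<close> be the integral of a bounded cutoff of the weight. By Fourier inversion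
  and Fubini, \<open>F\<^sub>m w\<close> minus the cut-off inner product of \<open>F\<^sub>m\<close> with \<open>K\<^sub>w\<close> is the integral of
  \<open>(1 - I\<^sub>m / I) \<phi>\<^sub>m exp (2 pi i t\<cdot>w)\<close>. By Cauchy--Schwarz its square is at most
  \<open>\<integral> (1 - I\<^sub>m / I)\<^sup>2 exp (- 4 pi v\<cdot>t) / I\<^sub>m dt\<close> times \<open>\<integral> I\<^sub>m \<bar>\<phi>\<^sub>m\<bar>\<^sup>2 dt\<close>, where \<open>v = Im w\<close>. The first factor
  tends to \<open>0\<close> by dominated convergence, also at the points where \<open>I = \<infinity>\<close>; the second is bounded by
  a multiple of the squared norm of \<open>F\<close>, again by Bessel's inequality.
\<close>

subsection \<open>Fourier transforms of integrable functions\<close>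

text \<open>A slice of a function in \<open>A2\<close> need not be integrable, so its transform
  would be an L2 object. The Gaussian factor keeps everything inside the L1 theory, where the
  one-sided Bessel inequality does the work of Plancherel's theorem. This has a price. The
  regularized functions may leave \<open>A2\<close>, because the factor grows like
  \<open>exp (eps |y|^2)\<close> in the imaginary direction, and their spectrum may fail to vanish
  where the weight integral is infinite. The cutoff pays for both: on its support that growth is
  bounded, and for large \<open>m\<close> the finite positive integrals \<open>I_m\<close> measure
  the spectrum even where \<open>I\<close> is infinite, the error made there being controlled by
  \<open>1 / I_m\<close>, which tends to 0. Uniqueness is a matter of symmetry: any two reproducing
  kernels are conjugate transposes of each other.\<close>

lemma norm_integral_le_nn_integral:
  fixes f :: "'a \<Rightarrow> 'b::{banach, second_countable_topology}"
  shows "ennreal (norm (LINT x|M. f x)) \<le> (\<integral>\<^sup>+x. ennreal (norm (f x)) \<partial>M)"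
  \<comment> \<open>A non-integrable \<open>f\<close> has Bochner integral 0, so the estimate may be
    used before integrability is known.\<close>
  by (cases "integrable M f") (auto intro: integral_norm_bound_ennreal simp: not_integrable_integral_eq)

text \<open>Lebesgue measure is the image of a product of one-dimensional Lebesgue measures under
  the map from coordinates to vectors, so both claims are transported from the product
  measure.\<close>

lemma lborel_integral_Basis_prod:
  fixes f :: "'a::euclidean_space \<Rightarrow> real \<Rightarrow> 'c::{real_normed_field,banach,second_countable_topology}"
  assumes f: "\<And>b. b \<in> Basis \<Longrightarrow> integrable lborel (f b)"
  shows "integrable lborel (\<lambda>x::'a. \<Prod>b\<in>Basis. f b (x \<bullet> b))"
    and "(LINT x|lborel. (\<Prod>b\<in>Basis. f b (x \<bullet> b))) = (\<Prod>b\<in>Basis. integral\<^sup>L lborel (f b))"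
proof -
  interpret product_sigma_finite "\<lambda>_::'a. lborel :: real measure" ..
  have m[measurable]: "f b \<in> borel_measurable borel" if "b \<in> Basis" for b
    using borel_measurable_integrable[OF f[OF that]] by simp
  have m2: "(\<lambda>x::'a. \<Prod>b\<in>Basis. f b (x \<bullet> b)) \<in> borel_measurable borel"
    by (intro borel_measurable_prod) measurable
  have m3: "(\<lambda>x::'a \<Rightarrow> real. \<Sum>b\<in>Basis. x b *\<^sub>R b) \<in> (\<Pi>\<^sub>M b\<in>Basis. lborel) \<rightarrow>\<^sub>M borel"
    by measurable
  have eq: "(\<Prod>b\<in>Basis. f b ((\<Sum>b\<in>Basis. x b *\<^sub>R b) \<bullet> b)) = (\<Prod>b\<in>Basis. f b (x b))" for x :: "'a \<Rightarrow> real"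
    by (intro prod.cong refl) (simp add: inner_sum_left_Basis)
  have i: "integrable (\<Pi>\<^sub>M b\<in>Basis. lborel) (\<lambda>x. \<Prod>b\<in>Basis. f b (x b))"
    by (rule product_integrable_prod) (use f in auto)
  show "integrable lborel (\<lambda>x::'a. \<Prod>b\<in>Basis. f b (x \<bullet> b))"
    by (subst lborel_eq, subst integrable_distr_eq[OF m3 m2]) (simp add: inner_sum_left_Basis i cong: prod.cong)
  show "(LINT x|lborel. (\<Prod>b\<in>Basis. f b (x \<bullet> b))) = (\<Prod>b\<in>Basis. integral\<^sup>L lborel (f b))"
    by (subst lborel_eq, subst integral_distr[OF m3 m2])
      (simp only: eq, rule product_integral_prod, use f in auto)
qed

text \<open>This is the characteristic function of the standard normal law after a change of
  scale.\<close>

lemma gauss_integral_real: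
  fixes c s :: real assumes c: "c > 0"
  shows "integrable lborel (\<lambda>x::real. complex_of_real (exp (- c * x\<^sup>2)) * cis (x * s))" (is ?i)
    and "(LINT x|lborel. complex_of_real (exp (- c * x\<^sup>2)) * cis (x * s))
       = complex_of_real (sqrt (pi / c) * exp (- s\<^sup>2 / (4 * c)))" (is ?e)
proof -
  \<comment> \<open>With this scale, \<open>x \<mapsto> a * x\<close> turns
    \<open>exp (- x^2 / 2)\<close> into \<open>exp (- c * x^2)\<close> and the frequency
    \<open>s / a\<close> back into \<open>s\<close>.\<close>
  define a where "a = sqrt (2 * c)"
  have a: "a > 0" "a\<^sup>2 = 2 * c" using c by (auto simp: a_def)
  define f where "f = (\<lambda>x. std_normal_density x *\<^sub>R iexp (s / a * x))"
  have "complex_of_real (exp (- ((s / a)\<^sup>2) / 2)) = char std_normal_distribution (s / a)"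
    by (simp add: char_std_normal_distribution)
  also have "\<dots> = (LINT x|lborel. f x)"
    unfolding char_def f_def by (subst integral_density) (auto simp: normal_density_nonneg)
  also have "\<dots> = \<bar>a\<bar> *\<^sub>R (LINT x|lborel. f (0 + a * x))"
    by (rule lborel_integral_real_affine) (use a in auto)
  finally have 1: "complex_of_real (exp (- ((s / a)\<^sup>2) / 2)) = \<bar>a\<bar> *\<^sub>R (LINT x|lborel. f (0 + a * x))" .
  have fi: "integrable lborel f"
    unfolding f_def
    by (rule Bochner_Integration.integrable_bound[OF integrable_normal_density[of 1 0]])
      (auto simp: normal_density_nonneg)
  have 2: "f (0 + a * x) = complex_of_real (1 / sqrt (2 * pi)) * (complex_of_real (exp (- c * x\<^sup>2)) * cis (x * s))" for x
    using a by (simp add: f_def std_normal_density_def power_mult_distrib cis_conv_exp scaleR_conv_of_real mult_ac)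
  have "integrable lborel (\<lambda>x. f (0 + a * x))"
    by (rule lborel_integrable_real_affine[OF fi]) (use a in auto)
  then have 3: "integrable lborel (\<lambda>x. complex_of_real (1 / sqrt (2 * pi)) * (complex_of_real (exp (- c * x\<^sup>2)) * cis (x * s)))"
    by (simp only: 2)
  show ?i using integrable_mult_right[OF 3, of "complex_of_real (sqrt (2 * pi))"]
    by (simp add: field_simps)
  have "(s / a)\<^sup>2 / 2 = s\<^sup>2 / (4 * c)" using a by (simp add: power_divide)
  then have "complex_of_real (exp (- s\<^sup>2 / (4 * c))) = complex_of_real (a / sqrt (2 * pi)) * (LINT x|lborel. complex_of_real (exp (- c * x\<^sup>2)) * cis (x * s))"
    using 1 a by (simp only: 2 integral_mult_right_zero) (simp add: scaleR_conv_of_real)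
  moreover have "sqrt (pi / c) = inverse (a / sqrt (2 * pi))"
    using c by (simp add: a_def real_sqrt_divide real_sqrt_mult field_simps)
  moreover have "X = complex_of_real (inverse k * e)" if "complex_of_real e = complex_of_real k * X" "k \<noteq> 0" for X k e
    using that by (simp add: field_simps)
  ultimately show ?e using a by simp
qed

lemma gauss_integral:
  fixes s :: "'a::euclidean_space" and c :: real assumes c: "c > 0"
  shows "integrable lborel (\<lambda>x::'a. complex_of_real (exp (- c * (norm x)\<^sup>2)) * cis (x \<bullet> s))" (is ?i)
    and "(LINT x|lborel. complex_of_real (exp (- c * (norm x)\<^sup>2)) * cis (x \<bullet> s))
       = complex_of_real (sqrt (pi / c) ^ DIM('a) * exp (- (norm s)\<^sup>2 / (4 * c)))" (is ?e)
proof -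
  have cis_sum: "cis (\<Sum>b\<in>A. g b) = (\<Prod>b\<in>A. cis (g b))" if "finite A" for A and g :: "'a \<Rightarrow> real"
    using that by (induction A rule: finite_induct) (auto simp: cis_mult[symmetric])
  have n: "(norm x)\<^sup>2 = (\<Sum>b\<in>Basis. (x \<bullet> b)\<^sup>2)" for x :: 'a
    by (subst power2_norm_eq_inner, subst euclidean_inner) (simp add: power2_eq_square)
  have eq: "complex_of_real (exp (- c * (norm x)\<^sup>2)) * cis (x \<bullet> s)
      = (\<Prod>b\<in>Basis. complex_of_real (exp (- c * (x \<bullet> b)\<^sup>2)) * cis ((x \<bullet> b) * (s \<bullet> b)))" for x :: 'a
    by (simp add: prod.distrib cis_sum[symmetric] euclidean_inner[of x s] n sum_distrib_left exp_sum
        sum_negf[symmetric] flip: of_real_prod del: sum_negf)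
  show ?i unfolding eq by (rule lborel_integral_Basis_prod) (rule gauss_integral_real[OF c])
  have "exp (- (norm s)\<^sup>2 / (4 * c)) = (\<Prod>b\<in>Basis. exp (- (s \<bullet> b)\<^sup>2 / (4 * c)))"
    by (simp add: n sum_divide_distrib sum_negf[symmetric] exp_sum del: sum_negf)
  moreover have "(LINT x::'a|lborel. (\<Prod>b\<in>Basis. complex_of_real (exp (- c * (x \<bullet> b)\<^sup>2)) * cis ((x \<bullet> b) * (s \<bullet> b))))
      = (\<Prod>b\<in>Basis. LINT x|lborel. complex_of_real (exp (- c * x\<^sup>2)) * cis (x * (s \<bullet> b)))"
    by (rule lborel_integral_Basis_prod(2)) (rule gauss_integral_real[OF c])
  ultimately show ?e unfolding eq
    by (simp only: gauss_integral_real(2)[OF c] of_real_mult of_real_prod prod.distrib prod_constant of_real_power)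
qed

section \<open>Integrability on product spaces and the Fourier transform\<close>

lemma integrable_pairI:
  fixes f :: "'a::euclidean_space \<Rightarrow> 'b::euclidean_space \<Rightarrow> 'c::{banach, second_countable_topology}"
  assumes [measurable]: "case_prod f \<in> borel_measurable (lborel \<Otimes>\<^sub>M lborel)"
    and fin: "(\<integral>\<^sup>+x. \<integral>\<^sup>+y. ennreal (norm (f x y)) \<partial>lborel \<partial>lborel) < \<infinity>"
  shows "integrable (lborel \<Otimes>\<^sub>M lborel) (case_prod f)"
proof (rule integrableI_bounded)
  have "(\<integral>\<^sup>+p. ennreal (norm (case_prod f p)) \<partial>(lborel \<Otimes>\<^sub>M lborel)) = (\<integral>\<^sup>+x. \<integral>\<^sup>+y. ennreal (norm (case_prod f (x, y))) \<partial>lborel \<partial>lborel)"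
    by (rule lborel.nn_integral_fst[symmetric]) measurable
  then show "(\<integral>\<^sup>+p. ennreal (norm (case_prod f p)) \<partial>(lborel \<Otimes>\<^sub>M lborel)) < \<infinity>" using fin by simp
qed fact

lemma integrable_pair_mult:
  fixes f :: "'a::euclidean_space \<Rightarrow> 'c::{banach, second_countable_topology, real_normed_div_algebra}"
    and g :: "'b::euclidean_space \<Rightarrow> 'c"
  assumes f: "integrable lborel f" and g: "integrable lborel g"
  shows "integrable (lborel \<Otimes>\<^sub>M lborel) (\<lambda>(x, y). f x * g y)"
proof (rule integrable_pairI)
  note [measurable] = borel_measurable_integrable[OF f] borel_measurable_integrable[OF g]
  show "(\<lambda>(x, y). f x * g y) \<in> borel_measurable (lborel \<Otimes>\<^sub>M lborel)" by measurable
  have "(\<integral>\<^sup>+x. \<integral>\<^sup>+y. ennreal (norm (f x * g y)) \<partial>lborel \<partial>lborel)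
      = (\<integral>\<^sup>+x. ennreal (norm (f x)) \<partial>lborel) * (\<integral>\<^sup>+y. ennreal (norm (g y)) \<partial>lborel)"
    by (simp add: norm_mult ennreal_mult nn_integral_cmult nn_integral_multc)
  also have "\<dots> < \<infinity>"
    using f g by (simp add: integrable_iff_bounded ennreal_mult_less_top)
  finally show "(\<integral>\<^sup>+x. \<integral>\<^sup>+y. ennreal (norm (f x * g y)) \<partial>lborel \<partial>lborel) < \<infinity>" .
qed

text \<open>The plus sign in the exponent makes each slice of the kernel a \<open>four\<close>
  directly; transforms of slices of \<open>F\<close> then occur at \<open>- t\<close>. The factor
  \<open>2 * pi\<close> keeps inversion and Bessel's inequality free of constants.\<close>

definition four :: "('a::euclidean_space \<Rightarrow> complex) \<Rightarrow> 'a \<Rightarrow> complex" where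
  "four f t = (LINT x|lborel. f x * cis (2 * pi * (x \<bullet> t)))"

lemma borel_measurable_cis [measurable]: "cis \<in> borel_measurable borel"
  by (intro borel_measurable_continuous_onI continuous_intros)

lemma integrable_mult_cis:
  fixes f :: "'a \<Rightarrow> complex"
  assumes f: "integrable M f" and [measurable]: "g \<in> borel_measurable M"
  shows "integrable M (\<lambda>x. f x * cis (g x))"
proof (rule Bochner_Integration.integrable_bound[OF f])
  note [measurable] = borel_measurable_integrable[OF f]
  show "(\<lambda>x. f x * cis (g x)) \<in> borel_measurable M" by measurable
qed (auto simp: norm_mult)

lemma norm_four_le: 
  assumes "integrable lborel f" shows "norm (four f t) \<le> (LINT x|lborel. norm (f x))"
  unfolding four_def by (rule order.trans[OF integral_norm_bound]) (simp add: norm_mult)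

lemma borel_measurable_four [measurable]:
  fixes f :: "'a::euclidean_space \<Rightarrow> complex"
  assumes f: "integrable lborel f" shows "four f \<in> borel_measurable borel"
proof -
  note [measurable] = borel_measurable_integrable[OF f]
  have "(\<lambda>t. LINT x|lborel. f x * cis (2 * pi * (x \<bullet> t))) \<in> borel_measurable (lborel :: 'a measure)"
    by (intro lborel.borel_measurable_lebesgue_integral) measurable
  then show ?thesis unfolding four_def[abs_def] by simp
qed

text \<open>The Fourier transform of \<open>exp (- c \<bar>t\<bar>\<^sup>2)\<close>, an approximate identity as \<open>c\<close> tends to \<open>0\<close>.\<close>

definition heat :: "real \<Rightarrow> 'a::euclidean_space \<Rightarrow> real" where
  "heat c u = sqrt (pi / c) ^ DIM('a) * exp (- (pi\<^sup>2 / c) * (norm u)\<^sup>2)"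

lemma heat_nonneg: "c > 0 \<Longrightarrow> heat c u \<ge> 0" by (simp add: heat_def)

lemma heat_measurable [measurable]: "heat c \<in> borel_measurable borel"
  unfolding heat_def[abs_def] by measurable

lemma heat_minus: "heat c (x - y) = heat c (y - x)"
  by (simp add: heat_def norm_minus_commute)

lemma heat_eq_integral:
  fixes u :: "'a::euclidean_space" assumes "c > 0"
  shows "(LINT t|lborel. complex_of_real (exp (- c * (norm t)\<^sup>2)) * cis (2 * pi * (t \<bullet> u))) = heat c u"
proof -
  have "(LINT t|lborel. complex_of_real (exp (- c * (norm t)\<^sup>2)) * cis (2 * pi * (t \<bullet> u)))
     = (LINT t|lborel. complex_of_real (exp (- c * (norm t)\<^sup>2)) * cis (t \<bullet> ((2 * pi) *\<^sub>R u)))" by simp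
  also have "\<dots> = heat c u"
    by (subst gauss_integral(2)[OF assms]) (simp add: heat_def power_mult_distrib power2_eq_square)
  finally show ?thesis .
qed

lemma heat_integral:
  assumes "c > 0"
  shows "integrable lborel (heat c :: 'a::euclidean_space \<Rightarrow> real)" and "(LINT u::'a|lborel. heat c u) = 1"
proof -
  have c: "pi\<^sup>2 / c > 0" using assms by simp
  have i: "integrable lborel (\<lambda>x::'a. complex_of_real (exp (- (pi\<^sup>2 / c) * (norm x)\<^sup>2)))"
    using gauss_integral(1)[OF c, of 0] by simp
  have i': "integrable lborel (\<lambda>x::'a. exp (- (pi\<^sup>2 / c) * (norm x)\<^sup>2))"
    using integrable_norm[OF i] by simp
  then show "integrable lborel (heat c :: 'a \<Rightarrow> real)" unfolding heat_def by simp
  have "complex_of_real (LINT x::'a|lborel. exp (- (pi\<^sup>2 / c) * (norm x)\<^sup>2)) = complex_of_real (sqrt (pi / (pi\<^sup>2 / c)) ^ DIM('a))"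
    using gauss_integral(2)[OF c, of "0 :: 'a"] by (simp flip: of_real_power)
  then have "(LINT x::'a|lborel. exp (- (pi\<^sup>2 / c) * (norm x)\<^sup>2)) = sqrt (pi / (pi\<^sup>2 / c)) ^ DIM('a)"
    using of_real_eq_iff by blast
  moreover have "sqrt (pi / c) * sqrt (pi / (pi\<^sup>2 / c)) = 1"
    using assms by (simp flip: real_sqrt_mult add: power2_eq_square)
  ultimately show "(LINT u::'a|lborel. heat c u) = 1"
    unfolding heat_def by (simp flip: power_mult_distrib)
qed

lemma nn_integral_heat:
  fixes y :: "'a::euclidean_space" assumes "c > 0"
  shows "(\<integral>\<^sup>+x. ennreal (heat c (x - y)) \<partial>lborel) = 1"
proof -
  have "(\<integral>\<^sup>+x. ennreal (heat c x) \<partial>(lborel::'a measure)) = 1"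
    using heat_integral[OF assms, where 'a='a] by (subst nn_integral_eq_integral) (auto simp: heat_nonneg assms)
  also have "(\<integral>\<^sup>+x. ennreal (heat c x) \<partial>(lborel::'a measure)) = (\<integral>\<^sup>+x. ennreal (heat c x) \<partial>distr lborel borel ((+) (-y)))"
    by (simp add: lborel_distr_plus)
  also have "\<dots> = (\<integral>\<^sup>+x. ennreal (heat c (x - y)) \<partial>lborel)"
    by (subst nn_integral_distr) auto
  finally show ?thesis by simp
qed

lemma integrable_gauss:
  "c > 0 \<Longrightarrow> integrable lborel (\<lambda>x::'a::euclidean_space. exp (- c * (norm x)\<^sup>2))"
  using integrable_norm[OF gauss_integral(1)[of c 0]] by simp

text \<open>Damping the transform by a Gaussian before inverting averages \<open>f\<close> against
  \<open>heat c\<close>: the damping makes the double integral absolutely convergent, and Fubini's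
  theorem leaves a Gaussian transform to evaluate.\<close>

lemma gauss_four:
  fixes f :: "'a::euclidean_space \<Rightarrow> complex"
  assumes f: "integrable lborel f" and c: "c > 0"
  shows "(LINT t|lborel. complex_of_real (exp (- c * (norm t)\<^sup>2)) * four f t * cis (- 2 * pi * (x \<bullet> t)))
    = (LINT y|lborel. f y * heat c (y - x))"
proof -
  note [measurable] = borel_measurable_integrable[OF f]
  let ?h = "\<lambda>y t. f y * (complex_of_real (exp (- c * (norm t)\<^sup>2)) * cis (2 * pi * (t \<bullet> (y - x))))"
  have "integrable (lborel \<Otimes>\<^sub>M lborel) (\<lambda>(y,t). f y * (complex_of_real (exp (- c * (norm t)\<^sup>2)) * cis (2 * pi * (t \<bullet> (y - x)))))"
  proof (rule Bochner_Integration.integrable_bound)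
    show "integrable (lborel \<Otimes>\<^sub>M lborel) (\<lambda>(y::'a,t::'a). norm (f y) * exp (- c * (norm t)\<^sup>2))"
      by (rule integrable_pair_mult) (use f integrable_gauss[OF c] in auto)
    show "(\<lambda>(y,t). ?h y t) \<in> borel_measurable (lborel \<Otimes>\<^sub>M lborel)"
      by measurable
  qed (auto simp: norm_mult)
  from lborel_pair.Fubini_integral[OF this] 
  have "(LINT t|lborel. LINT y|lborel. ?h y t) = (LINT y|lborel. LINT t|lborel. ?h y t)" .
  also have "(\<lambda>y. LINT t|lborel. ?h y t) = (\<lambda>y. f y * heat c (y - x))"
    by (simp only: integral_mult_right_zero heat_eq_integral[OF c])
  also have "(\<lambda>t. LINT y|lborel. ?h y t) = (\<lambda>t. complex_of_real (exp (- c * (norm t)\<^sup>2)) * four f t * cis (- 2 * pi * (x \<bullet> t)))"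
  proof
    fix t
    have "?h y t = (complex_of_real (exp (- c * (norm t)\<^sup>2)) * cis (- 2 * pi * (x \<bullet> t))) * (f y * cis (2 * pi * (y \<bullet> t)))" for y
      by (simp add: cis_mult inner_diff_right inner_commute algebra_simps)
    then show "(LINT y|lborel. ?h y t) = complex_of_real (exp (- c * (norm t)\<^sup>2)) * four f t * cis (- 2 * pi * (x \<bullet> t))"
      by (simp only: integral_mult_right_zero four_def) (simp add: mult_ac)
  qed
  finally show ?thesis .
qed

lemma borel_measurable_cnj [measurable]: "cnj \<in> borel_measurable borel"
  by (intro borel_measurable_continuous_onI continuous_intros)

lemma lborel_integral_affine:
  fixes f :: "'a::euclidean_space \<Rightarrow> 'b::{banach, second_countable_topology}"
  assumes [measurable]: "f \<in> borel_measurable borel" and s: "s > 0"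
  shows "(LINT x|lborel. f x) = (LINT u|lborel. s ^ DIM('a) *\<^sub>R f (x + s *\<^sub>R u))"
proof -
  have "(LINT x|lborel. f x) = (LINT y|density (distr lborel borel (\<lambda>u. x + s *\<^sub>R u)) (\<lambda>_. \<bar>s\<bar> ^ DIM('a)). f y)"
    using lborel_affine[of s x] s by simp
  also have "\<dots> = (LINT y|distr lborel borel (\<lambda>u. x + s *\<^sub>R u). s ^ DIM('a) *\<^sub>R f y)"
    using s by (subst integral_density) auto
  also have "\<dots> = (LINT u|lborel. s ^ DIM('a) *\<^sub>R f (x + s *\<^sub>R u))"
    by (subst integral_distr) auto
  finally show ?thesis .
qed

text \<open>By \<open>gauss_four\<close> the left side is the quadratic form of \<open>f\<close>
  with kernel \<open>heat c (y - x)\<close>. Since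
  \<open>|f x f y| \<le> (|f x|^2 + |f y|^2) / 2\<close> and \<open>heat c\<close> has mass 1 in
  either variable, the form is at most the squared norm, as in Schur's test. The right side may be
  infinite.\<close>

lemma bessel_gauss:
  fixes f :: "'a::euclidean_space \<Rightarrow> complex"
  assumes f: "integrable lborel f" and c: "c > 0"
  shows "(\<integral>\<^sup>+t. ennreal (exp (- c * (norm t)\<^sup>2) * (norm (four f t))\<^sup>2) \<partial>lborel) \<le> (\<integral>\<^sup>+x. ennreal ((norm (f x))\<^sup>2) \<partial>lborel)"
proof -
  note [measurable] = borel_measurable_integrable[OF f] borel_measurable_four[OF f]
  define C where "C = (LINT x|lborel. norm (f x))"
  have C: "norm (four f t) \<le> C" for t unfolding C_def by (rule norm_four_le[OF f])
  have C0: "C \<ge> 0" unfolding C_def by simp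
  \<comment> \<open>The Gaussian goes into one factor only: \<open>h\<close> is integrable because
    \<open>four f\<close> is bounded, while the other factor is expanded as an integral for Fubini's
    theorem.\<close>
  define h where "h t = complex_of_real (exp (- c * (norm t)\<^sup>2)) * four f t" for t :: 'a
  have [measurable]: "h \<in> borel_measurable borel" unfolding h_def[abs_def] by measurable
  have h: "integrable lborel h"
  proof (rule Bochner_Integration.integrable_bound)
    show "integrable lborel (\<lambda>t::'a. C * exp (- c * (norm t)\<^sup>2))" using integrable_gauss[OF c, where 'a='a] by simp
    show "AE t in lborel. norm (h t) \<le> norm (C * exp (- c * (norm t)\<^sup>2))"
      using C C0 by (auto simp: h_def norm_mult)
  qed measurable
  have nn: "(\<lambda>t. exp (- c * (norm t)\<^sup>2) * (norm (four f t))\<^sup>2) = (\<lambda>t. norm (h t * cnj (four f t)))"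
    by (auto simp: h_def norm_mult power2_eq_square)
  have hc: "h t * cnj (four f t) = complex_of_real (exp (- c * (norm t)\<^sup>2) * (norm (four f t))\<^sup>2)" for t
    by (simp only: h_def mult.assoc complex_norm_square[symmetric] of_real_mult)
  have hi: "integrable lborel (\<lambda>t. h t * cnj (four f t))"
  proof (rule Bochner_Integration.integrable_bound)
    show "integrable lborel (\<lambda>t. C * norm (h t))" using h by simp
    show "AE t in lborel. norm (h t * cnj (four f t)) \<le> norm (C * norm (h t))"
      using C C0 by (intro AE_I2) (auto simp: norm_mult mult.commute[of C] intro!: mult_left_mono)
  qed measurable
  have cn: "cnj (four f t) = (LINT x|lborel. cnj (f x) * cis (- 2 * pi * (x \<bullet> t)))" for t
  proof -
    have "cnj (f x) * cis (- 2 * pi * (x \<bullet> t)) = cnj (f x * cis (2 * pi * (x \<bullet> t)))" for x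
      by (simp add: cis_cnj)
    then show ?thesis by (simp only: four_def Bochner_Integration.integral_cnj)
  qed
  have fub: "integrable (lborel \<Otimes>\<^sub>M lborel) (\<lambda>(t,x). h t * cnj (f x) * cis (- 2 * pi * (x \<bullet> t)))"
  proof (rule Bochner_Integration.integrable_bound)
    show "integrable (lborel \<Otimes>\<^sub>M lborel) (\<lambda>(t,x). h t * cnj (f x))"
      by (rule integrable_pair_mult) (use h f in auto)
    show "(\<lambda>(t,x). h t * cnj (f x) * cis (- 2 * pi * (x \<bullet> t))) \<in> borel_measurable (lborel \<Otimes>\<^sub>M lborel)" by measurable
  qed (auto simp: norm_mult)
  have "(LINT t|lborel. h t * cnj (four f t)) = (LINT t|lborel. LINT x|lborel. h t * cnj (f x) * cis (- 2 * pi * (x \<bullet> t)))"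
    unfolding cn by (simp only: mult.assoc integral_mult_right_zero)
  also have "\<dots> = (LINT x|lborel. LINT t|lborel. h t * cnj (f x) * cis (- 2 * pi * (x \<bullet> t)))"
    by (rule lborel_pair.Fubini_integral[OF fub, symmetric])
  also have "\<dots> = (LINT x|lborel. cnj (f x) * (LINT t|lborel. h t * cis (- 2 * pi * (x \<bullet> t))))"
    by (simp only: integral_mult_right_zero[symmetric] mult_ac)
  also have "\<dots> = (LINT x|lborel. (LINT y|lborel. cnj (f x) * (f y * heat c (y - x))))"
    using gauss_four[OF f c] by (simp only: h_def integral_mult_right_zero)
  finally have eq: "(LINT t|lborel. h t * cnj (four f t)) = (LINT x|lborel. (LINT y|lborel. cnj (f x) * (f y * heat c (y - x))))" .
  let ?N = "\<integral>\<^sup>+x. ennreal ((norm (f x))\<^sup>2) \<partial>lborel"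
  have "(\<integral>\<^sup>+t. ennreal (exp (- c * (norm t)\<^sup>2) * (norm (four f t))\<^sup>2) \<partial>lborel) = ennreal (LINT t|lborel. exp (- c * (norm t)\<^sup>2) * (norm (four f t))\<^sup>2)"
    using integrable_norm[OF hi] by (subst nn_integral_eq_integral) (simp_all only: nn, auto)
  also have "(LINT t|lborel. exp (- c * (norm t)\<^sup>2) * (norm (four f t))\<^sup>2) = norm (LINT t|lborel. h t * cnj (four f t))"
    unfolding hc integral_complex_of_real norm_of_real by (intro abs_of_nonneg[symmetric] integral_nonneg_AE) auto
  also have "ennreal \<dots> \<le> (\<integral>\<^sup>+x. ennreal (norm (LINT y|lborel. cnj (f x) * (f y * heat c (y - x)))) \<partial>lborel)"
    unfolding eq by (rule norm_integral_le_nn_integral)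
  also have "\<dots> \<le> (\<integral>\<^sup>+x. \<integral>\<^sup>+y. ennreal (norm (cnj (f x) * (f y * heat c (y - x)))) \<partial>lborel \<partial>lborel)"
    by (intro nn_integral_mono norm_integral_le_nn_integral)
  also have "\<dots> \<le> (\<integral>\<^sup>+x. \<integral>\<^sup>+y. ennreal (1/2) * (ennreal ((norm (f x))\<^sup>2) * ennreal (heat c (y - x)) + ennreal ((norm (f y))\<^sup>2) * ennreal (heat c (y - x))) \<partial>lborel \<partial>lborel)"
  proof (intro nn_integral_mono)
    fix x y :: 'a
    have "norm (f x) * norm (f y) \<le> 1/2 * ((norm (f x))\<^sup>2 + (norm (f y))\<^sup>2)"
      using sum_squares_bound[of "norm (f x)" "norm (f y)"] by simp
    then have "norm (f x) * norm (f y) * heat c (y - x) \<le> 1/2 * ((norm (f x))\<^sup>2 + (norm (f y))\<^sup>2) * heat c (y - x)"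
      by (rule mult_right_mono) (use heat_nonneg[OF c] in auto)
    then have "norm (cnj (f x) * (f y * heat c (y - x))) \<le> 1/2 * ((norm (f x))\<^sup>2 * heat c (y - x) + (norm (f y))\<^sup>2 * heat c (y - x))"
      using heat_nonneg[OF c, of "y - x"] by (simp add: norm_mult algebra_simps)
    then have "ennreal (norm (cnj (f x) * (f y * heat c (y - x)))) \<le> ennreal (1/2 * ((norm (f x))\<^sup>2 * heat c (y - x) + (norm (f y))\<^sup>2 * heat c (y - x)))"
      by (rule ennreal_leI)
    also have "\<dots> = ennreal (1/2) * (ennreal ((norm (f x))\<^sup>2) * ennreal (heat c (y - x)) + ennreal ((norm (f y))\<^sup>2) * ennreal (heat c (y - x)))"
      by (subst ennreal_mult) (auto simp: ennreal_mult[symmetric] heat_nonneg[OF c])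
    finally show "ennreal (norm (cnj (f x) * (f y * heat c (y - x)))) \<le> ennreal (1/2) * (ennreal ((norm (f x))\<^sup>2) * ennreal (heat c (y - x)) + ennreal ((norm (f y))\<^sup>2) * ennreal (heat c (y - x)))" .
  qed
  also have "\<dots> = ennreal (1/2) * ((\<integral>\<^sup>+x. \<integral>\<^sup>+y. ennreal ((norm (f x))\<^sup>2) * ennreal (heat c (y - x)) \<partial>lborel \<partial>lborel)
      + (\<integral>\<^sup>+x. \<integral>\<^sup>+y. ennreal ((norm (f y))\<^sup>2) * ennreal (heat c (y - x)) \<partial>lborel \<partial>lborel))"
    by (simp add: nn_integral_add nn_integral_cmult)
  also have "(\<integral>\<^sup>+x. \<integral>\<^sup>+y. ennreal ((norm (f y))\<^sup>2) * ennreal (heat c (y - x)) \<partial>lborel \<partial>lborel)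
     = (\<integral>\<^sup>+y. \<integral>\<^sup>+x. ennreal ((norm (f y))\<^sup>2) * ennreal (heat c (y - x)) \<partial>lborel \<partial>lborel)"
    by (rule lborel_pair.Fubini') measurable
  also have "\<dots> = ?N"
    by (subst heat_minus) (simp add: nn_integral_cmult nn_integral_heat[OF c])
  also have "(\<integral>\<^sup>+x. \<integral>\<^sup>+y. ennreal ((norm (f x))\<^sup>2) * ennreal (heat c (y - x)) \<partial>lborel \<partial>lborel) = ?N"
    by (simp add: nn_integral_cmult nn_integral_heat[OF c])
  also have "ennreal (1/2) * (?N + ?N) = ?N"
  proof -
    have "ennreal (1/2) + ennreal (1/2) = 1"
      by (subst ennreal_plus[symmetric]) (auto simp del: ennreal_plus)
    moreover have "ennreal (1/2) * (?N + ?N) = (ennreal (1/2) + ennreal (1/2)) * ?N"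
      by (simp only: distrib_left distrib_right)
    ultimately show ?thesis by (simp only: mult_1)
  qed
  finally show ?thesis .
qed

text \<open>The bound in \<open>bessel_gauss\<close> is uniform in the damping, so Fatou's lemma
  lets the damping tend to 0.\<close>

theorem bessel:
  fixes f :: "'a::euclidean_space \<Rightarrow> complex"
  assumes f: "integrable lborel f"
  shows "(\<integral>\<^sup>+t. ennreal ((norm (four f t))\<^sup>2) \<partial>lborel) \<le> (\<integral>\<^sup>+x. ennreal ((norm (f x))\<^sup>2) \<partial>lborel)"
proof -
  note [measurable] = borel_measurable_four[OF f]
  define u where "u j t = ennreal (exp (- (1 / real (Suc j)) * (norm t)\<^sup>2) * (norm (four f t))\<^sup>2)" for j t
  have lim: "(\<lambda>j. u j t) \<longlonglongrightarrow> ennreal ((norm (four f t))\<^sup>2)" for t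
  proof -
    have "(\<lambda>j. exp (- (1 / real (Suc j)) * (norm t)\<^sup>2) * (norm (four f t))\<^sup>2) \<longlonglongrightarrow> exp (- 0 * (norm t)\<^sup>2) * (norm (four f t))\<^sup>2"
      by (intro tendsto_intros LIMSEQ_Suc[OF lim_inverse_n, unfolded inverse_eq_divide])
    then show ?thesis unfolding u_def by (intro tendsto_ennrealI) simp
  qed
  have "(\<integral>\<^sup>+t. ennreal ((norm (four f t))\<^sup>2) \<partial>lborel) = (\<integral>\<^sup>+t. liminf (\<lambda>j. u j t) \<partial>lborel)"
    by (intro nn_integral_cong lim_imp_Liminf[symmetric] lim) simp
  also have "\<dots> \<le> liminf (\<lambda>j. \<integral>\<^sup>+t. u j t \<partial>lborel)"
    by (rule nn_integral_liminf) (simp add: u_def)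
  also have "\<dots> \<le> (\<integral>\<^sup>+x. ennreal ((norm (f x))\<^sup>2) \<partial>lborel)"
    unfolding u_def by (intro Liminf_le always_eventually allI bessel_gauss[OF f]) auto
  finally show ?thesis .
qed

text \<open>The limit of the damped inversion integrals \<open>L j\<close> is found in two ways:
  dominated convergence on the transform side gives the undamped integral, while
  \<open>gauss_four\<close> turns \<open>L j\<close> into an average of \<open>f\<close> that
  concentrates at \<open>x\<close> and tends to \<open>f x\<close> by continuity.\<close>

theorem fourier_inversion:
  fixes f :: "'a::euclidean_space \<Rightarrow> complex"
  assumes f: "integrable lborel f" and cont: "continuous_on UNIV f" and bd: "\<And>x. norm (f x) \<le> M"
    and ff: "integrable lborel (four f)"
  shows "f x = (LINT t|lborel. four f t * cis (- 2 * pi * (x \<bullet> t)))"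
proof -
  note [measurable] = borel_measurable_integrable[OF f] borel_measurable_four[OF f]
  \<comment> \<open>The damping parameter is the square \<open>(s j)^2\<close>, so that rescaling by
    \<open>s j\<close> turns \<open>heat ((s j)^2)\<close> into the fixed profile
    \<open>heat 1\<close> and the dominating function does not depend on \<open>j\<close>.\<close>
  define s where "s j = 1 / real (Suc j)" for j
  have s: "s j > 0" for j by (simp add: s_def)
  have s0: "s \<longlonglongrightarrow> 0" unfolding s_def by (rule LIMSEQ_Suc[OF lim_inverse_n, unfolded inverse_eq_divide])
  have M: "M \<ge> 0" using bd[of x] norm_ge_zero order_trans by blast
  define L where "L j = (LINT t|lborel. complex_of_real (exp (- (s j)\<^sup>2 * (norm t)\<^sup>2)) * four f t * cis (- 2 * pi * (x \<bullet> t)))" for j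
  have "L \<longlonglongrightarrow> (LINT t|lborel. four f t * cis (- 2 * pi * (x \<bullet> t)))"
    unfolding L_def
  proof (rule integral_dominated_convergence)
    show "integrable lborel (\<lambda>t. norm (four f t))" using ff by simp
    show "AE t in lborel. (\<lambda>j. complex_of_real (exp (- (s j)\<^sup>2 * (norm t)\<^sup>2)) * four f t * cis (- 2 * pi * (x \<bullet> t))) \<longlonglongrightarrow> four f t * cis (- 2 * pi * (x \<bullet> t))"
    proof (rule AE_I2)
      fix t
      have "(\<lambda>j. complex_of_real (exp (- (s j)\<^sup>2 * (norm t)\<^sup>2)) * four f t * cis (- 2 * pi * (x \<bullet> t))) \<longlonglongrightarrow> complex_of_real (exp (- 0\<^sup>2 * (norm t)\<^sup>2)) * four f t * cis (- 2 * pi * (x \<bullet> t))"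
        by (intro tendsto_intros s0)
      then show "(\<lambda>j. complex_of_real (exp (- (s j)\<^sup>2 * (norm t)\<^sup>2)) * four f t * cis (- 2 * pi * (x \<bullet> t))) \<longlonglongrightarrow> four f t * cis (- 2 * pi * (x \<bullet> t))" by simp
    qed
    show "AE t in lborel. norm (complex_of_real (exp (- (s j)\<^sup>2 * (norm t)\<^sup>2)) * four f t * cis (- 2 * pi * (x \<bullet> t))) \<le> norm (four f t)" for j
      by (auto simp: norm_mult intro!: mult_left_le_one_le)
  qed measurable
  moreover have "L \<longlonglongrightarrow> (LINT u|lborel. f x * complex_of_real (heat 1 (u::'a)))"
  proof -
    have "L = (\<lambda>j. LINT u|lborel. f (x + s j *\<^sub>R u) * complex_of_real (heat 1 u))"
    proof (rule ext)
      fix j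
      have h: "s j ^ DIM('a) * heat ((s j)\<^sup>2) (s j *\<^sub>R u) = heat 1 u" for u :: 'a
        using s[of j] by (simp add: heat_def real_sqrt_divide power_mult_distrib power_divide)
      have "L j = (LINT y|lborel. f y * heat ((s j)\<^sup>2) (y - x))"
        unfolding L_def by (rule gauss_four[OF f]) (use s[of j] in simp)
      also have "\<dots> = (LINT u|lborel. s j ^ DIM('a) *\<^sub>R (f (x + s j *\<^sub>R u) * heat ((s j)\<^sup>2) ((x + s j *\<^sub>R u) - x)))"
        by (rule lborel_integral_affine) (use s[of j] in measurable)
      also have "\<dots> = (LINT u|lborel. f (x + s j *\<^sub>R u) * complex_of_real (heat 1 u))"
        by (simp add: scaleR_conv_of_real mult_ac flip: h)
      finally show "L j = (LINT u|lborel. f (x + s j *\<^sub>R u) * complex_of_real (heat 1 u))" .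
    qed
    moreover have "(\<lambda>j. LINT u|lborel. f (x + s j *\<^sub>R u) * complex_of_real (heat 1 u)) \<longlonglongrightarrow> (LINT u|lborel. f x * complex_of_real (heat 1 (u::'a)))"
    proof (rule integral_dominated_convergence)
      show "integrable lborel (\<lambda>u::'a. M * heat 1 u)" using heat_integral(1)[of 1, where 'a='a] by simp
      show "AE u in lborel. (\<lambda>j. f (x + s j *\<^sub>R u) * complex_of_real (heat 1 u)) \<longlonglongrightarrow> f x * complex_of_real (heat 1 u)"
      proof (rule AE_I2)
        fix u :: 'a
        have "(\<lambda>j. x + s j *\<^sub>R u) \<longlonglongrightarrow> x + 0 *\<^sub>R u" by (intro tendsto_intros s0)
        then have "(\<lambda>j. f (x + s j *\<^sub>R u)) \<longlonglongrightarrow> f x"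
          by (intro isCont_tendsto_compose[of x f] continuous_on_interior[OF cont]) auto
        then show "(\<lambda>j. f (x + s j *\<^sub>R u) * complex_of_real (heat 1 u)) \<longlonglongrightarrow> f x * complex_of_real (heat 1 u)"
          by (intro tendsto_intros)
      qed
      show "AE u in lborel. norm (f (x + s j *\<^sub>R u) * complex_of_real (heat 1 u)) \<le> M * heat 1 u" for j
        using bd heat_nonneg[of 1, where 'a='a] by (intro AE_I2) (auto simp: norm_mult intro!: mult_mono M)
    qed measurable
    ultimately show ?thesis by (simp only:)
  qed
  ultimately have "(LINT t|lborel. four f t * cis (- 2 * pi * (x \<bullet> t))) = (LINT u|lborel. f x * complex_of_real (heat 1 (u::'a)))"
    by (rule LIMSEQ_unique)
  also have "\<dots> = f x" using heat_integral(2)[of 1, where 'a='a] by simp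
  finally show ?thesis by simp
qed

subsection \<open>Holomorphic functions on tubes\<close>

lemma nn_integral_lborel_affine:
  fixes f :: "'a::euclidean_space \<Rightarrow> ennreal"
  assumes [measurable]: "f \<in> borel_measurable borel" and c: "c \<noteq> 0"
  shows "(\<integral>\<^sup>+x. f x \<partial>lborel) = ennreal (\<bar>c\<bar> ^ DIM('a)) * (\<integral>\<^sup>+x. f (t + c *\<^sub>R x) \<partial>lborel)"
  by (subst lborel_affine[OF c, of t]) (simp add: nn_integral_density nn_integral_distr nn_integral_cmult)

lemma nn_integral_lborel_translate:
  fixes f :: "'a::euclidean_space \<Rightarrow> ennreal"
  assumes [measurable]: "f \<in> borel_measurable borel"
  shows "(\<integral>\<^sup>+x. f (t + x) \<partial>lborel) = (\<integral>\<^sup>+x. f x \<partial>lborel)"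
  using nn_integral_lborel_affine[OF assms, of 1 t] by simp

lemma integral_lborel_translate:
  fixes f :: "'a::euclidean_space \<Rightarrow> 'b::{banach, second_countable_topology}"
  assumes [measurable]: "f \<in> borel_measurable borel"
  shows "(LINT x|lborel. f (t + x)) = (LINT x|lborel. f x)"
  using lborel_integral_affine[OF assms, of 1 t] by simp

text \<open>Reading the pair as \<open>p + i q\<close>, the map is multiplication by the unimodular
  number \<open>a + i b\<close>. For \<open>a \<noteq> 0\<close> it is undone one real vector
  variable at a time, with mutually inverse Jacobians; for \<open>a = 0\<close> it exchanges the
  variables up to sign.\<close>

lemma nn_integral_complex_rotation:
  fixes g :: "'a::euclidean_space \<Rightarrow> 'a \<Rightarrow> ennreal"
  assumes gm: "case_prod g \<in> borel_measurable (lborel \<Otimes>\<^sub>M lborel)" and ab: "a\<^sup>2 + b\<^sup>2 = (1::real)"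
  shows "(\<integral>\<^sup>+q. \<integral>\<^sup>+p. g (a *\<^sub>R p - b *\<^sub>R q) (b *\<^sub>R p + a *\<^sub>R q) \<partial>lborel \<partial>lborel) = (\<integral>\<^sup>+p. \<integral>\<^sup>+q. g p q \<partial>lborel \<partial>lborel)"
proof -
  have [measurable]: "(\<lambda>x. g (f x) (h x)) \<in> borel_measurable M" if "f \<in> borel_measurable M" "h \<in> borel_measurable M" for f h :: "'c \<Rightarrow> 'a" and M
    using measurable_compose[OF measurable_Pair[of f M lborel h lborel] gm] that by simp
  show ?thesis
  proof (cases "a = 0")
    case True
    then have b: "b = 1 \<or> b = -1" using ab by (simp add: power2_eq_1_iff)
    then have b0: "- b \<noteq> 0" "b \<noteq> 0" "\<bar>b\<bar> = 1" by auto
    have "(\<integral>\<^sup>+q. \<integral>\<^sup>+p. g (- b *\<^sub>R q) (b *\<^sub>R p) \<partial>lborel \<partial>lborel) = (\<integral>\<^sup>+q. \<integral>\<^sup>+p. g (- b *\<^sub>R q) p \<partial>lborel \<partial>lborel)"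
    proof (rule nn_integral_cong)
      fix q :: 'a
      show "(\<integral>\<^sup>+p. g (- b *\<^sub>R q) (b *\<^sub>R p) \<partial>lborel) = (\<integral>\<^sup>+p. g (- b *\<^sub>R q) p \<partial>lborel)"
        using nn_integral_lborel_affine[OF _ b0(2), of "\<lambda>p. g (- b *\<^sub>R q) p" 0] b0(3) by simp
    qed
    also have "\<dots> = (\<integral>\<^sup>+q. \<integral>\<^sup>+p. g q p \<partial>lborel \<partial>lborel)"
      using nn_integral_lborel_affine[OF _ b0(1), of "\<lambda>q. \<integral>\<^sup>+p. g q p \<partial>lborel" 0] b0(3) by simp
    finally show ?thesis using True by simp
  next
    case False
    define A where "A = ennreal (\<bar>a\<bar> ^ DIM('a))"
    define A' where "A' = ennreal (\<bar>1 / a\<bar> ^ DIM('a))"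
    have AA: "A' * A = 1"
      unfolding A_def A'_def by (subst ennreal_mult[symmetric]) (auto simp: False simp flip: power_mult_distrib)
    have "(\<integral>\<^sup>+q. \<integral>\<^sup>+p. g (a *\<^sub>R p - b *\<^sub>R q) (b *\<^sub>R p + a *\<^sub>R q) \<partial>lborel \<partial>lborel)
        = (\<integral>\<^sup>+q. \<integral>\<^sup>+p. A' * g p ((b / a) *\<^sub>R p + (1 / a) *\<^sub>R q) \<partial>lborel \<partial>lborel)"
    proof (rule nn_integral_cong)
      fix q :: 'a
      have *: "(b / a) *\<^sub>R (- (b *\<^sub>R q) + a *\<^sub>R p) + (1 / a) *\<^sub>R q = b *\<^sub>R p + a *\<^sub>R q" for p :: 'a
      proof -
        \<comment> \<open>The normalization of \<open>a\<close> and \<open>b\<close> enters here: it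
          makes the second argument, rewritten in the new first variable, equal to
          \<open>b p + a q\<close>.\<close>
        have "1 / a - b * b / a = a" using ab False by (simp add: field_simps power2_eq_square)
        then have "b *\<^sub>R p + (1 / a - b * b / a) *\<^sub>R q = b *\<^sub>R p + a *\<^sub>R q" by simp
        then show ?thesis using False by (simp add: algebra_simps)
      qed
      have "(\<integral>\<^sup>+p. g p ((b / a) *\<^sub>R p + (1 / a) *\<^sub>R q) \<partial>lborel)
         = A * (\<integral>\<^sup>+p. g (- (b *\<^sub>R q) + a *\<^sub>R p) ((b / a) *\<^sub>R (- (b *\<^sub>R q) + a *\<^sub>R p) + (1 / a) *\<^sub>R q) \<partial>lborel)"
        unfolding A_def by (rule nn_integral_lborel_affine) (use False in measurable)
      also have "\<dots> = A * (\<integral>\<^sup>+p. g (a *\<^sub>R p - b *\<^sub>R q) (b *\<^sub>R p + a *\<^sub>R q) \<partial>lborel)"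
        unfolding * by simp
      finally have 1: "(\<integral>\<^sup>+p. g p ((b / a) *\<^sub>R p + (1 / a) *\<^sub>R q) \<partial>lborel) = A * (\<integral>\<^sup>+p. g (a *\<^sub>R p - b *\<^sub>R q) (b *\<^sub>R p + a *\<^sub>R q) \<partial>lborel)" .
      have "(\<integral>\<^sup>+p. A' * g p ((b / a) *\<^sub>R p + (1 / a) *\<^sub>R q) \<partial>lborel) = A' * (\<integral>\<^sup>+p. g p ((b / a) *\<^sub>R p + (1 / a) *\<^sub>R q) \<partial>lborel)"
        by (rule nn_integral_cmult) measurable
      then show "(\<integral>\<^sup>+p. g (a *\<^sub>R p - b *\<^sub>R q) (b *\<^sub>R p + a *\<^sub>R q) \<partial>lborel) = (\<integral>\<^sup>+p. A' * g p ((b / a) *\<^sub>R p + (1 / a) *\<^sub>R q) \<partial>lborel)"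
        by (simp add: 1 AA mult.assoc[symmetric])
    qed
    also have "\<dots> = (\<integral>\<^sup>+p. \<integral>\<^sup>+q. A' * g p ((b / a) *\<^sub>R p + (1 / a) *\<^sub>R q) \<partial>lborel \<partial>lborel)"
      by (rule lborel_pair.Fubini') measurable
    also have "\<dots> = (\<integral>\<^sup>+p. \<integral>\<^sup>+q. g p q \<partial>lborel \<partial>lborel)"
    proof (rule nn_integral_cong)
      fix p :: 'a
      have "(\<integral>\<^sup>+q. g p q \<partial>lborel) = A' * (\<integral>\<^sup>+q. g p ((b / a) *\<^sub>R p + (1 / a) *\<^sub>R q) \<partial>lborel)"
        unfolding A'_def by (rule nn_integral_lborel_affine) (use False in auto)
      then show "(\<integral>\<^sup>+q. A' * g p ((b / a) *\<^sub>R p + (1 / a) *\<^sub>R q) \<partial>lborel) = (\<integral>\<^sup>+q. g p q \<partial>lborel)"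
        by (simp add: nn_integral_cmult)
    qed
    finally show ?thesis .
  qed
qed

text \<open>The Cauchy inequality turns the bound \<open>h t\<close> on values into the bound
  \<open>h t / r\<close> on derivatives, hence on difference quotients, so dominated convergence
  applies along every sequence tending to \<open>z0\<close>.\<close>

lemma holomorphic_on_integral:
  fixes f :: "'b \<Rightarrow> complex \<Rightarrow> complex"
  assumes U: "open U" and hol: "\<And>t. f t holomorphic_on U"
    and meas: "\<And>z. z \<in> U \<Longrightarrow> (\<lambda>t. f t z) \<in> borel_measurable M"
    and bd: "\<And>t z. z \<in> U \<Longrightarrow> norm (f t z) \<le> h t" and h: "integrable M h"
  shows "(\<lambda>z. LINT t|M. f t z) holomorphic_on U"
  unfolding holomorphic_on_def
proof
  fix z0 assume z0: "z0 \<in> U"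
  obtain r0 where r0: "r0 > 0" "cball z0 r0 \<subseteq> U" using U z0 open_contains_cball by blast
  \<comment> \<open>Half the radius, so that each disc of radius \<open>r\<close> about a point of
    \<open>ball z0 r\<close> still lies in \<open>U\<close>.\<close>
  define r where "r = r0 / 2"
  have r: "r > 0" "cball z0 (2 * r) \<subseteq> U" using r0 by (auto simp: r_def)
  have fi: "integrable M (\<lambda>t. f t z)" if "z \<in> U" for z
    by (rule Bochner_Integration.integrable_bound[OF h meas[OF that]]) (use bd[OF that] in \<open>auto intro: order.trans[OF _ abs_ge_self]\<close>)
  have lip: "norm (f t z - f t z0) \<le> (h t / r) * norm (z - z0)" if z: "z \<in> ball z0 r" for t z
  proof (rule field_differentiable_bound)
    show "convex (ball z0 r)" by simp
    show "z \<in> ball z0 r" "z0 \<in> ball z0 r" using z r by auto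
  next
    fix w assume w: "w \<in> ball z0 r"
    have sub: "cball w r \<subseteq> U"
    proof
      fix u assume "u \<in> cball w r"
      then have "dist z0 u \<le> 2 * r" using w dist_triangle[of z0 u w] by auto
      then show "u \<in> U" using r(2) by (auto simp: mem_cball)
    qed
    have "norm ((deriv ^^ 1) (f t) w) \<le> fact 1 * h t / r ^ 1"
    proof (rule Cauchy_inequality)
      show "f t holomorphic_on ball w r" using hol sub ball_subset_cball holomorphic_on_subset by blast
      show "continuous_on (cball w r) (f t)" using hol sub holomorphic_on_imp_continuous_on continuous_on_subset by blast
      show "norm (f t x) \<le> h t" if "norm (w - x) = r" for x
        by (rule bd) (use that sub in \<open>auto simp: dist_norm\<close>)
    qed (use r in auto)
    then show "norm (deriv (f t) w) \<le> h t / r" by simp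
    have "w \<in> U" using sub r by auto
    then have "(f t has_field_derivative deriv (f t) w) (at w)" by (rule holomorphic_derivI[OF hol U])
    then show "(f t has_field_derivative deriv (f t) w) (at w within ball z0 r)"
      by (rule has_field_derivative_at_within)
  qed
  let ?Q = "\<lambda>t z. (f t z - f t z0) / (z - z0)"
  have "((\<lambda>z. LINT t|M. f t z) has_field_derivative (LINT t|M. deriv (f t) z0)) (at z0 within ball z0 r)"
    unfolding has_field_derivative_iff tendsto_at_iff_sequentially
  proof (intro allI impI)
    fix X assume X: "\<forall>i. X i \<in> ball z0 r - {z0}" and X0: "X \<longlonglongrightarrow> z0"
    have XU: "X i \<in> U" for i
    proof -
      have "X i \<in> ball z0 r" using X by auto
      then show ?thesis using r by (auto simp: subset_iff)
    qed
    have "(\<lambda>i. LINT t|M. ?Q t (X i)) \<longlonglongrightarrow> (LINT t|M. deriv (f t) z0)"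
    proof (rule integral_dominated_convergence)
      show "integrable M (\<lambda>t. h t / r)" using h by simp
      have m: "(\<lambda>t. ?Q t (X i)) \<in> borel_measurable M" for i
        using meas[OF XU[of i]] meas[OF z0] by measurable
      then show "\<And>i. (\<lambda>t. ?Q t (X i)) \<in> borel_measurable M" .
      have lim: "(\<lambda>i. ?Q t (X i)) \<longlonglongrightarrow> deriv (f t) z0" for t
      proof -
        have "(f t has_field_derivative deriv (f t) z0) (at z0 within ball z0 r)"
          by (rule has_field_derivative_at_within[OF holomorphic_derivI[OF hol U z0]])
        then show ?thesis
          unfolding has_field_derivative_iff tendsto_at_iff_sequentially using X X0 by (simp add: o_def)
      qed
      then show "AE t in M. (\<lambda>i. ?Q t (X i)) \<longlonglongrightarrow> deriv (f t) z0" by simp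
      show "(\<lambda>t. deriv (f t) z0) \<in> borel_measurable M"
        by (rule borel_measurable_LIMSEQ_metric[OF m lim])
      show "AE t in M. norm (?Q t (X i)) \<le> h t / r" for i
      proof (rule AE_I2)
        fix t
        have "X i \<in> ball z0 r" "X i \<noteq> z0" using X by auto
        then show "norm (?Q t (X i)) \<le> h t / r"
          using lip[of "X i" t] by (simp add: norm_divide divide_le_eq)
      qed
    qed
    moreover have "(LINT t|M. ?Q t (X i)) = ((LINT t|M. f t (X i)) - (LINT t|M. f t z0)) / (X i - z0)" for i
      by (simp only: integral_divide_zero Bochner_Integration.integral_diff[OF fi[OF XU] fi[OF z0]])
    ultimately show "((\<lambda>z. ((LINT t|M. f t z) - (LINT t|M. f t z0)) / (z - z0)) \<circ> X) \<longlonglongrightarrow> (LINT t|M. deriv (f t) z0)"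
      by (simp only: o_def)
  qed
  then have "((\<lambda>z. LINT t|M. f t z) has_field_derivative (LINT t|M. deriv (f t) z0)) (at z0)"
    using r by (subst (asm) at_within_open) auto
  then show "(\<lambda>z. LINT t|M. f t z) field_differentiable at z0 within U"
    unfolding field_differentiable_def using has_field_derivative_at_within by blast
qed

section \<open>Real and imaginary coordinates on a tube\<close>

lemma cvec_nth [simp]: "cvec x y $ k = Complex (x $ k) (y $ k)"
  by (simp add: cvec_def complex_eq_iff)

lemma cvec_in_tube [simp]: "cvec x y \<in> tube B \<longleftrightarrow> y \<in> B"
proof
  assume "cvec x y \<in> tube B"
  then obtain x' y' where "cvec x y = cvec x' y'" "y' \<in> B" by (auto simp: tube_def)
  moreover from this have "y = y'" by (simp add: vec_eq_iff)
  ultimately show "y \<in> B" by simp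
qed (auto simp: tube_def)

lemma tubeE: "z \<in> tube B \<Longrightarrow> (\<And>x y. z = cvec x y \<Longrightarrow> y \<in> B \<Longrightarrow> thesis) \<Longrightarrow> thesis"
  by (auto simp: tube_def)

lemma cvec_line: "cvec x y + \<zeta> *s cvec p q = cvec (x + (Re \<zeta> *\<^sub>R p - Im \<zeta> *\<^sub>R q)) (y + (Im \<zeta> *\<^sub>R p + Re \<zeta> *\<^sub>R q))"
  by (simp add: vec_eq_iff complex_eq_iff)

lemma continuous_on_cvec [continuous_intros]:
  "continuous_on S f \<Longrightarrow> continuous_on S g \<Longrightarrow> continuous_on S (\<lambda>u. cvec (f u) (g u))"
  unfolding cvec_def by (intro continuous_intros)

text \<open>One-variable theory enters through complex lines: along such a line the complex linear
  Frechet derivative becomes multiplication by a complex number.\<close>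

lemma sholomorphic_on_line:
  assumes F: "sholomorphic_on F U" and S: "open S" "\<And>\<zeta>. \<zeta> \<in> S \<Longrightarrow> z + \<zeta> *s w \<in> U"
  shows "(\<lambda>\<zeta>. F (z + \<zeta> *s w)) holomorphic_on S"
  unfolding holomorphic_on_def
proof
  fix \<zeta> assume \<zeta>: "\<zeta> \<in> S"
  obtain c :: "complex ^ 'a" where c: "(F has_derivative (\<lambda>h. \<Sum>k\<in>UNIV. c $ k * h $ k)) (at (z + \<zeta> *s w))"
    using F S(2)[OF \<zeta>] unfolding sholomorphic_on_def by blast
  have "linear (\<lambda>\<zeta>. \<zeta> *s w)"
    by (rule linearI) (auto simp: vec_eq_iff algebra_simps)
  then have "((\<lambda>\<zeta>. \<zeta> *s w) has_derivative (\<lambda>h. h *s w)) (at \<zeta>)"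
    by (intro bounded_linear_imp_has_derivative) (simp add: linear_conv_bounded_linear)
  from has_derivative_add[OF has_derivative_const[of z] this]
  have "((\<lambda>\<zeta>. z + \<zeta> *s w) has_derivative (\<lambda>h. h *s w)) (at \<zeta>)" by simp
  from has_derivative_compose[OF this c]
  have "((\<lambda>\<zeta>. F (z + \<zeta> *s w)) has_derivative (\<lambda>h. (\<Sum>k\<in>UNIV. c $ k * w $ k) * h)) (at \<zeta>)"
    by (simp add: sum_distrib_right sum_distrib_left mult_ac)
  then have "((\<lambda>\<zeta>. F (z + \<zeta> *s w)) has_field_derivative (\<Sum>k\<in>UNIV. c $ k * w $ k)) (at \<zeta>)"
    by (simp add: has_field_derivative_def)
  then show "(\<lambda>\<zeta>. F (z + \<zeta> *s w)) field_differentiable at \<zeta> within S"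
    unfolding field_differentiable_def using has_field_derivative_at_within by blast
qed

lemma sholomorphic_on_imp_continuous_on: "sholomorphic_on F U \<Longrightarrow> continuous_on U F"
  unfolding sholomorphic_on_def
  by (intro continuous_at_imp_continuous_on ballI) (blast intro: has_derivative_continuous)

lemma continuous_on_tube_compose:
  assumes "continuous_on (tube B) F" "continuous_on S f" "continuous_on S g" "\<And>u. u \<in> S \<Longrightarrow> g u \<in> B"
  shows "continuous_on S (\<lambda>u. F (cvec (f u) (g u)))"
  by (rule continuous_on_compose2[OF assms(1)]) (auto intro!: continuous_intros assms)

text \<open>The average \<open>G \<zeta>\<close> of \<open>F (z + \<zeta> \<eta>)\<^sup>2\<close> over \<open>\<eta>\<close> in a ball is holomorphic in \<open>\<zeta>\<close>, and for \<open>\<bar>\<zeta>\<bar> = 1\<close> the map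
  \<open>\<eta> \<mapsto> \<zeta> \<eta>\<close> preserves Lebesgue measure; so the maximum principle bounds \<open>G 0\<close>.\<close>

lemma local_mean_bound:
  fixes F :: "complex ^ 'n \<Rightarrow> complex" and y :: "real ^ 'n"
  assumes B: "open B" and F: "sholomorphic_on F (tube B)" and c: "c > 0" and sub: "cball y0 c \<subseteq> B"
    and y: "norm (y - y0) \<le> c / 2"
  shows "ennreal (measure lborel (cball (0 :: (real ^ 'n) \<times> (real ^ 'n)) (c / 8)) * (cmod (F (cvec x y)))\<^sup>2)
    \<le> (\<integral>\<^sup>+\<eta>. \<integral>\<^sup>+\<xi>. ennreal (indicator (cball y0 c) \<eta> * (cmod (F (cvec \<xi> \<eta>)))\<^sup>2) \<partial>lborel \<partial>lborel)" (is "_ \<le> ?R")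
proof (cases "?R = \<infinity>")
  case False
  \<comment> \<open>For \<open>\<zeta>\<close> in the disc of radius 2 the imaginary part moves by
    at most \<open>4 * \<delta> = c / 2\<close>, and \<open>y\<close> is within \<open>c / 2\<close>
    of \<open>y0\<close>, so the whole family stays over \<open>cball y0 c\<close>. The radius 2
    leaves room around the unit circle.\<close>
  define \<delta> where "\<delta> = c / 8"
  have \<delta>: "\<delta> > 0" "c = 8 * \<delta>" using c by (auto simp: \<delta>_def)
  let ?S = "cball (0 :: (real ^ 'n) \<times> (real ^ 'n)) \<delta>"
  define N where "N \<xi> \<eta> = ennreal (indicator (cball y0 c) \<eta> * (cmod (F (cvec \<xi> \<eta>)))\<^sup>2)" for \<xi> \<eta> :: "real ^ 'n"
  have contF: "continuous_on (tube B) F" using F by (rule sholomorphic_on_imp_continuous_on)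
  have Nm: "case_prod N \<in> borel_measurable (lborel \<Otimes>\<^sub>M lborel)"
  proof -
    have "(\<lambda>u. indicator (UNIV \<times> cball y0 c) u *\<^sub>R (cmod (F (cvec (fst u) (snd u))))\<^sup>2) \<in> borel_measurable borel"
      by (intro borel_measurable_continuous_on_indicator continuous_intros continuous_on_tube_compose[OF contF])
        (use sub in \<open>auto intro!: borel_closed closed_Times\<close>)
    then have "(\<lambda>u. ennreal (indicator (UNIV \<times> cball y0 c) u *\<^sub>R (cmod (F (cvec (fst u) (snd u))))\<^sup>2)) \<in> borel_measurable (lborel \<Otimes>\<^sub>M lborel)"
      by (simp add: lborel_prod)
    also have "(\<lambda>u. ennreal (indicator (UNIV \<times> cball y0 c) u *\<^sub>R (cmod (F (cvec (fst u) (snd u))))\<^sup>2)) = case_prod N"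
      by (auto simp: N_def fun_eq_iff indicator_def)
    finally show ?thesis .
  qed
  have Nm': "(\<lambda>x. N (f x) (h x)) \<in> borel_measurable M" if "f \<in> borel_measurable M" "h \<in> borel_measurable M" for f h :: "'c \<Rightarrow> real ^ 'n" and M
    using measurable_compose[OF measurable_Pair[of f M lborel h lborel] Nm] that by simp
  note [measurable] = Nm'
  define D where "D t \<zeta> = cvec x y + \<zeta> *s cvec (fst t) (snd t)" for t :: "(real ^ 'n) \<times> (real ^ 'n)" and \<zeta>
  have D: "D t \<zeta> = cvec (x + (Re \<zeta> *\<^sub>R fst t - Im \<zeta> *\<^sub>R snd t)) (y + (Im \<zeta> *\<^sub>R fst t + Re \<zeta> *\<^sub>R snd t))" for t \<zeta>
    unfolding D_def by (rule cvec_line)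
  have small: "norm (a *\<^sub>R fst t) \<le> 2 * \<delta>" "norm (a *\<^sub>R snd t) \<le> 2 * \<delta>" if "t \<in> ?S" "\<bar>a\<bar> \<le> 2" for a t
  proof -
    have "norm (fst t) \<le> \<delta>" "norm (snd t) \<le> \<delta>" using that norm_fst_le[of "fst t" "snd t"] norm_snd_le[of "snd t" "fst t"] by auto
    then show "norm (a *\<^sub>R fst t) \<le> 2 * \<delta>" "norm (a *\<^sub>R snd t) \<le> 2 * \<delta>" using that(2) by (auto intro!: mult_mono)
  qed
  have Dy: "y + (Im \<zeta> *\<^sub>R fst t + Re \<zeta> *\<^sub>R snd t) \<in> cball y0 c"
    and Dx: "x + (Re \<zeta> *\<^sub>R fst t - Im \<zeta> *\<^sub>R snd t) \<in> cball x c" if "t \<in> ?S" "\<zeta> \<in> ball 0 2" for t \<zeta>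
  proof -
    have \<zeta>: "\<bar>Re \<zeta>\<bar> \<le> 2" "\<bar>Im \<zeta>\<bar> \<le> 2" using abs_Re_le_cmod[of \<zeta>] abs_Im_le_cmod[of \<zeta>] that by auto
    note s = small(1)[OF that(1) \<zeta>(1)] small(2)[OF that(1) \<zeta>(1)] small(1)[OF that(1) \<zeta>(2)] small(2)[OF that(1) \<zeta>(2)]
    have "norm (y - y0 + (Im \<zeta> *\<^sub>R fst t + Re \<zeta> *\<^sub>R snd t)) \<le> c / 2 + (2 * \<delta> + 2 * \<delta>)"
      by (intro norm_triangle_mono y s)
    moreover have "dist y0 (y + (Im \<zeta> *\<^sub>R fst t + Re \<zeta> *\<^sub>R snd t)) = norm (y - y0 + (Im \<zeta> *\<^sub>R fst t + Re \<zeta> *\<^sub>R snd t))"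
      by (subst dist_commute) (simp add: dist_norm algebra_simps)
    ultimately show "y + (Im \<zeta> *\<^sub>R fst t + Re \<zeta> *\<^sub>R snd t) \<in> cball y0 c" using \<delta> by simp
    have "norm (Re \<zeta> *\<^sub>R fst t - Im \<zeta> *\<^sub>R snd t) \<le> 2 * \<delta> + 2 * \<delta>"
      using norm_triangle_ineq4[of "Re \<zeta> *\<^sub>R fst t" "Im \<zeta> *\<^sub>R snd t"] s by simp
    then show "x + (Re \<zeta> *\<^sub>R fst t - Im \<zeta> *\<^sub>R snd t) \<in> cball x c" using \<delta> by (simp add: dist_norm norm_minus_commute)
  qed
  obtain K where K: "\<And>u. u \<in> cball x c \<times> cball y0 c \<Longrightarrow> (cmod (F (cvec (fst u) (snd u))))\<^sup>2 \<le> K"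
  proof -
    have "compact ((\<lambda>u. (cmod (F (cvec (fst u) (snd u))))\<^sup>2) ` (cball x c \<times> cball y0 c))"
      by (intro compact_continuous_image continuous_intros continuous_on_tube_compose[OF contF] compact_Times compact_cball)
        (use sub in auto)
    from compact_imp_bounded[OF this] show ?thesis
      unfolding bounded_iff using that by force
  qed
  \<comment> \<open>Squaring preserves holomorphy and makes the modulus \<open>|F|^2\<close>, the
    quantity that the integral on the right controls.\<close>
  define f where "f t \<zeta> = of_real (indicator ?S t) * (F (D t \<zeta>))\<^sup>2" for t \<zeta>
  define G where "G \<zeta> = (LINT t|lborel. f t \<zeta>)" for \<zeta>
  have G: "G holomorphic_on ball 0 2"
    unfolding G_def
  proof (rule holomorphic_on_integral)
    show "f t holomorphic_on ball 0 2" for t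
    proof (cases "t \<in> ?S")
      case True
      then have "(\<lambda>\<zeta>. F (D t \<zeta>)) holomorphic_on ball 0 2"
        unfolding D_def using Dy[OF True] sub
        by (intro sholomorphic_on_line[OF F]) (auto simp: cvec_line)
      then show ?thesis unfolding f_def by (intro holomorphic_intros)
    next
      case False
      then have "f t = (\<lambda>\<zeta>. 0)" by (simp add: f_def fun_eq_iff)
      then show ?thesis by simp
    qed
  next
    fix \<zeta> :: complex assume \<zeta>: "\<zeta> \<in> ball 0 2"
    have "(\<lambda>t. indicator ?S t *\<^sub>R (F (D t \<zeta>))\<^sup>2) \<in> borel_measurable borel"
      unfolding D
      by (intro borel_measurable_continuous_on_indicator continuous_intros continuous_on_tube_compose[OF contF])
        (use sub Dy[OF _ \<zeta>] in auto)
    then show "(\<lambda>t. f t \<zeta>) \<in> borel_measurable lborel" by (simp add: f_def scaleR_conv_of_real)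
    show "cmod (f t \<zeta>) \<le> K * indicator ?S t" for t
      using K[of "(x + (Re \<zeta> *\<^sub>R fst t - Im \<zeta> *\<^sub>R snd t), y + (Im \<zeta> *\<^sub>R fst t + Re \<zeta> *\<^sub>R snd t))"] Dx[OF _ \<zeta>, of t] Dy[OF _ \<zeta>, of t]
      by (auto simp: f_def norm_mult norm_power D indicator_def)
  next
    have "emeasure lborel ?S < \<infinity>" by (rule emeasure_bounded_finite) simp
    then show "integrable lborel (\<lambda>t. K * indicator ?S t)" by (intro integrable_mult_right integrable_real_indicator) auto
  qed simp
  define b where "b = enn2real ?R"
  have "?R < top" using False by (simp add: less_top)
  then have b: "?R = ennreal b" "b \<ge> 0" by (simp_all add: b_def)
  have circle: "cmod (G \<zeta>) \<le> b" if \<zeta>: "cmod (0 - \<zeta>) = 1" for \<zeta>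
  proof -
    have \<zeta>2: "\<zeta> \<in> ball 0 2" using \<zeta> by simp
    have ab: "(Re \<zeta>)\<^sup>2 + (Im \<zeta>)\<^sup>2 = 1" using \<zeta> cmod_power2[of \<zeta>] by simp
    let ?g = "\<lambda>\<xi> \<eta>. N (x + \<xi>) (y + \<eta>)"
    have "ennreal (cmod (G \<zeta>)) \<le> (\<integral>\<^sup>+t. ennreal (cmod (f t \<zeta>)) \<partial>lborel)"
      unfolding G_def by (rule norm_integral_le_nn_integral)
    \<comment> \<open>The ball of directions is given up here. Since \<open>N\<close> is extended by
      0 off \<open>cball y0 c\<close>, the integrand makes sense for all \<open>t\<close>, and
      invariance under rotation and translation applies on the whole space.\<close>
    also have "\<dots> \<le> (\<integral>\<^sup>+t. (\<lambda>(p, q). ?g (Re \<zeta> *\<^sub>R p - Im \<zeta> *\<^sub>R q) (Im \<zeta> *\<^sub>R p + Re \<zeta> *\<^sub>R q)) t \<partial>lborel)"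
    proof (rule nn_integral_mono)
      fix t
      show "ennreal (cmod (f t \<zeta>)) \<le> (\<lambda>(p, q). ?g (Re \<zeta> *\<^sub>R p - Im \<zeta> *\<^sub>R q) (Im \<zeta> *\<^sub>R p + Re \<zeta> *\<^sub>R q)) t"
        using Dy[OF _ \<zeta>2, of t] by (cases t) (auto simp: f_def N_def D norm_mult norm_power indicator_def)
    qed
    also have "\<dots> = (\<integral>\<^sup>+q. \<integral>\<^sup>+p. ?g (Re \<zeta> *\<^sub>R p - Im \<zeta> *\<^sub>R q) (Im \<zeta> *\<^sub>R p + Re \<zeta> *\<^sub>R q) \<partial>lborel \<partial>lborel)"
      by (simp only: lborel_prod[symmetric]) (subst lborel_pair.nn_integral_snd[symmetric]; simp)
    also have "\<dots> = (\<integral>\<^sup>+p. \<integral>\<^sup>+q. ?g p q \<partial>lborel \<partial>lborel)"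
      by (rule nn_integral_complex_rotation[OF _ ab]) measurable
    also have "\<dots> = (\<integral>\<^sup>+q. \<integral>\<^sup>+p. ?g p q \<partial>lborel \<partial>lborel)"
      by (rule lborel_pair.Fubini'[symmetric]) measurable
    also have "\<dots> = (\<integral>\<^sup>+q. \<integral>\<^sup>+p. N p (y + q) \<partial>lborel \<partial>lborel)"
      by (subst nn_integral_lborel_translate) auto
    also have "\<dots> = (\<integral>\<^sup>+\<eta>. \<integral>\<^sup>+\<xi>. N \<xi> \<eta> \<partial>lborel \<partial>lborel)"
      by (rule nn_integral_lborel_translate) measurable
    also have "\<dots> = ?R" by (simp add: N_def)
    finally show ?thesis using b by simp
  qed
  \<comment> \<open>The Cauchy inequality of order 0 on the unit circle serves as the maximum
    principle.\<close>
  have "cmod ((deriv ^^ 0) G 0) \<le> fact 0 * b / 1 ^ 0"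
  proof (rule Cauchy_inequality)
    show "G holomorphic_on ball 0 1" by (rule holomorphic_on_subset[OF G]) auto
    show "continuous_on (cball 0 1) G" by (rule continuous_on_subset[OF holomorphic_on_imp_continuous_on[OF G]]) auto
  qed (use circle in auto)
  moreover have "G 0 = of_real (measure lborel ?S) * (F (cvec x y))\<^sup>2"
    by (simp add: G_def f_def D)
  ultimately show ?thesis using b by (simp add: norm_mult norm_power \<delta>_def)
qed simp

section \<open>Gaussian and exponential factors\<close>

lemma sholomorphic_on_mult:
  assumes "sholomorphic_on F U" "sholomorphic_on G U"
  shows "sholomorphic_on (\<lambda>z. F z * G z) U"
  unfolding sholomorphic_on_def
proof
  fix z assume z: "z \<in> U"
  obtain c :: "complex ^ 'a" where c: "(F has_derivative (\<lambda>h. \<Sum>k\<in>UNIV. c $ k * h $ k)) (at z)"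
    using assms z unfolding sholomorphic_on_def by blast
  obtain d :: "complex ^ 'a" where d: "(G has_derivative (\<lambda>h. \<Sum>k\<in>UNIV. d $ k * h $ k)) (at z)"
    using assms z unfolding sholomorphic_on_def by blast
  have "((\<lambda>z. F z * G z) has_derivative (\<lambda>h. \<Sum>k\<in>UNIV. (\<chi> k. F z * d $ k + c $ k * G z) $ k * h $ k)) (at z)"
    using has_derivative_mult[OF c d] by (simp add: sum_distrib_left sum_distrib_right sum.distrib algebra_simps)
  then show "\<exists>c :: complex ^ 'a. ((\<lambda>z. F z * G z) has_derivative (\<lambda>h. \<Sum>k\<in>UNIV. c $ k * h $ k)) (at z)" by blast
qed

lemma sholomorphic_on_exp:
  assumes "sholomorphic_on P U" shows "sholomorphic_on (\<lambda>z. exp (P z)) U"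
  unfolding sholomorphic_on_def
proof
  fix z assume z: "z \<in> U"
  obtain c :: "complex ^ 'a" where c: "(P has_derivative (\<lambda>h. \<Sum>k\<in>UNIV. c $ k * h $ k)) (at z)"
    using assms z unfolding sholomorphic_on_def by blast
  have "(exp has_derivative (\<lambda>h. exp (P z) * h)) (at (P z))"
    using DERIV_exp[of "P z"] by (simp add: has_field_derivative_def)
  from has_derivative_compose[OF c this]
  have "((\<lambda>z. exp (P z)) has_derivative (\<lambda>h. \<Sum>k\<in>UNIV. (\<chi> k. exp (P z) * c $ k) $ k * h $ k)) (at z)"
    by (simp add: sum_distrib_left mult.assoc)
  then show "\<exists>c :: complex ^ 'a. ((\<lambda>z. exp (P z)) has_derivative (\<lambda>h. \<Sum>k\<in>UNIV. c $ k * h $ k)) (at z)" by blast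
qed

lemma has_derivative_sum_components:
  fixes z :: "complex ^ 'n"
  assumes "\<And>k. (p k has_field_derivative p' k (z $ k)) (at (z $ k))"
  shows "((\<lambda>z. \<Sum>k\<in>UNIV. p k (z $ k)) has_derivative (\<lambda>h. \<Sum>k\<in>UNIV. (\<chi> k. p' k (z $ k)) $ k * h $ k)) (at z)"
proof -
  have "((\<lambda>z. p k (z $ k)) has_derivative (\<lambda>h. p' k (z $ k) * h $ k)) (at z)" for k
    using has_derivative_compose[OF bounded_linear_imp_has_derivative[OF bounded_linear_vec_nth] assms[of k, unfolded has_field_derivative_def]]
    by simp
  then show ?thesis by (simp add: has_derivative_sum)
qed

lemma sholomorphic_on_gauss: "sholomorphic_on (\<lambda>z::complex ^ 'n. exp (\<Sum>k\<in>UNIV. a * z $ k * z $ k)) U"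
  by (rule sholomorphic_on_exp, unfold sholomorphic_on_def, intro ballI exI,
      rule has_derivative_sum_components[where p' = "\<lambda>k u. 2 * a * u"])
    (auto intro!: derivative_eq_intros)

lemma sholomorphic_on_exp_cdot: "sholomorphic_on (\<lambda>z::complex ^ 'n. exp (a * cdot z t)) U"
  unfolding cdot_def sum_distrib_left
  by (rule sholomorphic_on_exp, unfold sholomorphic_on_def, intro ballI exI,
      rule has_derivative_sum_components[where p' = "\<lambda>k u. a * of_real (t $ k)"])
    (auto intro!: derivative_eq_intros)

lemma norm_gauss_cvec: "cmod (exp (\<Sum>k\<in>UNIV. - of_real e * cvec x y $ k * cvec x y $ k)) = exp (- e * (norm x)\<^sup>2 + e * (norm y)\<^sup>2)"
proof -
  have n: "(norm v)\<^sup>2 = (\<Sum>k\<in>UNIV. (v $ k)\<^sup>2)" for v :: "real ^ 'a"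
    unfolding power2_norm_eq_inner inner_vec_def by (simp add: power2_eq_square)
  have "Re (\<Sum>k\<in>UNIV. - of_real e * cvec x y $ k * cvec x y $ k) = - e * (\<Sum>k\<in>UNIV. (x $ k)\<^sup>2) + e * (\<Sum>k\<in>UNIV. (y $ k)\<^sup>2)"
    by (simp add: sum_distrib_left power2_eq_square algebra_simps sum_subtractf sum_negf)
  then show ?thesis by (simp only: norm_exp_eq_Re n)
qed

lemma cdot_cvec: "cdot (cvec x y) t = Complex (x \<bullet> t) (y \<bullet> t)"
  by (simp add: cdot_def inner_vec_def complex_eq_iff)

lemma exp_cdot_cvec: "exp (2 * complex_of_real pi * \<i> * cdot (cvec x y) t) = of_real (exp (- 2 * pi * (y \<bullet> t))) * cis (2 * pi * (x \<bullet> t))"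
proof -
  have "2 * complex_of_real pi * \<i> * cdot (cvec x y) t = of_real (- 2 * pi * (y \<bullet> t)) + \<i> * of_real (2 * pi * (x \<bullet> t))"
    by (simp add: cdot_cvec complex_eq_iff)
  then show ?thesis by (simp only: exp_add cis_conv_exp exp_of_real)
qed

text \<open>Uniformity in \<open>y\<close> is asked only on small balls, with constants depending on
  the ball: this is enough to move a slice a little, and connectedness does the rest. The class is
  stable under multiplication by \<open>exp (- 2 pi i z.t)\<close>, whose modulus does not depend on
  \<open>x\<close> and is locally bounded in \<open>y\<close>.\<close>

definition gauss_dominated :: "(real ^ 'n) set \<Rightarrow> (complex ^ 'n \<Rightarrow> complex) \<Rightarrow> bool" where
  "gauss_dominated B H \<longleftrightarrow> sholomorphic_on H (tube B) \<and>
     (\<forall>y0\<in>B. \<exists>r>0. \<exists>C\<ge>0. \<exists>c>0. ball y0 r \<subseteq> B \<and> (\<forall>x. \<forall>y\<in>ball y0 r. cmod (H (cvec x y)) \<le> C * exp (- c * (norm x)\<^sup>2)))"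

lemma gauss_dominated_exp_cdot:
  assumes H: "gauss_dominated B H"
  shows "gauss_dominated B (\<lambda>z. H z * exp (- 2 * complex_of_real pi * \<i> * cdot z t))"
  unfolding gauss_dominated_def
proof (intro conjI ballI)
  show "sholomorphic_on (\<lambda>z. H z * exp (- 2 * complex_of_real pi * \<i> * cdot z t)) (tube B)"
    using H by (intro sholomorphic_on_mult sholomorphic_on_exp_cdot) (simp add: gauss_dominated_def)
  fix y0 assume "y0 \<in> B"
  then obtain r C c where r: "r > 0" "C \<ge> 0" "c > 0" "ball y0 r \<subseteq> B"
    and bd: "\<And>x y. y \<in> ball y0 r \<Longrightarrow> cmod (H (cvec x y)) \<le> C * exp (- c * (norm x)\<^sup>2)"
    using H unfolding gauss_dominated_def by blast
  define E where "E = exp (2 * pi * ((norm y0 + r) * norm t))"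
  have "cmod (H (cvec x y) * exp (- 2 * complex_of_real pi * \<i> * cdot (cvec x y) t)) \<le> (C * E) * exp (- c * (norm x)\<^sup>2)"
    if y: "y \<in> ball y0 r" for x y
  proof -
    have "norm y \<le> norm y0 + r" using y norm_triangle_ineq2[of y y0] by (simp add: dist_norm norm_minus_commute)
    then have "y \<bullet> t \<le> (norm y0 + r) * norm t"
      using norm_cauchy_schwarz[of y t] by (meson mult_right_mono norm_ge_zero order_trans)
    then have "cmod (exp (- 2 * complex_of_real pi * \<i> * cdot (cvec x y) t)) \<le> E"
      by (simp add: E_def cdot_cvec)
    from mult_mono[OF bd[OF y, of x] this] r(2) show ?thesis by (simp add: norm_mult mult_ac)
  qed
  moreover have "C * E \<ge> 0" using r by (simp add: E_def)
  ultimately show "\<exists>r>0. \<exists>C\<ge>0. \<exists>c>0. ball y0 r \<subseteq> B \<and> (\<forall>x. \<forall>y\<in>ball y0 r. cmod (H (cvec x y) * exp (- 2 * complex_of_real pi * \<i> * cdot (cvec x y) t)) \<le> C * exp (- c * (norm x)\<^sup>2))"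
    using r by blast
qed

text \<open>At \<open>x + i y\<close> the Gaussian factor has modulus
  \<open>exp (- e |x|^2 + e |y|^2)\<close>: the growing part is bounded on a ball of heights, and
  the decaying part supplies the domination.\<close>

lemma gauss_dominated_regularize:
  assumes F: "sholomorphic_on F (tube B)" and e: "e > 0"
    and bd: "\<And>y0. y0 \<in> B \<Longrightarrow> \<exists>r>0. \<exists>C\<ge>0. ball y0 r \<subseteq> B \<and> (\<forall>x. \<forall>y\<in>ball y0 r. cmod (F (cvec x y)) \<le> C)"
  shows "gauss_dominated B (\<lambda>z. F z * exp (\<Sum>k\<in>UNIV. - of_real e * z $ k * z $ k))"
  unfolding gauss_dominated_def
proof (intro conjI ballI)
  show "sholomorphic_on (\<lambda>z. F z * exp (\<Sum>k\<in>UNIV. - of_real e * z $ k * z $ k)) (tube B)"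
    by (intro sholomorphic_on_mult sholomorphic_on_gauss F)
  fix y0 assume "y0 \<in> B"
  then obtain r C where r: "r > 0" "C \<ge> 0" "ball y0 r \<subseteq> B" and bd: "\<And>x y. y \<in> ball y0 r \<Longrightarrow> cmod (F (cvec x y)) \<le> C"
    using bd by blast
  define E where "E = exp (e * (norm y0 + r)\<^sup>2)"
  have "cmod (F (cvec x y) * exp (\<Sum>k\<in>UNIV. - of_real e * cvec x y $ k * cvec x y $ k)) \<le> (C * E) * exp (- e * (norm x)\<^sup>2)"
    if y: "y \<in> ball y0 r" for x y
  proof -
    have "norm y \<le> norm y0 + r" using y norm_triangle_ineq2[of y y0] by (simp add: dist_norm norm_minus_commute)
    then have "e * (norm y)\<^sup>2 \<le> e * (norm y0 + r)\<^sup>2"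
      using e by (intro mult_left_mono power_mono) auto
    then have "exp (- e * (norm x)\<^sup>2 + e * (norm y)\<^sup>2) \<le> E * exp (- e * (norm x)\<^sup>2)"
      unfolding E_def by (simp flip: exp_add)
    then have "cmod (F (cvec x y)) * exp (- e * (norm x)\<^sup>2 + e * (norm y)\<^sup>2) \<le> C * (E * exp (- e * (norm x)\<^sup>2))"
      by (intro mult_mono bd[OF y] r(2)) auto
    then show ?thesis by (simp only: norm_mult norm_gauss_cvec mult.assoc[of C])
  qed
  moreover have "C * E \<ge> 0" using r by (simp add: E_def)
  ultimately show "\<exists>r>0. \<exists>C\<ge>0. \<exists>c>0. ball y0 r \<subseteq> B \<and> (\<forall>x. \<forall>y\<in>ball y0 r. cmod (F (cvec x y) * exp (\<Sum>k\<in>UNIV. - of_real e * cvec x y $ k * cvec x y $ k)) \<le> C * exp (- c * (norm x)\<^sup>2))"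
    using r e by blast
qed

lemma gauss_dominated_slice:
  assumes H: "gauss_dominated B H" and y: "y \<in> B"
  shows "continuous_on UNIV (\<lambda>x. H (cvec x y))" and "\<exists>M. \<forall>x. cmod (H (cvec x y)) \<le> M"
    and "integrable lborel (\<lambda>x. H (cvec x y))"
proof -
  have "continuous_on (tube B) H" using H by (auto simp: gauss_dominated_def intro: sholomorphic_on_imp_continuous_on)
  then show c: "continuous_on UNIV (\<lambda>x. H (cvec x y))"
    by (rule continuous_on_tube_compose) (use y in \<open>auto intro: continuous_intros\<close>)
  obtain r C c where r: "r > 0" "C \<ge> 0" "c > 0"
    and bd: "\<And>x y'. y' \<in> ball y r \<Longrightarrow> cmod (H (cvec x y')) \<le> C * exp (- c * (norm x)\<^sup>2)"
    using H y unfolding gauss_dominated_def by blast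
  have bd: "cmod (H (cvec x y)) \<le> C * exp (- c * (norm x)\<^sup>2)" for x using bd[of y x] r by simp
  moreover have "C * exp (- c * (norm x)\<^sup>2) \<le> C" for x :: "real ^ 'a" using r by (simp add: mult_left_le)
  ultimately show "\<exists>M. \<forall>x. cmod (H (cvec x y)) \<le> M" using order_trans by blast
  show "integrable lborel (\<lambda>x. H (cvec x y))"
  proof (rule Bochner_Integration.integrable_bound)
    show "integrable lborel (\<lambda>x::real ^ 'a. C * exp (- c * (norm x)\<^sup>2))" using integrable_gauss[OF r(3)] by (rule integrable_mult_right)
    show "(\<lambda>x. H (cvec x y)) \<in> borel_measurable lborel" using borel_measurable_continuous_onI[OF c] by simp
  qed (use bd r in auto)
qed

text \<open>The integral over a horizontal slice extends to complex shifts \<open>\<zeta>\<eta>\<close> as a holomorphic function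
  of \<open>\<zeta>\<close>; it does not depend on real \<open>\<zeta>\<close>, so it is constant, and \<open>\<zeta> = \<i>\<close> moves the slice.\<close>

lemma gauss_dominated_shift:
  assumes H: "gauss_dominated B H" and B: "open B" "connected B" and y: "y1 \<in> B" "y2 \<in> B"
  shows "(LINT x|lborel. H (cvec x y1)) = (LINT x|lborel. H (cvec x y2))"
proof (rule connected_local_const[where f = "\<lambda>y. LINT x|lborel. H (cvec x y)", OF B(2) y], rule ballI)
  fix y0 assume y0: "y0 \<in> B"
  obtain r C c where r: "r > 0" "C \<ge> 0" "c > 0" "ball y0 r \<subseteq> B"
    and bd: "\<And>x y. y \<in> ball y0 r \<Longrightarrow> cmod (H (cvec x y)) \<le> C * exp (- c * (norm x)\<^sup>2)"
    using H y0 unfolding gauss_dominated_def by blast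
  have holH: "sholomorphic_on H (tube B)" using H by (simp add: gauss_dominated_def)
  \<comment> \<open>The bound \<open>r / 2\<close> keeps the displaced slices over
    \<open>ball y0 r\<close> for all \<open>\<zeta>\<close> of modulus below 2, a disc that contains
    both the real segment near 0 and \<open>\<i>\<close>.\<close>
  have "(LINT x|lborel. H (cvec x y0)) = (LINT x|lborel. H (cvec x (y0 + \<eta>)))" if \<eta>: "norm \<eta> < r / 2" for \<eta>
  proof -
    have line: "cvec x y0 + \<zeta> *s cvec \<eta> 0 = cvec (x + Re \<zeta> *\<^sub>R \<eta>) (y0 + Im \<zeta> *\<^sub>R \<eta>)" for x \<zeta>
      by (simp add: cvec_line)
    have inb: "y0 + Im \<zeta> *\<^sub>R \<eta> \<in> ball y0 r" if "\<zeta> \<in> ball 0 2" for \<zeta>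
    proof -
      have "\<bar>Im \<zeta>\<bar> * norm \<eta> \<le> 2 * norm \<eta>"
        using abs_Im_le_cmod[of \<zeta>] that by (intro mult_right_mono) auto
      then show ?thesis using \<eta> by (simp add: dist_norm)
    qed
    define \<phi> where "\<phi> \<zeta> = (LINT x|lborel. H (cvec x y0 + \<zeta> *s cvec \<eta> 0))" for \<zeta>
    have hol: "\<phi> holomorphic_on ball 0 2"
      unfolding \<phi>_def
    proof (rule holomorphic_on_integral)
      show "(\<lambda>\<zeta>. H (cvec x y0 + \<zeta> *s cvec \<eta> 0)) holomorphic_on ball 0 2" for x
        by (rule sholomorphic_on_line[OF holH]) (use inb r(4) in \<open>auto simp: line\<close>)
    next
      fix \<zeta> :: complex assume \<zeta>: "\<zeta> \<in> ball 0 2"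
      have "continuous_on UNIV (\<lambda>x. H (cvec (x + Re \<zeta> *\<^sub>R \<eta>) (y0 + Im \<zeta> *\<^sub>R \<eta>)))"
        by (rule continuous_on_tube_compose[OF sholomorphic_on_imp_continuous_on[OF holH]])
          (use inb[OF \<zeta>] r(4) in \<open>auto intro!: continuous_intros\<close>)
      then show "(\<lambda>x. H (cvec x y0 + \<zeta> *s cvec \<eta> 0)) \<in> borel_measurable lborel"
        unfolding line by (simp add: borel_measurable_continuous_onI)
      \<comment> \<open>A real shift by \<open>u\<close> costs half of the Gaussian rate, because
        \<open>|x + u|^2 \<ge> |x|^2 / 2 - |u|^2\<close>; with \<open>|u| \<le> 2 |\<eta>|\<close>
        the bound becomes uniform in \<open>\<zeta>\<close>.\<close>
      show "cmod (H (cvec x y0 + \<zeta> *s cvec \<eta> 0)) \<le> C * exp (c * (2 * norm \<eta>)\<^sup>2) * exp (- (c / 2) * (norm x)\<^sup>2)" for x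
      proof -
        define u where "u = Re \<zeta> *\<^sub>R \<eta>"
        have u: "norm u \<le> 2 * norm \<eta>"
          unfolding u_def using abs_Re_le_cmod[of \<zeta>] \<zeta> by (simp add: mult_right_mono)
        have "(norm x)\<^sup>2 \<le> (norm (x + u) + norm u)\<^sup>2"
          using norm_triangle_ineq4[of "x + u" u] by (intro power_mono) auto
        also have "\<dots> \<le> 2 * (norm (x + u))\<^sup>2 + 2 * (norm u)\<^sup>2"
          using sum_squares_bound[of "norm (x + u)" "norm u"] by (simp add: power2_sum)
        also have "(norm u)\<^sup>2 \<le> (2 * norm \<eta>)\<^sup>2" using u by (intro power_mono) auto
        finally have "(norm x)\<^sup>2 / 2 - (2 * norm \<eta>)\<^sup>2 \<le> (norm (x + u))\<^sup>2" by linarith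
        then have "c * ((norm x)\<^sup>2 / 2 - (2 * norm \<eta>)\<^sup>2) \<le> c * (norm (x + u))\<^sup>2" using r(3) by (intro mult_left_mono) auto
        then have "- c * (norm (x + u))\<^sup>2 \<le> c * (2 * norm \<eta>)\<^sup>2 + - (c / 2) * (norm x)\<^sup>2" by (simp add: algebra_simps)
        then have "exp (- c * (norm (x + u))\<^sup>2) \<le> exp (c * (2 * norm \<eta>)\<^sup>2) * exp (- (c / 2) * (norm x)\<^sup>2)"
          by (simp only: exp_add[symmetric] exp_le_cancel_iff)
        then have "C * exp (- c * (norm (x + u))\<^sup>2) \<le> C * exp (c * (2 * norm \<eta>)\<^sup>2) * exp (- (c / 2) * (norm x)\<^sup>2)"
          using r(2) by (simp only: mult.assoc mult_left_mono)
        with bd[OF inb[OF \<zeta>], of "x + u"] show ?thesis unfolding line u_def by linarith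
      qed
    next
      have "c / 2 > 0" using r by simp
      from integrable_gauss[OF this] show "integrable lborel (\<lambda>x::real ^ 'a. C * exp (c * (2 * norm \<eta>)\<^sup>2) * exp (- (c / 2) * (norm x)\<^sup>2))"
        by (rule integrable_mult_right)
    qed simp
    have real: "\<phi> (of_real a) = \<phi> 0" for a
    proof -
      have "\<phi> (of_real a) = (LINT x|lborel. H (cvec (a *\<^sub>R \<eta> + x) y0))" by (simp add: \<phi>_def line add.commute)
      also have "\<dots> = (LINT x|lborel. H (cvec x y0))"
        by (rule integral_lborel_translate) (rule borel_measurable_continuous_onI[OF gauss_dominated_slice(1)[OF H y0]])
      finally show ?thesis by (simp add: \<phi>_def line)
    qed
    have "\<phi> \<i> - \<phi> 0 = 0"
    proof (rule analytic_continuation[of "\<lambda>\<zeta>. \<phi> \<zeta> - \<phi> 0" "ball 0 2" "of_real ` {-1<..<1}" 0])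
      show "(\<lambda>\<zeta>. \<phi> \<zeta> - \<phi> 0) holomorphic_on ball 0 2" using hol by (intro holomorphic_intros)
      show "of_real ` {-1<..<1} \<subseteq> ball (0::complex) 2" by auto
      show "(0::complex) islimpt of_real ` {-1<..<1}"
        unfolding islimpt_approachable
      proof (intro allI impI)
        fix e :: real assume "e > 0"
        then have "complex_of_real (min (e / 2) (1 / 2)) \<in> of_real ` {-1<..<1}" "complex_of_real (min (e / 2) (1 / 2)) \<noteq> 0"
          "dist (complex_of_real (min (e / 2) (1 / 2))) 0 < e" by (auto simp: min_def intro!: imageI)
        then show "\<exists>x'\<in>of_real ` {-1<..<1}. x' \<noteq> (0::complex) \<and> dist x' 0 < e" by blast
      qed
      show "\<phi> \<zeta> - \<phi> 0 = 0" if "\<zeta> \<in> of_real ` {-1<..<1}" for \<zeta> using that real by auto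
    qed auto
    then have "\<phi> 0 = \<phi> \<i>" by simp
    then have "(LINT x|lborel. H (cvec x y0 + 0 *s cvec \<eta> 0)) = (LINT x|lborel. H (cvec x y0 + \<i> *s cvec \<eta> 0))"
      unfolding \<phi>_def .
    then show ?thesis by (simp only: line) simp
  qed
  note loc = this
  show "\<forall>\<^sub>F b in at y0 within B. (LINT x|lborel. H (cvec x y0)) = (LINT x|lborel. H (cvec x b))"
    unfolding eventually_at
  proof (intro exI conjI ballI impI)
    show "r / 2 > 0" using r by simp
    fix b assume "b \<noteq> y0 \<and> dist b y0 < r / 2"
    then show "(LINT x|lborel. H (cvec x y0)) = (LINT x|lborel. H (cvec x b))"
      using loc[of "b - y0"] by (simp add: dist_norm)
  qed
qed

text \<open>Once \<open>H\<close> is multiplied by \<open>exp (- 2 pi i z.t)\<close>, its slice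
  integral is exactly this weighted transform, and slice integrals do not depend on the height. The
  common value is the spectrum of \<open>H\<close>.\<close>

lemma four_slice_shift:
  assumes H: "gauss_dominated B H" and B: "open B" "connected B" and y: "y1 \<in> B" "y2 \<in> B"
  shows "of_real (exp (2 * pi * (y1 \<bullet> t))) * four (\<lambda>x. H (cvec x y1)) (- t)
       = of_real (exp (2 * pi * (y2 \<bullet> t))) * four (\<lambda>x. H (cvec x y2)) (- t)"
proof -
  have "exp (- 2 * complex_of_real pi * \<i> * cdot (cvec x y) t) = of_real (exp (2 * pi * (y \<bullet> t))) * cis (2 * pi * (x \<bullet> - t))" for x y
    using exp_cdot_cvec[of x y "-t"] by (simp add: cdot_def sum_negf)
  then have "(LINT x|lborel. H (cvec x y) * exp (- 2 * complex_of_real pi * \<i> * cdot (cvec x y) t))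
    = of_real (exp (2 * pi * (y \<bullet> t))) * four (\<lambda>x. H (cvec x y)) (- t)" for y
    unfolding four_def by (subst integral_mult_right_zero[symmetric]) (simp only: mult_ac)
  with gauss_dominated_shift[OF gauss_dominated_exp_cdot[OF H, of t] B y] show ?thesis by simp
qed

subsection \<open>Exponential decay of the reciprocal weight\<close>

lemma integrable_exp_neg_norm:
  assumes a: "a > 0" shows "integrable lborel (\<lambda>t::'a::euclidean_space. exp (- a * norm t))"
proof -
  have 1: "integrable lborel (\<lambda>s::real. exp (- b * \<bar>s\<bar>))" if b: "b > 0" for b
  proof -
    have "((\<lambda>x. - exp (- b * x) / b) \<longlongrightarrow> - 0 / b) at_top"
      using b by (intro tendsto_intros filterlim_compose[OF exp_at_bot] filterlim_tendsto_neg_mult_at_bot[OF tendsto_const _ filterlim_ident]) auto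
    then have "(\<integral>\<^sup>+x. ennreal (exp (- b * x)) * indicator {0 ..} x \<partial>lborel) = - 0 / b - (- exp (- b * 0) / b)"
      using b by (intro nn_integral_FTC_atLeast) (auto intro!: derivative_eq_intros)
    then have "(\<integral>\<^sup>+x. ennreal (exp (- b * x) * indicator {0 ..} x) \<partial>lborel) < \<infinity>"
      by (simp add: ennreal_mult ennreal_indicator)
    then have i: "integrable lborel (\<lambda>x::real. exp (- b * x) * indicator {0 ..} x)"
      by (intro integrableI_nonneg) auto
    then have "integrable lborel (\<lambda>x::real. exp (- b * (0 + (-1) * x)) * indicator {0 ..} (0 + (-1) * x))"
      by (subst lborel_integrable_real_affine_iff) auto
    from Bochner_Integration.integrable_add[OF i this] show ?thesis
      by (rule Bochner_Integration.integrable_bound) (auto intro!: AE_I2 simp: indicator_def)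
  qed
  \<comment> \<open>The moduli of the coordinates sum to at most \<open>DIM('a) * norm t\<close>, so
    at this rate a product of one-dimensional exponentials dominates.\<close>
  define b where "b = a / DIM('a)"
  have b: "b > 0" using a by (simp add: b_def)
  show ?thesis
  proof (rule Bochner_Integration.integrable_bound[OF lborel_integral_Basis_prod(1)])
    show "integrable lborel (\<lambda>s::real. exp (- b * \<bar>s\<bar>))" if "i \<in> Basis" for i :: 'a by (rule 1[OF b])
    show "AE t in lborel. norm (exp (- a * norm (t::'a))) \<le> norm (\<Prod>i\<in>Basis. exp (- b * \<bar>t \<bullet> i\<bar>))"
    proof (rule AE_I2)
      fix t :: 'a
      have "(\<Sum>i\<in>Basis. \<bar>t \<bullet> i\<bar>) \<le> (\<Sum>i\<in>(Basis::'a set). norm t)" by (intro sum_mono Basis_le_norm)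
      then have "b * (\<Sum>i\<in>Basis. \<bar>t \<bullet> i\<bar>) \<le> b * (DIM('a) * norm t)" using b by (intro mult_left_mono) auto
      also have "\<dots> = a * norm t" by (simp add: b_def)
      finally show "norm (exp (- a * norm t)) \<le> norm (\<Prod>i\<in>Basis. exp (- b * \<bar>t \<bullet> i\<bar>))"
        by (simp add: exp_sum[symmetric] sum_negf sum_distrib_left)
    qed
  qed measurable
qed

lemma square_le_exp: "(0::real) \<le> x \<Longrightarrow> x\<^sup>2 \<le> 2 * exp x"
  using exp_lower_Taylor_quadratic[of x] by simp

locale tube_weight =
  fixes B :: "(real ^ 'n) set" and \<rho> :: "complex ^ 'n \<Rightarrow> real"
  assumes open_B: "open B" and connected_B: "connected B"
    and continuous_\<rho>: "continuous_on (tube B) \<rho>" and \<rho>_pos: "\<And>z. z \<in> tube B \<Longrightarrow> \<rho> z > 0"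
begin

text \<open>Extension by 0 turns integrals over \<open>B\<close> into integrals over the whole
  space, the form in which Fubini's theorem is applied.\<close>

definition wt :: "real ^ 'n \<Rightarrow> real" where "wt y = indicator B y * \<rho> (cvec 0 y)"

text \<open>Cutting off both \<open>y\<close> and the weight makes all the integrals \<open>I_cut m t\<close> finite, even though
  \<open>I_weight B \<rho> t\<close> may be infinite.\<close>

definition wt_cut :: "nat \<Rightarrow> real ^ 'n \<Rightarrow> real" where
  "wt_cut m y = (if norm y \<le> m \<and> wt y \<le> m then wt y else 0)"

definition I_cut :: "nat \<Rightarrow> real ^ 'n \<Rightarrow> real" where
  "I_cut m t = (LINT y|lborel. wt_cut m y * exp (- 4 * pi * (y \<bullet> t)))"

abbreviation "rI \<equiv> I_weight_inv B \<rho>"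

lemma continuous_on_weight: "continuous_on B (\<lambda>y. \<rho> (cvec 0 y))"
  by (rule continuous_on_compose2[OF continuous_\<rho>]) (auto intro!: continuous_intros)

lemma wt_nonneg: "wt y \<ge> 0"
  using \<rho>_pos[of "cvec 0 y"] by (auto simp: wt_def indicator_def less_imp_le)

lemma wt_pos: "y \<in> B \<Longrightarrow> wt y > 0"
  using \<rho>_pos[of "cvec 0 y"] by (auto simp: wt_def)

lemma wt_notin: "y \<notin> B \<Longrightarrow> wt y = 0" by (simp add: wt_def)

lemma continuous_on_wt: "continuous_on B wt"
  using continuous_on_weight by (subst continuous_on_cong[OF refl, of _ _ "\<lambda>y. \<rho> (cvec 0 y)"]) (auto simp: wt_def)

lemma measurable_wt [measurable]: "wt \<in> borel_measurable borel"
proof -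
  have "(\<lambda>y. indicator B y *\<^sub>R \<rho> (cvec 0 y)) \<in> borel_measurable borel"
    by (rule borel_measurable_continuous_on_indicator[OF _ continuous_on_weight]) (use open_B in auto)
  then show ?thesis by (simp add: wt_def[abs_def])
qed

lemma measurable_wt_cut [measurable]: "wt_cut m \<in> borel_measurable borel"
  unfolding wt_cut_def[abs_def] by measurable

lemma wt_cut_nonneg: "wt_cut m y \<ge> 0"
  by (simp add: wt_cut_def wt_nonneg)

lemma wt_cut_le: "wt_cut m y \<le> wt y"
  by (simp add: wt_cut_def wt_nonneg)

lemma wt_cut_mono: "m \<le> m' \<Longrightarrow> wt_cut m y \<le> wt_cut m' y"
  using wt_nonneg[of y] by (auto simp: wt_cut_def)

lemma wt_cut_LIMSEQ: "(\<lambda>m. wt_cut m y) \<longlonglongrightarrow> wt y"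
proof (rule tendsto_eventually, rule eventually_sequentiallyI)
  fix m :: nat assume "nat \<lceil>max (norm y) (wt y)\<rceil> \<le> m"
  then have "max (norm y) (wt y) \<le> m" by linarith
  then show "wt_cut m y = wt y" by (simp add: wt_cut_def)
qed

lemma I_cut_integrable: "integrable lborel (\<lambda>y. wt_cut m y * exp (- 4 * pi * (y \<bullet> t)))"
proof (rule Bochner_Integration.integrable_bound)
  have "emeasure lborel (cball (0 :: real ^ 'n) m) < \<infinity>" by (rule emeasure_bounded_finite) simp
  then show "integrable lborel (\<lambda>y. (m * exp (4 * pi * (m * norm t))) * indicator (cball (0 :: real ^ 'n) m) y)"
    by (intro integrable_mult_right integrable_real_indicator) auto
  show "AE y in lborel. norm (wt_cut m y * exp (- 4 * pi * (y \<bullet> t))) \<le> norm ((m * exp (4 * pi * (m * norm t))) * indicator (cball (0 :: real ^ 'n) m) y)"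
  proof (rule AE_I2)
    fix y :: "real ^ 'n"
    show "norm (wt_cut m y * exp (- 4 * pi * (y \<bullet> t))) \<le> norm ((m * exp (4 * pi * (m * norm t))) * indicator (cball 0 m) y)"
    proof (cases "norm y \<le> m \<and> wt y \<le> m")
      case True
      have "- (y \<bullet> t) \<le> norm y * norm t" using Cauchy_Schwarz_ineq2[of y t] by linarith
      also have "\<dots> \<le> m * norm t" using True by (intro mult_right_mono) auto
      finally have "4 * pi * (- (y \<bullet> t)) \<le> 4 * pi * (m * norm t)" by (intro mult_left_mono) auto
      then have "exp (- 4 * pi * (y \<bullet> t)) \<le> exp (4 * pi * (m * norm t))" by simp
      with True show ?thesis
        using wt_nonneg[of y] by (auto simp: wt_cut_def abs_mult intro!: mult_mono)
    next
      case False
      then have "wt_cut m y = 0" by (auto simp: wt_cut_def)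
      then show ?thesis by simp
    qed
  qed
qed measurable

lemma ennreal_I_cut: "ennreal (I_cut m t) = (\<integral>\<^sup>+y. ennreal (wt_cut m y * exp (- 4 * pi * (y \<bullet> t))) \<partial>lborel)"
  unfolding I_cut_def by (rule nn_integral_eq_integral[OF I_cut_integrable, symmetric]) (simp add: wt_cut_nonneg)

lemma I_weight_eq: "I_weight B \<rho> t = (\<integral>\<^sup>+y. ennreal (wt y * exp (- 4 * pi * (y \<bullet> t))) \<partial>lborel)"
  unfolding I_weight_def by (rule nn_integral_cong) (simp add: wt_def indicator_def)

lemma I_cut_nonneg: "I_cut m t \<ge> 0"
  unfolding I_cut_def by (rule integral_nonneg_AE) (simp add: wt_cut_nonneg)

lemma I_cut_le_I_weight: "ennreal (I_cut m t) \<le> I_weight B \<rho> t"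
  unfolding ennreal_I_cut I_weight_eq by (intro nn_integral_mono ennreal_leI mult_right_mono wt_cut_le) auto

lemma I_cut_LIMSEQ: "(\<lambda>m. ennreal (I_cut m t)) \<longlonglongrightarrow> I_weight B \<rho> t"
  unfolding ennreal_I_cut I_weight_eq
  by (rule nn_integral_LIMSEQ)
    (auto intro!: tendsto_ennrealI tendsto_intros wt_cut_LIMSEQ incseq_SucI le_funI ennreal_leI mult_right_mono wt_cut_mono)

lemma measurable_I_weight [measurable]: "I_weight B \<rho> \<in> borel_measurable borel"
proof -
  have "(\<lambda>t. \<integral>\<^sup>+y. ennreal (wt y * exp (- 4 * pi * (y \<bullet> t))) \<partial>lborel) \<in> borel_measurable (lborel :: (real ^ 'n) measure)"
    by (rule lborel.borel_measurable_nn_integral) measurable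
  then show ?thesis by (simp add: I_weight_eq[abs_def])
qed

lemma measurable_rI [measurable]: "rI \<in> borel_measurable borel"
  unfolding I_weight_inv_def[abs_def] by measurable

lemma measurable_I_cut [measurable]: "I_cut m \<in> borel_measurable borel"
proof -
  have "(\<lambda>t. LINT y|lborel. wt_cut m y * exp (- 4 * pi * (y \<bullet> t))) \<in> borel_measurable (lborel :: (real ^ 'n) measure)"
    by (rule lborel.borel_measurable_lebesgue_integral) measurable
  then show ?thesis by (simp add: I_cut_def[abs_def])
qed

lemma rI_nonneg: "rI t \<ge> 0" by (simp add: I_weight_inv_def)

text \<open>The cutoff lowers the integral; where the uncut integral is infinite,
  \<open>rI t = 0\<close> makes the product vanish. The product is the multiplier by which the
  cut-off pairing with the kernel acts on the spectrum.\<close>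

lemma I_cut_rI_le: "I_cut m t * rI t \<le> 1"
proof (cases "I_weight B \<rho> t = \<infinity>")
  case False
  then have lt: "I_weight B \<rho> t < top" by (simp add: less_top)
  then have "I_cut m t \<le> enn2real (I_weight B \<rho> t)"
    using I_cut_le_I_weight[of m t] I_cut_nonneg[of m t] by (metis enn2real_ennreal enn2real_mono)
  moreover have "x * (1 / e) \<le> 1" if "x \<le> e" "0 \<le> e" for x e :: real
    using that by (cases "e = 0") (auto simp: divide_le_eq)
  ultimately show ?thesis using False by (simp only: I_weight_inv_def if_False enn2real_nonneg)
qed (simp add: I_weight_inv_def)

text \<open>Moving from \<open>v\<close> against the direction of \<open>t\<close> raises
  \<open>exp (- 4 pi y.t)\<close> exponentially above its value at \<open>v\<close>, and there is
  room for a whole ball of such \<open>y\<close> on which the weight is bounded below.\<close>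

lemma I_cut_lower_bound:
  assumes v: "v \<in> B"
  obtains a c m0 where "a > 0" "c > 0" "\<And>m t. m \<ge> m0 \<Longrightarrow> I_cut m t \<ge> c * exp (a * norm t) * exp (- 4 * pi * (v \<bullet> t))"
proof -
  obtain s where s: "s > 0" "cball v s \<subseteq> B" using open_B v open_contains_cball by blast
  have cont: "continuous_on (cball v s) wt" using continuous_on_wt s continuous_on_subset by blast
  obtain y1 where y1: "y1 \<in> cball v s" "\<And>y. y \<in> cball v s \<Longrightarrow> wt y1 \<le> wt y"
    using continuous_attains_inf[OF compact_cball _ cont] s by auto
  obtain y2 where y2: "y2 \<in> cball v s" "\<And>y. y \<in> cball v s \<Longrightarrow> wt y \<le> wt y2"
    using continuous_attains_sup[OF compact_cball _ cont] s by auto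
  \<comment> \<open>From \<open>m0\<close> on the cutoff is inactive on \<open>cball v s\<close>:
    both the norms and the weights there are at most \<open>m\<close>.\<close>
  define m0 where "m0 = nat \<lceil>max (norm v + s) (wt y2)\<rceil>"
  define V where "V = measure lborel (cball (0 :: real ^ 'n) (s / 4))"
  have V: "V > 0" using s by (simp add: V_def)
  have w1: "wt y1 > 0" using y1 s by (intro wt_pos) auto
  show ?thesis
  proof (rule that[of "pi * s" "wt y1 * V" m0])
    show "pi * s > 0" "wt y1 * V > 0" using s V w1 by auto
    fix m t assume "m0 \<le> m"
    then have m: "norm v + s \<le> m" "wt y2 \<le> m" unfolding m0_def by linarith+
    \<comment> \<open>On the ball of radius \<open>s / 4\<close> about \<open>u\<close>, the product
      \<open>y.t\<close> is at most \<open>v.t - (s / 2 - s / 4) |t|\<close>; multiplication by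
      \<open>4 * pi\<close> gives the rate \<open>pi * s\<close>. For \<open>t = 0\<close> the
      convention \<open>sgn 0 = 0\<close> gives \<open>u = v\<close>.\<close>
    define u where "u = v - (s / 2) *\<^sub>R sgn t"
    have nu: "norm ((s / 2) *\<^sub>R sgn t) \<le> s / 2" using s by (simp add: norm_sgn)
    let ?E = "exp (pi * s * norm t) * exp (- 4 * pi * (v \<bullet> t))"
    have int: "integrable lborel (\<lambda>y. indicator (cball u (s / 4)) y * (wt y1 * ?E))"
    proof -
      have "emeasure lborel (cball u (s / 4)) < \<infinity>" by (rule emeasure_bounded_finite) simp
      then show ?thesis by (intro integrable_mult_left integrable_real_indicator) auto
    qed
    have "measure lborel (cball u (s / 4)) = V" unfolding V_def using s by (simp add: content_cball)
    then have "wt y1 * V * exp (pi * s * norm t) * exp (- 4 * pi * (v \<bullet> t)) = (LINT y|lborel. indicator (cball u (s / 4)) y * (wt y1 * ?E))"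
      by simp
    also have "\<dots> \<le> I_cut m t"
      unfolding I_cut_def
    proof (rule integral_mono[OF int I_cut_integrable])
      fix y
      show "indicator (cball u (s / 4)) y * (wt y1 * ?E) \<le> wt_cut m y * exp (- 4 * pi * (y \<bullet> t))"
      proof (cases "y \<in> cball u (s / 4)")
        case True
        then have yu: "norm (y - u) \<le> s / 4" by (simp add: dist_norm norm_minus_commute)
        have "dist v u \<le> s / 2" using nu by (simp add: u_def dist_norm)
        then have yv: "y \<in> cball v s" using True dist_triangle[of v y u] s by (simp add: dist_commute)
        then have "norm y \<le> norm v + s" using norm_triangle_ineq2[of y v] by (simp add: dist_norm norm_minus_commute)
        then have w: "wt_cut m y = wt y" using m y2(2)[OF yv] by (simp add: wt_cut_def)
        have "sgn t \<bullet> t = norm t" by (cases "t = 0") (auto simp: sgn_div_norm power2_norm_eq_inner[symmetric] power2_eq_square)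
        then have "u \<bullet> t = v \<bullet> t - (s / 2) * norm t" by (simp add: u_def inner_diff_left)
        moreover have "(y - u) \<bullet> t \<le> (s / 4) * norm t"
          using norm_cauchy_schwarz[of "y - u" t] mult_right_mono[OF yu norm_ge_zero[of t]] by linarith
        ultimately have "y \<bullet> t \<le> v \<bullet> t - (s / 4) * norm t" by (simp add: inner_diff_left)
        then have "4 * pi * (y \<bullet> t) \<le> 4 * pi * (v \<bullet> t - (s / 4) * norm t)" by (intro mult_left_mono) auto
        then have "?E \<le> exp (- 4 * pi * (y \<bullet> t))" by (simp add: exp_add[symmetric] algebra_simps)
        then have "wt y1 * ?E \<le> wt y * exp (- 4 * pi * (y \<bullet> t))"
          by (intro mult_mono y1 yv) (auto simp: wt_nonneg)
        then show ?thesis using True w by simp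
      qed (simp add: wt_cut_nonneg)
    qed
    finally show "I_cut m t \<ge> wt y1 * V * exp (pi * s * norm t) * exp (- 4 * pi * (v \<bullet> t))" .
  qed
qed

lemma inverse_I_cut_bound:
  assumes v: "v \<in> B"
  obtains a C m0 where "a > 0" "C > 0"
    "\<And>m t. m \<ge> m0 \<Longrightarrow> I_cut m t > 0"
    "\<And>m t. m \<ge> m0 \<Longrightarrow> exp (- 4 * pi * (v \<bullet> t)) / I_cut m t \<le> C * exp (- a * norm t)"
    "\<And>t. exp (- 4 * pi * (v \<bullet> t)) * rI t \<le> C * exp (- a * norm t)"
proof -
  obtain a c m0 where a: "a > 0" and c: "c > 0"
    and lb: "\<And>m t. m \<ge> m0 \<Longrightarrow> I_cut m t \<ge> c * exp (a * norm t) * exp (- 4 * pi * (v \<bullet> t))"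
    using I_cut_lower_bound[OF v] by blast
  have pos: "I_cut m t > 0" if "m \<ge> m0" for m t
    using lb[OF that, of t] c by (smt (verit) exp_gt_zero mult_pos_pos)
  have bd: "exp (- 4 * pi * (v \<bullet> t)) / I_cut m t \<le> 1 / c * exp (- a * norm t)" if "m \<ge> m0" for m t
  proof -
    have "exp (- 4 * pi * (v \<bullet> t)) = 1 / c * exp (- a * norm t) * (c * exp (a * norm t) * exp (- 4 * pi * (v \<bullet> t)))"
      using c by (simp add: exp_minus)
    also have "\<dots> \<le> 1 / c * exp (- a * norm t) * I_cut m t"
      by (rule mult_left_mono[OF lb[OF that]]) (use c in simp)
    finally show ?thesis using pos[OF that] by (simp only: pos_divide_le_eq)
  qed
  have "exp (- 4 * pi * (v \<bullet> t)) * rI t \<le> 1 / c * exp (- a * norm t)" for t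
  proof -
    \<comment> \<open>The uncut integral is at least the one with cutoff \<open>m0\<close>, so the
      bound for a single cutoff passes to \<open>rI\<close>, also where the uncut integral is
      infinite.\<close>
    have "rI t \<le> 1 / I_cut m0 t" using I_cut_rI_le[of m0 t] pos[of m0 t] by (simp add: pos_le_divide_eq mult.commute)
    then have "exp (- 4 * pi * (v \<bullet> t)) * rI t \<le> exp (- 4 * pi * (v \<bullet> t)) * (1 / I_cut m0 t)" by (intro mult_left_mono) auto
    also have "\<dots> \<le> 1 / c * exp (- a * norm t)" using bd[of m0 t] by simp
    finally show ?thesis .
  qed
  then show ?thesis using that[of a "1 / c" m0] a c pos bd by simp
qed

lemma rI_mixed_bound:
  assumes v: "v \<in> B" and y: "y \<in> B"
  obtains a C where "a > 0" "C > 0" "\<And>t. exp (- 2 * pi * ((y + v) \<bullet> t)) * rI t \<le> C * exp (- a * norm t)"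
proof -
  obtain a C where a: "a > 0" "C > 0" and bd: "\<And>t. exp (- 4 * pi * (v \<bullet> t)) * rI t \<le> C * exp (- a * norm t)"
    using inverse_I_cut_bound[OF v] by metis
  obtain a' C' where a': "a' > 0" "C' > 0" and bd': "\<And>t. exp (- 4 * pi * (y \<bullet> t)) * rI t \<le> C' * exp (- a' * norm t)"
    using inverse_I_cut_bound[OF y] by metis
  show ?thesis
  proof (rule that[of "min a a'" "C + C'"])
    show "min a a' > 0" "C + C' > 0" using a a' by auto
    fix t :: "real ^ 'n"
    have "2 * (exp (- 2 * pi * (y \<bullet> t)) * exp (- 2 * pi * (v \<bullet> t))) \<le> (exp (- 2 * pi * (y \<bullet> t)))\<^sup>2 + (exp (- 2 * pi * (v \<bullet> t)))\<^sup>2"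
      using sum_squares_bound[of "exp (- 2 * pi * (y \<bullet> t))" "exp (- 2 * pi * (v \<bullet> t))"] by (simp only: mult.assoc)
    moreover have "(exp (- 2 * pi * (x \<bullet> t)))\<^sup>2 = exp (- 4 * pi * (x \<bullet> t))" for x :: "real ^ 'n"
      by (simp flip: exp_double)
    ultimately have "2 * exp (- 2 * pi * ((y + v) \<bullet> t)) \<le> exp (- 4 * pi * (y \<bullet> t)) + exp (- 4 * pi * (v \<bullet> t))"
      by (simp add: exp_add[symmetric] inner_add_left algebra_simps)
    then have "exp (- 2 * pi * ((y + v) \<bullet> t)) \<le> exp (- 4 * pi * (y \<bullet> t)) + exp (- 4 * pi * (v \<bullet> t))"
      by (smt (verit) exp_gt_zero)
    then have "exp (- 2 * pi * ((y + v) \<bullet> t)) * rI t \<le> (exp (- 4 * pi * (y \<bullet> t)) + exp (- 4 * pi * (v \<bullet> t))) * rI t"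
      by (rule mult_right_mono) (rule rI_nonneg)
    also have "\<dots> \<le> C' * exp (- a' * norm t) + C * exp (- a * norm t)"
      using bd[of t] bd'[of t] by (simp add: distrib_right)
    also have "C' * exp (- a' * norm t) \<le> C' * exp (- min a a' * norm t)"
      using a' by (auto intro!: mult_right_mono)
    also have "C * exp (- a * norm t) \<le> C * exp (- min a a' * norm t)"
      using a by (auto intro!: mult_right_mono)
    finally show "exp (- 2 * pi * ((y + v) \<bullet> t)) * rI t \<le> (C + C') * exp (- min a a' * norm t)"
      by (simp add: distrib_right)
  qed
qed

end

section \<open>Complex differentiability of exponential integrals\<close>

lemma norm_cdot_le: 
  fixes h :: "complex ^ 'n" shows "cmod (cdot h t) \<le> CARD('n) * (norm h * norm t)"
proof -
  have "cmod (cdot h t) \<le> (\<Sum>k\<in>(UNIV :: 'n set). norm h * norm t)"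
    unfolding cdot_def
  proof (rule order_trans[OF norm_sum sum_mono])
    fix k :: 'n
    have "\<bar>t $ k\<bar> \<le> norm t" using component_le_norm_cart[of t k] by simp
    then show "cmod (h $ k * complex_of_real (t $ k)) \<le> norm h * norm t"
      by (simp add: norm_mult mult_mono Finite_Cartesian_Product.norm_nth_le)
  qed
  then show ?thesis by simp
qed

lemma cdot_add: "cdot (z + w) t = cdot z t + cdot w t"
  by (simp add: cdot_def sum.distrib algebra_simps)

text \<open>The remainder \<open>exp z - 1 - z\<close> is quadratic in \<open>h\<close>, and for
  small \<open>h\<close> the decay of \<open>\<psi>\<close> absorbs both its exponential growth and
  its polynomial factor in \<open>t\<close>. The derivative is therefore obtained by differentiating
  the integrand.\<close>

lemma has_derivative_exp_integral:
  fixes \<psi> :: "real ^ 'n \<Rightarrow> complex"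
  assumes [measurable]: "\<psi> \<in> borel_measurable borel" and a: "a > 0"
    and bd: "\<And>t. cmod (\<psi> t) \<le> C * exp (- a * norm t)"
  shows "\<exists>c :: complex ^ 'n. ((\<lambda>h. LINT t|lborel. exp (2 * complex_of_real pi * \<i> * cdot h t) * \<psi> t) has_derivative (\<lambda>h. \<Sum>k\<in>UNIV. c $ k * h $ k)) (at 0)"
proof
  define b where "b = 2 * pi * CARD('n)"
  have b: "b > 0" by (simp add: b_def)
  have C: "C \<ge> 0" using bd[of 0] by (auto intro: order_trans[OF norm_ge_zero])
  define e where "e h t = 2 * complex_of_real pi * \<i> * cdot h t" for h :: "complex ^ 'n" and t
  have e: "cmod (e h t) \<le> b * (norm h * norm t)" for h t
    using norm_cdot_le[of h t] by (simp add: e_def b_def norm_mult)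
  have [measurable]: "e h \<in> borel_measurable borel" for h
    unfolding e_def cdot_def by measurable
  have int: "integrable lborel g" if "g \<in> borel_measurable borel" "\<And>t. cmod (g t) \<le> K * exp (- (a / 2) * norm t)" for g :: "real ^ 'n \<Rightarrow> complex" and K
  proof (rule Bochner_Integration.integrable_bound)
    show "integrable lborel (\<lambda>t :: real ^ 'n. K * exp (- (a / 2) * norm t))"
      by (rule integrable_mult_right, rule integrable_exp_neg_norm) (use a in simp)
    show "AE t in lborel. norm (g t) \<le> norm (K * exp (- (a / 2) * norm t))"
      using that(2) by (intro AE_I2) (auto intro: order_trans[OF _ abs_ge_self])
  qed (use that in simp)
  have i1: "integrable lborel (\<lambda>t. exp (e h t) * \<psi> t)" if h: "b * norm h \<le> a / 4" for h
  proof (rule int)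
    fix t
    have "cmod (exp (e h t)) \<le> exp (b * norm h * norm t)"
      using e[of h t] complex_Re_le_cmod[of "e h t"] by (simp add: mult.assoc)
    also have "b * norm h * norm t \<le> a / 2 * norm t"
      using h a by (intro mult_right_mono) auto
    finally have "cmod (exp (e h t)) \<le> exp (a / 2 * norm t)" by simp
    then have "cmod (exp (e h t) * \<psi> t) \<le> exp (a / 2 * norm t) * (C * exp (- a * norm t))"
      unfolding norm_mult by (intro mult_mono bd) auto
    also have "\<dots> = C * (exp (a / 2 * norm t) * exp (- a * norm t))" by (simp only: mult_ac)
    also have "exp (a / 2 * norm t) * exp (- a * norm t) = exp (- (a / 2) * norm t)"
      by (simp add: exp_add[symmetric])
    finally show "cmod (exp (e h t) * \<psi> t) \<le> C * exp (- (a / 2) * norm t)" .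
  qed measurable
  have i2: "integrable lborel (\<lambda>t. e h t * \<psi> t)" for h
  proof (rule int)
    fix t :: "real ^ 'n"
    have "a / 2 * norm t \<le> exp (a / 2 * norm t)" using exp_ge_add_one_self[of "a / 2 * norm t"] by linarith
    then have "norm t \<le> 2 / a * exp (a / 2 * norm t)" using a by (simp add: field_simps)
    then have "b * (norm h * norm t) \<le> b * (norm h * (2 / a * exp (a / 2 * norm t)))"
      using b by (intro mult_left_mono) auto
    then have "cmod (e h t * \<psi> t) \<le> (b * (norm h * (2 / a * exp (a / 2 * norm t)))) * (C * exp (- a * norm t))"
      unfolding norm_mult using e[of h t] by (intro mult_mono bd) (use a b in auto)
    also have "\<dots> = b * norm h * (2 / a) * C * (exp (a / 2 * norm t) * exp (- a * norm t))" by (simp only: mult_ac)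
    also have "exp (a / 2 * norm t) * exp (- a * norm t) = exp (- (a / 2) * norm t)"
      by (simp add: exp_add[symmetric])
    finally show "cmod (e h t * \<psi> t) \<le> b * norm h * (2 / a) * C * exp (- (a / 2) * norm t)" .
  qed measurable
  let ?c = "\<chi> k. LINT t|lborel. 2 * complex_of_real pi * \<i> * complex_of_real (t $ k) * \<psi> t"
  let ?\<Phi> = "\<lambda>h. LINT t|lborel. exp (2 * complex_of_real pi * \<i> * cdot h t) * \<psi> t"
  have D: "(\<Sum>k\<in>UNIV. ?c $ k * h $ k) = (LINT t|lborel. e h t * \<psi> t)" for h :: "complex ^ 'n"
  proof -
    have ax: "2 * complex_of_real pi * \<i> * complex_of_real (t $ k) * \<psi> t = e (axis k 1) t * \<psi> t" for t k
    proof -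
      have "cdot (axis k 1) t = (\<Sum>j\<in>UNIV. if j = k then complex_of_real (t $ j) else 0)"
        unfolding cdot_def by (intro sum.cong) (auto simp: axis_def)
      then show ?thesis by (simp add: e_def)
    qed
    have "(LINT t|lborel. e h t * \<psi> t) = (LINT t|lborel. (\<Sum>k\<in>UNIV. (e (axis k 1) t * \<psi> t) * h $ k))"
      unfolding ax[symmetric] by (simp add: e_def cdot_def sum_distrib_left sum_distrib_right mult_ac)
    also have "\<dots> = (\<Sum>k\<in>UNIV. LINT t|lborel. (e (axis k 1) t * \<psi> t) * h $ k)"
      by (rule Bochner_Integration.integral_sum) (intro integrable_mult_left i2)
    finally show ?thesis by (simp add: ax)
  qed
  \<comment> \<open>The factor \<open>32 / a^2\<close> comes from \<open>x^2 \<le> 2 * exp x\<close>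
    at \<open>x = a |t| / 4\<close>. Together with
    \<open>exp (b |h| |t|) \<le> exp (a |t| / 4)\<close> the remainder uses up half of the decay
    rate \<open>a\<close>, which leaves the integrable \<open>exp (- a |t| / 2)\<close>.\<close>
  define K where "K = C * b\<^sup>2 * (32 / a\<^sup>2) * (LINT t|lborel. exp (- (a / 2) * norm (t :: real ^ 'n)))"
  have main: "norm (?\<Phi> (0 + h) - ?\<Phi> 0 - (\<Sum>k\<in>UNIV. ?c $ k * h $ k)) \<le> K * (norm h)\<^sup>2" if h: "b * norm h \<le> a / 4" for h
  proof -
    have z: "b * norm (0 :: complex ^ 'n) \<le> a / 4" using a by simp
    have e0: "e 0 t = 0" for t by (simp add: e_def cdot_def)
    have "?\<Phi> (0 + h) - ?\<Phi> 0 - (\<Sum>k\<in>UNIV. ?c $ k * h $ k) = (LINT t|lborel. exp (e h t) * \<psi> t - exp (e 0 t) * \<psi> t - e h t * \<psi> t)"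
      unfolding D
      by (subst Bochner_Integration.integral_diff[OF Bochner_Integration.integrable_diff[OF i1[OF h] i1[OF z]] i2],
          subst Bochner_Integration.integral_diff[OF i1[OF h] i1[OF z]]) (simp add: e_def)
    also have "norm \<dots> \<le> (LINT t|lborel. C * b\<^sup>2 * (32 / a\<^sup>2) * (norm h)\<^sup>2 * exp (- (a / 2) * norm (t :: real ^ 'n)))"
    proof (rule Bochner_Integration.integral_norm_bound_integral)
      show "integrable lborel (\<lambda>t. exp (e h t) * \<psi> t - exp (e 0 t) * \<psi> t - e h t * \<psi> t)"
        by (intro Bochner_Integration.integrable_diff i1 i2 h z)
      show "integrable lborel (\<lambda>t :: real ^ 'n. C * b\<^sup>2 * (32 / a\<^sup>2) * (norm h)\<^sup>2 * exp (- (a / 2) * norm t))"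
        by (rule integrable_mult_right, rule integrable_exp_neg_norm) (use a in simp)
    next
      fix t
      let ?z = "e h t"
      have "cmod (exp ?z - 1 - ?z) \<le> exp (cmod ?z) * (cmod ?z)\<^sup>2"
        using Taylor_exp_field[of ?z 1] by (simp add: power2_eq_square algebra_simps)
      also have "\<dots> \<le> exp (a / 4 * norm t) * (b\<^sup>2 * (norm h)\<^sup>2 * (32 / a\<^sup>2 * exp (a / 4 * norm t)))"
      proof (rule mult_mono)
        have "cmod ?z \<le> (b * norm h) * norm t" using e[of h t] by (simp add: mult.assoc)
        also have "\<dots> \<le> a / 4 * norm t" by (rule mult_right_mono[OF h]) simp
        finally show "exp (cmod ?z) \<le> exp (a / 4 * norm t)" by simp
        have "(cmod ?z)\<^sup>2 \<le> (b * (norm h * norm t))\<^sup>2" using e[of h t] by (intro power_mono) auto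
        also have "\<dots> = b\<^sup>2 * (norm h)\<^sup>2 * (norm t)\<^sup>2" by (simp add: power_mult_distrib)
        also have "(norm t)\<^sup>2 \<le> 32 / a\<^sup>2 * exp (a / 4 * norm t)"
          using square_le_exp[of "a / 4 * norm t"] a by (simp add: power_mult_distrib power_divide field_simps)
        finally show "(cmod ?z)\<^sup>2 \<le> b\<^sup>2 * (norm h)\<^sup>2 * (32 / a\<^sup>2 * exp (a / 4 * norm t))"
          by (simp add: mult_left_mono)
      qed auto
      finally have "cmod (exp ?z - 1 - ?z) * cmod (\<psi> t) \<le> (exp (a / 4 * norm t) * (b\<^sup>2 * (norm h)\<^sup>2 * (32 / a\<^sup>2 * exp (a / 4 * norm t)))) * (C * exp (- a * norm t))"
        by (intro mult_mono bd) auto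
      also have "\<dots> = C * b\<^sup>2 * (32 / a\<^sup>2) * (norm h)\<^sup>2 * (exp (a / 4 * norm t) * exp (a / 4 * norm t) * exp (- a * norm t))"
        by (simp only: mult_ac)
      also have "exp (a / 4 * norm t) * exp (a / 4 * norm t) * exp (- a * norm t) = exp (- (a / 2) * norm t)"
        by (simp add: exp_add[symmetric])
      finally have "cmod ((exp ?z - 1 - ?z) * \<psi> t) \<le> C * b\<^sup>2 * (32 / a\<^sup>2) * (norm h)\<^sup>2 * exp (- (a / 2) * norm t)"
        by (simp only: norm_mult)
      then show "cmod (exp (e h t) * \<psi> t - exp (e 0 t) * \<psi> t - e h t * \<psi> t) \<le> C * b\<^sup>2 * (32 / a\<^sup>2) * (norm h)\<^sup>2 * exp (- (a / 2) * norm t)"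
        by (simp add: e0 left_diff_distrib)
    qed
    also have "\<dots> = K * (norm h)\<^sup>2" by (simp add: K_def)
    finally show ?thesis .
  qed
  show "(?\<Phi> has_derivative (\<lambda>h. \<Sum>k\<in>UNIV. ?c $ k * h $ k)) (at 0)"
    unfolding has_derivative_at
  proof
    show "bounded_linear (\<lambda>h. \<Sum>k\<in>UNIV. ?c $ k * h $ k)"
      by (intro bounded_linear_sum bounded_linear_const_mult bounded_linear_vec_nth)
    show "(\<lambda>h. norm (?\<Phi> (0 + h) - ?\<Phi> 0 - (\<Sum>k\<in>UNIV. ?c $ k * h $ k)) / norm h) \<midarrow>0\<rightarrow> 0"
    proof (rule Lim_null_comparison)
      have "eventually (\<lambda>h :: complex ^ 'n. b * norm h \<le> a / 4) (at 0)"
        unfolding eventually_at using a b by (intro exI[of _ "a / 4 / b"]) (auto simp: field_simps)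
      then show "\<forall>\<^sub>F h in at 0. norm (norm (?\<Phi> (0 + h) - ?\<Phi> 0 - (\<Sum>k\<in>UNIV. ?c $ k * h $ k)) / norm h) \<le> K * norm h"
      proof eventually_elim
        case (elim h)
        from main[OF elim] show ?case
          by (cases "h = 0") (auto simp: divide_le_eq power2_eq_square mult.assoc)
      qed
      have "((\<lambda>h :: complex ^ 'n. K * norm h) \<longlongrightarrow> K * norm (0 :: complex ^ 'n)) (at 0)"
        by (intro tendsto_intros)
      then show "(\<lambda>h :: complex ^ 'n. K * norm h) \<midarrow>0\<rightarrow> 0" by simp
    qed
  qed
qed

subsection \<open>The kernel\<close>

lemma cvec_minus_vcnj: "cvec x y - vcnj (cvec u v) = cvec (x - u) (y + v)"
  by (simp add: vec_eq_iff vcnj_def complex_eq_iff)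

context tube_weight
begin

definition kern :: "complex ^ 'n \<Rightarrow> complex ^ 'n \<Rightarrow> complex" where
  "kern z w = (LINT t|lborel. exp (2 * complex_of_real pi * \<i> * cdot (z - vcnj w) t) * complex_of_real (rI t))"

text \<open>The integrand of \<open>kern\<close> at height \<open>y\<close> with the character of
  \<open>x\<close> removed, \<open>u + i v\<close> being the second argument of the kernel. The
  slice of the kernel is the transform of this function.\<close>

definition kern_four :: "real ^ 'n \<Rightarrow> real ^ 'n \<Rightarrow> real ^ 'n \<Rightarrow> real ^ 'n \<Rightarrow> complex" where
  "kern_four u v y t = complex_of_real (exp (- 2 * pi * ((y + v) \<bullet> t)) * rI t) * cis (- 2 * pi * (u \<bullet> t))"

lemma kern_integrand_eq:
  "exp (2 * complex_of_real pi * \<i> * cdot (cvec x y - vcnj (cvec u v)) t) * complex_of_real (rI t)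
    = kern_four u v y t * cis (2 * pi * (t \<bullet> x))"
  unfolding cvec_minus_vcnj exp_cdot_cvec kern_four_def
  by (simp add: inner_diff_left right_diff_distrib cis_mult inner_commute algebra_simps)

lemma measurable_kern_four [measurable]: "kern_four u v y \<in> borel_measurable borel"
  unfolding kern_four_def[abs_def] by measurable

lemma norm_kern_four: "cmod (kern_four u v y t) = exp (- 2 * pi * ((y + v) \<bullet> t)) * rI t"
  by (simp add: kern_four_def norm_mult rI_nonneg)

lemma integrable_kern_four:
  assumes v: "v \<in> B" and y: "y \<in> B" shows "integrable lborel (kern_four u v y)"
proof -
  obtain a C where a: "a > 0" "C > 0" and bd: "\<And>t. exp (- 2 * pi * ((y + v) \<bullet> t)) * rI t \<le> C * exp (- a * norm t)"
    using rI_mixed_bound[OF v y] by metis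
  show ?thesis
  proof (rule Bochner_Integration.integrable_bound)
    show "integrable lborel (\<lambda>t :: real ^ 'n. C * exp (- a * norm t))"
      by (rule integrable_mult_right, rule integrable_exp_neg_norm[OF a(1)])
    show "AE t in lborel. norm (kern_four u v y t) \<le> norm (C * exp (- a * norm t))"
      unfolding norm_kern_four using bd a by (intro AE_I2) (auto intro: order_trans[OF _ abs_ge_self])
  qed measurable
qed

lemma kern_eq_four: "kern (cvec x y) (cvec u v) = four (kern_four u v y) x"
  by (simp only: kern_def kern_integrand_eq four_def)

lemma integrable_kern:
  assumes "z \<in> tube B" "w \<in> tube B"
  shows "integrable lborel (\<lambda>t. exp (2 * complex_of_real pi * \<i> * cdot (z - vcnj w) t) * complex_of_real (rI t))"
proof -
  obtain x y where z: "z = cvec x y" "y \<in> B" using assms(1) by (rule tubeE)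
  obtain u v where w: "w = cvec u v" "v \<in> B" using assms(2) by (rule tubeE)
  show ?thesis unfolding z w kern_integrand_eq
    by (rule integrable_mult_cis[OF integrable_kern_four[OF w(2) z(2)]]) measurable
qed

lemma sholomorphic_on_kern:
  assumes w: "w \<in> tube B" shows "sholomorphic_on (\<lambda>z. kern z w) (tube B)"
  unfolding sholomorphic_on_def
proof
  fix z assume "z \<in> tube B"
  then obtain x y where z: "z = cvec x y" "y \<in> B" by (rule tubeE)
  obtain u v where w: "w = cvec u v" "v \<in> B" using w by (rule tubeE)
  obtain a C where a: "a > 0" "C > 0" and bd: "\<And>t. exp (- 2 * pi * ((y + v) \<bullet> t)) * rI t \<le> C * exp (- a * norm t)"
    using rI_mixed_bound[OF w(2) z(2)] by metis
  define \<psi> where "\<psi> t = kern_four u v y t * cis (2 * pi * (t \<bullet> x))" for t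
  have \<psi>: "\<psi> t = exp (2 * complex_of_real pi * \<i> * cdot (z - vcnj w) t) * complex_of_real (rI t)" for t
    unfolding \<psi>_def z w kern_integrand_eq ..
  have [measurable]: "\<psi> \<in> borel_measurable borel" unfolding \<psi>_def[abs_def] by measurable
  have nb: "cmod (\<psi> t) \<le> C * exp (- a * norm t)" for t
    using bd[of t] by (simp add: \<psi>_def norm_mult norm_kern_four)
  obtain c :: "complex ^ 'n" where c: "((\<lambda>h. LINT t|lborel. exp (2 * complex_of_real pi * \<i> * cdot h t) * \<psi> t) has_derivative (\<lambda>h. \<Sum>k\<in>UNIV. c $ k * h $ k)) (at 0)"
    using has_derivative_exp_integral[OF _ a(1) nb] by auto
  \<comment> \<open>Splitting off \<open>exp (2 pi i h.t)\<close> reduces differentiation at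
    \<open>z\<close> to differentiation at 0, the rest of the integrand being
    \<open>\<psi>\<close>.\<close>
  have k: "kern (z + h) w = (LINT t|lborel. exp (2 * complex_of_real pi * \<i> * cdot h t) * \<psi> t)" for h
  proof -
    have "exp (2 * complex_of_real pi * \<i> * cdot (z + h - vcnj w) t) = exp (2 * complex_of_real pi * \<i> * cdot h t) * exp (2 * complex_of_real pi * \<i> * cdot (z - vcnj w) t)" for t
    proof -
      have "z + h - vcnj w = h + (z - vcnj w)" by simp
      then have "cdot (z + h - vcnj w) t = cdot h t + cdot (z - vcnj w) t" by (simp only: cdot_add)
      then show ?thesis by (simp only: distrib_left exp_add)
    qed
    then show ?thesis by (simp only: kern_def \<psi> mult.assoc)
  qed
  from c have "((\<lambda>z. kern z w) has_derivative (\<lambda>h. \<Sum>k\<in>UNIV. c $ k * h $ k)) (at z)"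
    unfolding has_derivative_at k[symmetric] by simp
  then show "\<exists>c :: complex ^ 'n. ((\<lambda>z. kern z w) has_derivative (\<lambda>h. \<Sum>k\<in>UNIV. c $ k * h $ k)) (at z)" by blast
qed

text \<open>One factor \<open>rI\<close> cancels the integral. The conventions cooperate where the
  integral is infinite: there \<open>rI t = 0\<close>, and \<open>0 * \<infinity> = 0\<close> in
  \<open>ennreal\<close>.\<close>

lemma weight_rI_square_le: "ennreal (s * (rI t)\<^sup>2) * I_weight B \<rho> t \<le> ennreal (s * rI t)" if s: "s \<ge> 0"
proof (cases "I_weight B \<rho> t = \<infinity>")
  case False
  define e where "e = enn2real (I_weight B \<rho> t)"
  have "I_weight B \<rho> t < top" using False by (simp add: less_top)
  then have e: "I_weight B \<rho> t = ennreal e" "e \<ge> 0" by (auto simp: e_def)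
  have "s * (1 / e)\<^sup>2 * e \<le> s * (1 / e)" using e(2) s by (cases "e = 0") (auto simp: power2_eq_square)
  moreover have "rI t = 1 / e" using False by (simp add: I_weight_inv_def e_def)
  ultimately show ?thesis using e s by (simp flip: ennreal_mult add: ennreal_leI)
qed (simp add: I_weight_inv_def)

lemma integrable_exp_rI:
  assumes v: "v \<in> B" shows "integrable lborel (\<lambda>t. exp (- 4 * pi * (v \<bullet> t)) * rI t)"
proof -
  have "- 2 * pi * ((v + v) \<bullet> t) = - 4 * pi * (v \<bullet> t)" for t by (subst inner_add_left) simp
  then show ?thesis
    using integrable_norm[OF integrable_kern_four[OF v v, of 0]] by (simp only: norm_kern_four)
qed

text \<open>After Bessel's inequality in \<open>x\<close>, Tonelli's theorem integrates over
  \<open>y\<close> first. This rebuilds \<open>I_weight\<close>, which cancels one of the two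
  factors \<open>rI\<close>; what remains is \<open>exp (- 4 pi v.t) * rI t\<close>, integrable by
  its exponential decay.\<close>

lemma kern_in_A2:
  assumes w: "w \<in> tube B" shows "(\<lambda>z. kern z w) \<in> A2 B \<rho>"
  unfolding A2_def
proof (intro CollectI conjI sholomorphic_on_kern[OF w])
  obtain u v where w: "w = cvec u v" "v \<in> B" using w by (rule tubeE)
  have "(\<integral>\<^sup>+y\<in>B. (\<integral>\<^sup>+x. ennreal ((cmod (kern (cvec x y) w))\<^sup>2 * \<rho> (cvec 0 y)) \<partial>lborel) \<partial>lborel)
     \<le> (\<integral>\<^sup>+y. \<integral>\<^sup>+t. ennreal (exp (- 4 * pi * (v \<bullet> t)) * (rI t)\<^sup>2) * ennreal (wt y * exp (- 4 * pi * (y \<bullet> t))) \<partial>lborel \<partial>lborel)"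
  proof (rule nn_integral_mono)
    fix y
    show "(\<integral>\<^sup>+x. ennreal ((cmod (kern (cvec x y) w))\<^sup>2 * \<rho> (cvec 0 y)) \<partial>lborel) * indicator B y
      \<le> (\<integral>\<^sup>+t. ennreal (exp (- 4 * pi * (v \<bullet> t)) * (rI t)\<^sup>2) * ennreal (wt y * exp (- 4 * pi * (y \<bullet> t))) \<partial>lborel)"
    proof (cases "y \<in> B")
      case True
      note i = integrable_kern_four[OF w(2) True, of u]
      note [measurable] = borel_measurable_four[OF i]
      have "(\<integral>\<^sup>+x. ennreal ((cmod (kern (cvec x y) w))\<^sup>2 * \<rho> (cvec 0 y)) \<partial>lborel) = (\<integral>\<^sup>+x. ennreal ((cmod (four (kern_four u v y) x))\<^sup>2) * ennreal (wt y) \<partial>lborel)"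
        using True by (intro nn_integral_cong) (simp add: w kern_eq_four ennreal_mult' wt_def)
      also have "\<dots> = (\<integral>\<^sup>+x. ennreal ((cmod (four (kern_four u v y) x))\<^sup>2) \<partial>lborel) * ennreal (wt y)"
        by (rule nn_integral_multc) measurable
      also have "\<dots> \<le> (\<integral>\<^sup>+t. ennreal ((cmod (kern_four u v y t))\<^sup>2) \<partial>lborel) * ennreal (wt y)"
        by (intro mult_right_mono bessel[OF i]) auto
      also have "\<dots> = (\<integral>\<^sup>+t. ennreal ((cmod (kern_four u v y t))\<^sup>2) * ennreal (wt y) \<partial>lborel)"
        by (rule nn_integral_multc[symmetric]) measurable
      also have "\<dots> = (\<integral>\<^sup>+t. ennreal (exp (- 4 * pi * (v \<bullet> t)) * (rI t)\<^sup>2) * ennreal (wt y * exp (- 4 * pi * (y \<bullet> t))) \<partial>lborel)"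
      proof (rule nn_integral_cong)
        fix t
        have "(cmod (kern_four u v y t))\<^sup>2 = exp (- 4 * pi * (v \<bullet> t)) * exp (- 4 * pi * (y \<bullet> t)) * (rI t)\<^sup>2"
          unfolding norm_kern_four power_mult_distrib
          by (simp add: exp_double[symmetric] exp_add[symmetric] inner_add_left algebra_simps)
        then show "ennreal ((cmod (kern_four u v y t))\<^sup>2) * ennreal (wt y) = ennreal (exp (- 4 * pi * (v \<bullet> t)) * (rI t)\<^sup>2) * ennreal (wt y * exp (- 4 * pi * (y \<bullet> t)))"
          by (simp add: ennreal_mult[symmetric] wt_nonneg mult_ac)
      qed
      finally show ?thesis using True by simp
    qed simp
  qed
  also have "\<dots> = (\<integral>\<^sup>+t. \<integral>\<^sup>+y. ennreal (exp (- 4 * pi * (v \<bullet> t)) * (rI t)\<^sup>2) * ennreal (wt y * exp (- 4 * pi * (y \<bullet> t))) \<partial>lborel \<partial>lborel)"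
    by (rule lborel_pair.Fubini') measurable
  also have "\<dots> = (\<integral>\<^sup>+t. ennreal (exp (- 4 * pi * (v \<bullet> t)) * (rI t)\<^sup>2) * I_weight B \<rho> t \<partial>lborel)"
    unfolding I_weight_eq by (intro nn_integral_cong nn_integral_cmult) measurable
  also have "\<dots> \<le> (\<integral>\<^sup>+t. ennreal (exp (- 4 * pi * (v \<bullet> t)) * rI t) \<partial>lborel)"
    by (intro nn_integral_mono weight_rI_square_le) simp
  also have "\<dots> < \<infinity>"
    using integrable_exp_rI[OF w(2)] by (subst nn_integral_eq_integral) (auto simp: rI_nonneg)
  finally show "(\<integral>\<^sup>+y\<in>B. (\<integral>\<^sup>+x. ennreal ((cmod (kern (cvec x y) w))\<^sup>2 * \<rho> (cvec 0 y)) \<partial>lborel) \<partial>lborel) < \<infinity>" .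
qed

end

text \<open>The multiplication formula: the character may be attached to either function, and
  integrability of \<open>f\<close> and \<open>g\<close> suffices for Fubini's theorem. It stands in
  for Parseval's identity when a slice of the kernel, itself a transform, is paired with a slice of
  a regularized function.\<close>

lemma integral_mult_cnj_four:
  fixes f g :: "'a::euclidean_space \<Rightarrow> complex"
  assumes f: "integrable lborel f" and g: "integrable lborel g"
  shows "(LINT x|lborel. f x * cnj (four g x)) = (LINT t|lborel. cnj (g t) * four f (- t))"
proof -
  note [measurable] = borel_measurable_integrable[OF f] borel_measurable_integrable[OF g]
  have cn: "cnj (four g x) = (LINT t|lborel. cnj (g t) * cis (2 * pi * (x \<bullet> - t)))" for x
  proof -
    have "cnj (g t) * cis (2 * pi * (x \<bullet> - t)) = cnj (g t * cis (2 * pi * (t \<bullet> x)))" for t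
      by (simp add: cis_cnj inner_commute)
    then show ?thesis by (simp only: four_def Bochner_Integration.integral_cnj)
  qed
  have fub: "integrable (lborel \<Otimes>\<^sub>M lborel) (\<lambda>(x,t). f x * cnj (g t) * cis (2 * pi * (x \<bullet> - t)))"
  proof (rule Bochner_Integration.integrable_bound)
    show "integrable (lborel \<Otimes>\<^sub>M lborel) (\<lambda>(x,t). f x * cnj (g t))"
      by (rule integrable_pair_mult) (use f g in auto)
    show "(\<lambda>(x,t). f x * cnj (g t) * cis (2 * pi * (x \<bullet> - t))) \<in> borel_measurable (lborel \<Otimes>\<^sub>M lborel)" by measurable
  qed (auto simp: norm_mult)
  have "(LINT x|lborel. f x * cnj (four g x)) = (LINT x|lborel. LINT t|lborel. f x * cnj (g t) * cis (2 * pi * (x \<bullet> - t)))"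
    unfolding cn by (simp only: mult.assoc integral_mult_right_zero)
  also have "\<dots> = (LINT t|lborel. LINT x|lborel. f x * cnj (g t) * cis (2 * pi * (x \<bullet> - t)))"
    by (rule lborel_pair.Fubini_integral[OF fub, symmetric])
  also have "\<dots> = (LINT t|lborel. cnj (g t) * four f (- t))"
    unfolding four_def by (simp only: integral_mult_right_zero[symmetric] mult_ac)
  finally show ?thesis .
qed

text \<open>The transforms of neighbouring slices are bounded by one constant. Passing to a slice
  displaced by \<open>r / 2\<close> against the direction of \<open>- t\<close> keeps that bound and
  gains \<open>exp (- pi r |t|)\<close> from the factors in \<open>four_slice_shift\<close>.\<close>

lemma integrable_four_slice:
  assumes H: "gauss_dominated B H" and B: "open B" "connected B" and v: "v \<in> B"
  shows "integrable lborel (four (\<lambda>x. H (cvec x v)))"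
proof -
  obtain r C c where r: "r > 0" "C \<ge> 0" "c > 0" "ball v r \<subseteq> B"
    and bd: "\<And>x y. y \<in> ball v r \<Longrightarrow> cmod (H (cvec x y)) \<le> C * exp (- c * (norm x)\<^sup>2)"
    using H v unfolding gauss_dominated_def by blast
  define C0 where "C0 = (LINT x|lborel. C * exp (- c * (norm (x :: real ^ 'a))\<^sup>2))"
  have C0: "C0 \<ge> 0" unfolding C0_def using r by (intro integral_nonneg_AE) auto
  have four_le: "cmod (four (\<lambda>x. H (cvec x y)) t) \<le> C0" if y: "y \<in> ball v r" for y t
  proof -
    have "y \<in> B" using y r by auto
    note i = gauss_dominated_slice(3)[OF H this]
    have "cmod (four (\<lambda>x. H (cvec x y)) t) \<le> (LINT x|lborel. norm (H (cvec x y)))" by (rule norm_four_le[OF i])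
    also have "\<dots> \<le> C0" unfolding C0_def
      by (intro integral_mono bd y integrable_norm i integrable_mult_right integrable_gauss r)
    finally show ?thesis .
  qed
  have decay: "cmod (four (\<lambda>x. H (cvec x v)) t) \<le> C0 * exp (- (pi * r) * norm t)" for t
  proof -
    define s where "s = - t"
    define y where "y = v - (r / 2) *\<^sub>R sgn s"
    have "norm ((r / 2) *\<^sub>R sgn s) < r" using r by (simp add: norm_sgn)
    then have yb: "y \<in> ball v r" by (simp add: y_def dist_norm)
    then have "y \<in> B" using r by auto
    from arg_cong[OF four_slice_shift[OF H B v this, of s], of cmod]
    have "exp (2 * pi * (v \<bullet> s)) * cmod (four (\<lambda>x. H (cvec x v)) t) = exp (2 * pi * (y \<bullet> s)) * cmod (four (\<lambda>x. H (cvec x y)) t)"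
      by (simp add: s_def norm_mult)
    also have "\<dots> \<le> exp (2 * pi * (y \<bullet> s)) * C0" by (intro mult_left_mono four_le yb) auto
    finally have "cmod (four (\<lambda>x. H (cvec x v)) t) \<le> exp (2 * pi * (y \<bullet> s)) * C0 / exp (2 * pi * (v \<bullet> s))"
      by (simp add: pos_le_divide_eq mult.commute)
    also have "\<dots> = C0 * exp (2 * pi * (y \<bullet> s) - 2 * pi * (v \<bullet> s))" by (simp add: exp_diff)
    also have "2 * pi * (y \<bullet> s) - 2 * pi * (v \<bullet> s) = - (pi * r) * norm t"
    proof -
      have "sgn s \<bullet> s = norm s" by (cases "s = 0") (auto simp: sgn_div_norm power2_norm_eq_inner[symmetric] power2_eq_square)
      then have "y \<bullet> s = v \<bullet> s - (r / 2) * norm t" by (simp add: y_def inner_diff_left) (simp add: s_def)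
      then show ?thesis by (simp only:) (simp add: algebra_simps)
    qed
    finally show ?thesis .
  qed
  show ?thesis
  proof (rule Bochner_Integration.integrable_bound)
    show "integrable lborel (\<lambda>t :: real ^ 'a. C0 * exp (- (pi * r) * norm t))"
      by (rule integrable_mult_right, rule integrable_exp_neg_norm) (use r in simp)
    show "four (\<lambda>x. H (cvec x v)) \<in> borel_measurable lborel"
      using borel_measurable_four[OF gauss_dominated_slice(3)[OF H v]] by simp
  qed (use decay C0 in auto)
qed

context tube_weight
begin

text \<open>Extended by 0 off the tube and with the height as first argument, so that the iterated
  integrals of \<open>A2_inner\<close> become integrals over a product space.\<close>

definition slice :: "(complex ^ 'n \<Rightarrow> complex) \<Rightarrow> real ^ 'n \<Rightarrow> real ^ 'n \<Rightarrow> complex" where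
  "slice F y x = indicator B y *\<^sub>R F (cvec x y)"

lemma measurable_slice:
  assumes F: "sholomorphic_on F (tube B)"
  shows "case_prod (slice F) \<in> borel_measurable (lborel \<Otimes>\<^sub>M lborel)"
proof -
  have "(\<lambda>p. indicator (B \<times> UNIV) p *\<^sub>R F (cvec (snd p) (fst p))) \<in> borel_measurable borel"
    by (intro borel_measurable_continuous_on_indicator continuous_intros continuous_on_tube_compose[OF sholomorphic_on_imp_continuous_on[OF F]])
      (use open_B in \<open>auto intro!: borel_open open_Times\<close>)
  also have "(\<lambda>p. indicator (B \<times> UNIV) p *\<^sub>R F (cvec (snd p) (fst p))) = case_prod (slice F)"
    by (auto simp: slice_def indicator_def fun_eq_iff)
  finally show ?thesis by (simp add: lborel_prod)
qed

lemma A2_slice: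
  assumes F: "F \<in> A2 B \<rho>"
  shows "sholomorphic_on F (tube B)"
    and "(\<integral>\<^sup>+y. \<integral>\<^sup>+x. ennreal ((cmod (slice F y x))\<^sup>2 * wt y) \<partial>lborel \<partial>lborel) < \<infinity>"
proof -
  show "sholomorphic_on F (tube B)" using F by (simp add: A2_def)
  have "(\<integral>\<^sup>+y. \<integral>\<^sup>+x. ennreal ((cmod (slice F y x))\<^sup>2 * wt y) \<partial>lborel \<partial>lborel)
     = (\<integral>\<^sup>+y\<in>B. (\<integral>\<^sup>+x. ennreal ((cmod (F (cvec x y)))\<^sup>2 * \<rho> (cvec 0 y)) \<partial>lborel) \<partial>lborel)"
    by (rule nn_integral_cong) (auto simp: slice_def wt_def indicator_def)
  then show "(\<integral>\<^sup>+y. \<integral>\<^sup>+x. ennreal ((cmod (slice F y x))\<^sup>2 * wt y) \<partial>lborel \<partial>lborel) < \<infinity>"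
    using F by (simp add: A2_def)
qed

text \<open>On a compact ball around \<open>y0\<close> the weight is bounded below, so membership in
  \<open>A2\<close> controls the unweighted integral over the heights in that ball.
  \<open>local_mean_bound\<close> converts this into a bound on values, uniform in \<open>x\<close>
  because its right side does not contain \<open>x\<close>.\<close>

lemma A2_locally_bounded:
  assumes F: "F \<in> A2 B \<rho>" and y0: "y0 \<in> B"
  shows "\<exists>r>0. \<exists>C\<ge>0. ball y0 r \<subseteq> B \<and> (\<forall>x. \<forall>y\<in>ball y0 r. cmod (F (cvec x y)) \<le> C)"
proof -
  obtain c where c: "c > 0" "cball y0 c \<subseteq> B" using open_B y0 open_contains_cball by blast
  have cont: "continuous_on (cball y0 c) wt" using continuous_on_wt c continuous_on_subset by blast
  obtain y1 where y1: "y1 \<in> cball y0 c" "\<And>y. y \<in> cball y0 c \<Longrightarrow> wt y1 \<le> wt y"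
    using continuous_attains_inf[OF compact_cball _ cont] c by auto
  define l where "l = wt y1"
  have l: "l > 0" unfolding l_def using y1 c by (intro wt_pos) auto
  let ?N = "\<integral>\<^sup>+y. \<integral>\<^sup>+x. ennreal ((cmod (slice F y x))\<^sup>2 * wt y) \<partial>lborel \<partial>lborel"
  define N where "N = enn2real ?N"
  have N: "?N = ennreal N" "N \<ge> 0" using A2_slice(2)[OF F] by (auto simp: N_def)
  note meas = measurable_slice[OF A2_slice(1)[OF F]]
  have [measurable]: "(\<lambda>x. slice F (f x) (h x)) \<in> borel_measurable M" if "f \<in> borel_measurable M" "h \<in> borel_measurable M" for f h :: "'c \<Rightarrow> real ^ 'n" and M
    using measurable_compose[OF measurable_Pair[of f M lborel h lborel] meas] that by simp
  define V where "V = measure lborel (cball (0 :: (real ^ 'n) \<times> (real ^ 'n)) (c / 8))"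
  have V: "V > 0" using c by (simp add: V_def)
  define C where "C = sqrt (1 / l * N / V)"
  have "cmod (F (cvec x y)) \<le> C" if y: "y \<in> ball y0 (c / 2)" for x y
  proof -
    have "ennreal (V * (cmod (F (cvec x y)))\<^sup>2) \<le> (\<integral>\<^sup>+\<eta>. \<integral>\<^sup>+\<xi>. ennreal (indicator (cball y0 c) \<eta> * (cmod (F (cvec \<xi> \<eta>)))\<^sup>2) \<partial>lborel \<partial>lborel)"
      unfolding V_def using y
      by (intro local_mean_bound[OF open_B A2_slice(1)[OF F] c]) (simp add: dist_norm norm_minus_commute)
    also have "\<dots> \<le> (\<integral>\<^sup>+\<eta>. \<integral>\<^sup>+\<xi>. ennreal (1 / l) * ennreal ((cmod (slice F \<eta> \<xi>))\<^sup>2 * wt \<eta>) \<partial>lborel \<partial>lborel)"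
    proof (intro nn_integral_mono)
      fix \<eta> \<xi>
      show "ennreal (indicator (cball y0 c) \<eta> * (cmod (F (cvec \<xi> \<eta>)))\<^sup>2) \<le> ennreal (1 / l) * ennreal ((cmod (slice F \<eta> \<xi>))\<^sup>2 * wt \<eta>)"
      proof (cases "\<eta> \<in> cball y0 c")
        case True
        then have "l \<le> wt \<eta>" "\<eta> \<in> B" using y1 c by (auto simp: l_def)
        then have "(cmod (F (cvec \<xi> \<eta>)))\<^sup>2 * l \<le> (cmod (slice F \<eta> \<xi>))\<^sup>2 * wt \<eta>"
          by (simp add: slice_def mult_left_mono)
        then have "(cmod (F (cvec \<xi> \<eta>)))\<^sup>2 \<le> 1 / l * ((cmod (slice F \<eta> \<xi>))\<^sup>2 * wt \<eta>)"
          using l by (simp add: pos_le_divide_eq)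
        then show ?thesis using True l by (subst ennreal_mult[symmetric]) (auto simp: wt_nonneg intro: ennreal_leI)
      qed simp
    qed
    also have "\<dots> = ennreal (1 / l) * ?N" by (simp add: nn_integral_cmult)
    finally have "V * (cmod (F (cvec x y)))\<^sup>2 \<le> 1 / l * N"
      using l N by (simp flip: ennreal_mult)
    then have "(cmod (F (cvec x y)))\<^sup>2 \<le> 1 / l * N / V" using V by (simp only: pos_le_divide_eq mult.commute)
    then show ?thesis unfolding C_def by (rule real_le_rsqrt)
  qed
  moreover have "C \<ge> 0" using l V N by (simp add: C_def)
  moreover have "ball y0 (c / 2) \<subseteq> B" using c by (intro order_trans[OF _ c(2)]) auto
  ultimately show ?thesis using c by (intro exI[of _ "c / 2"]) auto
qed

text \<open>A product is at most the sum of the squares. Absolute integrability lets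
  \<open>A2_inner\<close> be read as a single integral over the product space.\<close>

lemma A2_inner_integrable:
  assumes F: "F \<in> A2 B \<rho>" and G: "G \<in> A2 B \<rho>"
  shows "integrable (lborel \<Otimes>\<^sub>M lborel) (\<lambda>(y, x). slice F y x * cnj (slice G y x) * complex_of_real (wt y))"
proof (rule integrable_pairI)
  have [measurable]: "(\<lambda>x. slice F (f x) (h x)) \<in> borel_measurable M" if "f \<in> borel_measurable M" "h \<in> borel_measurable M" for f h :: "'c \<Rightarrow> real ^ 'n" and M
    using measurable_compose[OF measurable_Pair[of f M lborel h lborel] measurable_slice[OF A2_slice(1)[OF F]]] that by simp
  have [measurable]: "(\<lambda>x. slice G (f x) (h x)) \<in> borel_measurable M" if "f \<in> borel_measurable M" "h \<in> borel_measurable M" for f h :: "'c \<Rightarrow> real ^ 'n" and M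
    using measurable_compose[OF measurable_Pair[of f M lborel h lborel] measurable_slice[OF A2_slice(1)[OF G]]] that by simp
  show "(\<lambda>(y, x). slice F y x * cnj (slice G y x) * complex_of_real (wt y)) \<in> borel_measurable (lborel \<Otimes>\<^sub>M lborel)"
    by measurable
  have "(\<integral>\<^sup>+y. \<integral>\<^sup>+x. ennreal (norm (slice F y x * cnj (slice G y x) * complex_of_real (wt y))) \<partial>lborel \<partial>lborel)
    \<le> (\<integral>\<^sup>+y. \<integral>\<^sup>+x. ennreal ((cmod (slice F y x))\<^sup>2 * wt y) + ennreal ((cmod (slice G y x))\<^sup>2 * wt y) \<partial>lborel \<partial>lborel)"
  proof (intro nn_integral_mono)
    fix y x
    have "cmod (slice F y x) * cmod (slice G y x) \<le> (cmod (slice F y x))\<^sup>2 + (cmod (slice G y x))\<^sup>2"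
      using sum_squares_bound[of "cmod (slice F y x)" "cmod (slice G y x)"] mult_nonneg_nonneg[OF norm_ge_zero[of "slice F y x"] norm_ge_zero[of "slice G y x"]]
      by linarith
    from mult_right_mono[OF this wt_nonneg[of y]]
    show "ennreal (norm (slice F y x * cnj (slice G y x) * complex_of_real (wt y))) \<le> ennreal ((cmod (slice F y x))\<^sup>2 * wt y) + ennreal ((cmod (slice G y x))\<^sup>2 * wt y)"
      by (simp add: norm_mult wt_nonneg distrib_right flip: ennreal_plus)
  qed
  also have "\<dots> = (\<integral>\<^sup>+y. \<integral>\<^sup>+x. ennreal ((cmod (slice F y x))\<^sup>2 * wt y) \<partial>lborel \<partial>lborel) + (\<integral>\<^sup>+y. \<integral>\<^sup>+x. ennreal ((cmod (slice G y x))\<^sup>2 * wt y) \<partial>lborel \<partial>lborel)"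
    by (simp add: nn_integral_add)
  also have "\<dots> < \<infinity>" using A2_slice(2)[OF F] A2_slice(2)[OF G] by simp
  finally show "(\<integral>\<^sup>+y. \<integral>\<^sup>+x. ennreal (norm (slice F y x * cnj (slice G y x) * complex_of_real (wt y))) \<partial>lborel \<partial>lborel) < \<infinity>" .
qed

lemma A2_inner_eq:
  "A2_inner B \<rho> F G = (LINT y|lborel. LINT x|lborel. slice F y x * cnj (slice G y x) * complex_of_real (wt y))"
  unfolding A2_inner_def set_lebesgue_integral_def
  by (rule Bochner_Integration.integral_cong[OF refl]) (simp add: slice_def wt_def indicator_def)

lemma A2_inner_cnj: "A2_inner B \<rho> F G = cnj (A2_inner B \<rho> G F)"
proof -
  have "slice F y x * cnj (slice G y x) * complex_of_real (wt y) = cnj (slice G y x * cnj (slice F y x) * complex_of_real (wt y))" for y x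
    by simp
  then show ?thesis unfolding A2_inner_eq by (simp only: Bochner_Integration.integral_cnj)
qed

end

lemma lborel_reflect: "lborel = distr lborel borel (\<lambda>x::'a::euclidean_space. - x)"
  using lborel_affine[of "-1" "0::'a"] by (simp add: density_1)

lemma integral_lborel_reflect:
  fixes f :: "'a::euclidean_space \<Rightarrow> 'b::{banach, second_countable_topology}"
  assumes [measurable]: "f \<in> borel_measurable borel"
  shows "(LINT x|lborel. f (- x)) = (LINT x|lborel. f x)"
  by (subst (2) lborel_reflect, subst integral_distr) auto

lemma integrable_lborel_reflect:
  fixes f :: "'a::euclidean_space \<Rightarrow> 'b::{banach, second_countable_topology}"
  assumes f: "integrable lborel f" shows "integrable lborel (\<lambda>x. f (- x))"
proof -
  have "f \<in> borel_measurable borel" using borel_measurable_integrable[OF f] by simp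
  then show ?thesis using f by (subst (asm) lborel_reflect, subst (asm) integrable_distr_eq) auto
qed

lemma nn_integral_lborel_reflect:
  fixes f :: "'a::euclidean_space \<Rightarrow> ennreal"
  assumes [measurable]: "f \<in> borel_measurable borel"
  shows "(\<integral>\<^sup>+x. f (- x) \<partial>lborel) = (\<integral>\<^sup>+x. f x \<partial>lborel)"
  by (subst (2) lborel_reflect, subst nn_integral_distr) auto

subsection \<open>The reproducing property\<close>

context tube_weight
begin

text \<open>The rate is tied to the cutoff \<open>wt_cut m\<close>: where the latter does not vanish, \<open>eps m * (norm y)\<^sup>2 \<le> 1\<close>, so that
  the regularizing factor is bounded by \<open>exp 1\<close> uniformly in \<open>m\<close>.\<close>

definition eps :: "nat \<Rightarrow> real" where "eps m = 1 / (real (Suc m))\<^sup>2"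

definition regularize :: "(complex ^ 'n \<Rightarrow> complex) \<Rightarrow> nat \<Rightarrow> complex ^ 'n \<Rightarrow> complex" where
  "regularize F m z = F z * exp (\<Sum>k\<in>UNIV. - of_real (eps m) * z $ k * z $ k)"

text \<open>This is the integrand \<open>\<phi>\<^sub>m t * exp (2 pi i t.w)\<close> for
  \<open>w = u + i v\<close>: the factor \<open>exp (2 pi v.t)\<close> contained in
  \<open>\<phi>\<^sub>m\<close> cancels the modulus of the exponential.\<close>

definition spectrum :: "(complex ^ 'n \<Rightarrow> complex) \<Rightarrow> nat \<Rightarrow> real ^ 'n \<Rightarrow> real ^ 'n \<Rightarrow> real ^ 'n \<Rightarrow> complex" where
  "spectrum F m u v t = cis (2 * pi * (u \<bullet> t)) * four (\<lambda>x. regularize F m (cvec x v)) (- t)"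

lemma eps_pos: "eps m > 0" by (simp add: eps_def)

lemma eps_LIMSEQ: "eps \<longlonglongrightarrow> 0"
proof -
  have "(\<lambda>m. (1 / real (Suc m))\<^sup>2) \<longlonglongrightarrow> 0\<^sup>2"
    by (intro tendsto_intros LIMSEQ_Suc[OF lim_inverse_n, unfolded inverse_eq_divide])
  then show ?thesis by (simp add: eps_def[abs_def] power_divide)
qed

lemma eps_le: assumes "norm (y :: real ^ 'n) \<le> m" shows "eps m * (norm y)\<^sup>2 \<le> 1"
proof -
  have "(norm y)\<^sup>2 \<le> (real (Suc m))\<^sup>2" using assms by (intro power_mono) auto
  then show ?thesis by (simp add: eps_def)
qed

lemma regularize_LIMSEQ: "(\<lambda>m. regularize F m z) \<longlonglongrightarrow> F z"
proof -
  have "(\<lambda>m. regularize F m z) \<longlonglongrightarrow> F z * exp (\<Sum>k\<in>UNIV. - of_real 0 * z $ k * z $ k)"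
    unfolding regularize_def by (intro tendsto_intros eps_LIMSEQ)
  then show ?thesis by simp
qed

lemma norm_regularize_le:
  assumes "norm y \<le> real m" shows "cmod (regularize F m (cvec x y)) \<le> exp 1 * cmod (F (cvec x y))"
proof -
  have "eps m * (norm x)\<^sup>2 \<ge> 0" using eps_pos[of m] by (simp add: less_imp_le)
  then have "- eps m * (norm x)\<^sup>2 + eps m * (norm y)\<^sup>2 \<le> 1" using eps_le[OF assms] by simp
  then have "cmod (F (cvec x y)) * exp (- eps m * (norm x)\<^sup>2 + eps m * (norm y)\<^sup>2) \<le> cmod (F (cvec x y)) * exp 1"
    by (intro mult_left_mono) auto
  then show ?thesis unfolding regularize_def norm_mult norm_gauss_cvec by (simp only: mult.commute)
qed

lemma gauss_dominated_regularized:
  "F \<in> A2 B \<rho> \<Longrightarrow> gauss_dominated B (regularize F m)"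
  unfolding regularize_def[abs_def]
  by (intro gauss_dominated_regularize A2_locally_bounded A2_slice eps_pos)

lemma wt_cut_nonzeroD:
  assumes "wt_cut m y \<noteq> 0" shows "y \<in> B" "norm y \<le> m"
  using assms wt_notin[of y] by (auto simp: wt_cut_def split: if_splits)

lemma norm_slice_regularize_le:
  "cmod (slice (regularize F m) y x) * wt_cut m y \<le> exp 1 * cmod (slice F y x) * wt y"
proof (cases "wt_cut m y = 0")
  case False
  have "cmod (slice (regularize F m) y x) \<le> exp 1 * cmod (slice F y x)"
    using norm_regularize_le[OF wt_cut_nonzeroD(2)[OF False]] wt_cut_nonzeroD(1)[OF False] by (simp add: slice_def)
  then show ?thesis by (intro mult_mono wt_cut_le) (auto simp: wt_cut_nonneg)
qed (simp add: wt_nonneg)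

lemma measurable_slice_comp:
  assumes "sholomorphic_on F (tube B)" "f \<in> borel_measurable M" "h \<in> borel_measurable M"
  shows "(\<lambda>x. slice F (f x) (h x)) \<in> borel_measurable M"
  using measurable_compose[OF measurable_Pair[of f M lborel h lborel] measurable_slice[OF assms(1)]] assms(2,3) by simp

context
  fixes F :: "complex ^ 'n \<Rightarrow> complex" and u v :: "real ^ 'n"
  assumes F: "F \<in> A2 B \<rho>" and v: "v \<in> B"
begin

abbreviation "K \<equiv> (\<lambda>z. kern z (cvec u v))"

lemma K_A2: "K \<in> A2 B \<rho>"
  by (rule kern_in_A2) (simp add: v)

lemma sholomorphic_regularize: "sholomorphic_on (regularize F m) (tube B)"
  using gauss_dominated_regularized[OF F] by (simp add: gauss_dominated_def)

lemma reg_slice_integrable: "y \<in> B \<Longrightarrow> integrable lborel (\<lambda>x. regularize F m (cvec x y))"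
  by (rule gauss_dominated_slice(3)[OF gauss_dominated_regularized[OF F]])

lemma spectrum_integrable: "integrable lborel (spectrum F m u v)"
proof -
  note i = integrable_lborel_reflect[OF integrable_four_slice[OF gauss_dominated_regularized[OF F] open_B connected_B v]]
  have "integrable lborel (\<lambda>t. four (\<lambda>x. regularize F m (cvec x v)) (- t) * cis (2 * pi * (u \<bullet> t)))"
    by (rule integrable_mult_cis[OF i]) measurable
  then show ?thesis by (simp add: spectrum_def[abs_def] mult.commute)
qed

lemma measurable_spectrum [measurable]: "spectrum F m u v \<in> borel_measurable borel"
  using borel_measurable_integrable[OF spectrum_integrable] by simp

lemma regularize_eq_integral: "regularize F m (cvec u v) = (LINT t|lborel. spectrum F m u v t)"
proof -
  note gd = gauss_dominated_regularized[OF F, of m]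
  obtain M where M: "\<And>x. cmod (regularize F m (cvec x v)) \<le> M" using gauss_dominated_slice(2)[OF gd v] by blast
  note fi = integrable_four_slice[OF gd open_B connected_B v]
  have [measurable]: "four (\<lambda>x. regularize F m (cvec x v)) \<in> borel_measurable borel"
    using borel_measurable_integrable[OF fi] by simp
  have "regularize F m (cvec u v) = (LINT t|lborel. four (\<lambda>x. regularize F m (cvec x v)) t * cis (- 2 * pi * (u \<bullet> t)))"
    by (rule fourier_inversion[OF reg_slice_integrable[OF v] gauss_dominated_slice(1)[OF gd v] M fi])
  also have "\<dots> = (LINT t|lborel. four (\<lambda>x. regularize F m (cvec x v)) (- t) * cis (- 2 * pi * (u \<bullet> - t)))"
    by (rule integral_lborel_reflect[symmetric]) measurable
  finally show ?thesis by (simp add: spectrum_def mult.commute)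
qed

lemma four_slice_eq:
  assumes y: "y \<in> B"
  shows "four (\<lambda>x. regularize F m (cvec x y)) (- t) = of_real (exp (- 2 * pi * (y \<bullet> t)) * exp (2 * pi * (v \<bullet> t))) * (cis (- 2 * pi * (u \<bullet> t)) * spectrum F m u v t)"
proof -
  have "of_real (exp (2 * pi * (y \<bullet> t))) * four (\<lambda>x. regularize F m (cvec x y)) (- t)
      = of_real (exp (2 * pi * (v \<bullet> t))) * four (\<lambda>x. regularize F m (cvec x v)) (- t)"
    by (rule four_slice_shift[OF gauss_dominated_regularized[OF F] open_B connected_B y v])
  moreover have "four (\<lambda>x. regularize F m (cvec x v)) (- t) = cis (- 2 * pi * (u \<bullet> t)) * spectrum F m u v t"
    by (simp add: spectrum_def cis_mult mult.assoc[symmetric])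
  moreover have "X = of_real (exp (- a) * b) * Y" if "of_real (exp a) * X = of_real b * Y" for a b :: real and X Y :: complex
    using that by (simp add: exp_minus field_simps)
  ultimately show ?thesis by simp
qed

text \<open>The multiplication formula moves the pairing at height \<open>y\<close> to the spectral
  side. The factors that depend on \<open>v\<close> cancel, so that \<open>y\<close> enters only
  through the integrand of \<open>I_cut\<close>.\<close>

lemma inner_slice_eq:
  "(LINT x|lborel. slice (regularize F m) y x * cnj (slice K y x) * complex_of_real (wt_cut m y))
    = (LINT t|lborel. complex_of_real (wt_cut m y * exp (- 4 * pi * (y \<bullet> t)) * rI t) * spectrum F m u v t)"
proof (cases "y \<in> B")
  case True
  have "slice (regularize F m) y x * cnj (slice K y x) * complex_of_real (wt_cut m y)
     = complex_of_real (wt_cut m y) * (regularize F m (cvec x y) * cnj (four (kern_four u v y) x))" for x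
    using True by (simp add: slice_def kern_eq_four)
  then have "(LINT x|lborel. slice (regularize F m) y x * cnj (slice K y x) * complex_of_real (wt_cut m y))
    = complex_of_real (wt_cut m y) * (LINT x|lborel. regularize F m (cvec x y) * cnj (four (kern_four u v y) x))"
    by (simp only: integral_mult_right_zero)
  also have "\<dots> = complex_of_real (wt_cut m y) * (LINT t|lborel. cnj (kern_four u v y t) * four (\<lambda>x. regularize F m (cvec x y)) (- t))"
    by (simp only: integral_mult_cnj_four[OF reg_slice_integrable[OF True] integrable_kern_four[OF v True]])
  also have "\<dots> = (LINT t|lborel. complex_of_real (wt_cut m y) * (cnj (kern_four u v y t) * four (\<lambda>x. regularize F m (cvec x y)) (- t)))"
    by (simp only: integral_mult_right_zero)
  also have "\<dots> = (LINT t|lborel. complex_of_real (wt_cut m y * exp (- 4 * pi * (y \<bullet> t)) * rI t) * spectrum F m u v t)"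
  proof (rule Bochner_Integration.integral_cong[OF refl])
    fix t
    have c: "cis (2 * pi * (u \<bullet> t)) * cis (- 2 * pi * (u \<bullet> t)) = 1" by (simp add: cis_mult)
    \<comment> \<open>The first exponent comes from the kernel, the other two from expressing the
      slice at height \<open>y\<close> through the spectrum at height \<open>v\<close>.\<close>
    have e: "exp (- 2 * pi * ((y + v) \<bullet> t)) * (exp (- 2 * pi * (y \<bullet> t)) * exp (2 * pi * (v \<bullet> t))) = exp (- 4 * pi * (y \<bullet> t))"
      by (simp add: exp_add[symmetric] inner_add_left algebra_simps)
    have "cnj (kern_four u v y t) = complex_of_real (exp (- 2 * pi * ((y + v) \<bullet> t)) * rI t) * cis (2 * pi * (u \<bullet> t))"
      by (simp add: kern_four_def cis_cnj)
    then have "cnj (kern_four u v y t) * four (\<lambda>x. regularize F m (cvec x y)) (- t)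
       = complex_of_real (exp (- 2 * pi * ((y + v) \<bullet> t)) * (exp (- 2 * pi * (y \<bullet> t)) * exp (2 * pi * (v \<bullet> t)))) * complex_of_real (rI t)
          * (cis (2 * pi * (u \<bullet> t)) * cis (- 2 * pi * (u \<bullet> t))) * spectrum F m u v t"
      unfolding four_slice_eq[OF True] by (simp only: of_real_mult mult_ac)
    then show "complex_of_real (wt_cut m y) * (cnj (kern_four u v y t) * four (\<lambda>x. regularize F m (cvec x y)) (- t)) = complex_of_real (wt_cut m y * exp (- 4 * pi * (y \<bullet> t)) * rI t) * spectrum F m u v t"
      unfolding c e by (simp add: mult_ac)
  qed
  finally show ?thesis .
next
  case False
  then have "wt_cut m y = 0" using wt_cut_nonzeroD(1)[of m y] by blast
  then show ?thesis by simp
qed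

text \<open>Integration over \<open>y\<close> collects the weights into \<open>I_cut\<close>.
  Fubini's theorem applies because the multiplier \<open>I_cut m t * rI t\<close> is at most 1 and
  the spectrum is integrable.\<close>

lemma cut_inner_eq:
  "(LINT y|lborel. LINT x|lborel. slice (regularize F m) y x * cnj (slice K y x) * complex_of_real (wt_cut m y))
    = (LINT t|lborel. complex_of_real (I_cut m t * rI t) * spectrum F m u v t)"
proof -
  let ?f = "\<lambda>t y. complex_of_real (wt_cut m y * exp (- 4 * pi * (y \<bullet> t)) * rI t) * spectrum F m u v t"
  have "integrable (lborel \<Otimes>\<^sub>M lborel) (\<lambda>(t, y). ?f t y)"
  proof (rule integrable_pairI)
    show "(\<lambda>(t, y). ?f t y) \<in> borel_measurable (lborel \<Otimes>\<^sub>M lborel)" by measurable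
    have "(\<integral>\<^sup>+t. \<integral>\<^sup>+y. ennreal (norm (?f t y)) \<partial>lborel \<partial>lborel) \<le> (\<integral>\<^sup>+t. ennreal (norm (spectrum F m u v t)) \<partial>lborel)"
    proof (rule nn_integral_mono)
      fix t
      have "(\<integral>\<^sup>+y. ennreal (norm (?f t y)) \<partial>lborel) = (\<integral>\<^sup>+y. ennreal (wt_cut m y * exp (- 4 * pi * (y \<bullet> t))) * ennreal (rI t * norm (spectrum F m u v t)) \<partial>lborel)"
        by (rule nn_integral_cong) (simp add: norm_mult wt_cut_nonneg rI_nonneg ennreal_mult[symmetric] mult.assoc)
      also have "\<dots> = ennreal (I_cut m t) * ennreal (rI t * norm (spectrum F m u v t))"
        unfolding ennreal_I_cut by (rule nn_integral_multc) measurable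
      also have "\<dots> = ennreal (I_cut m t * rI t * norm (spectrum F m u v t))"
        by (simp add: ennreal_mult[symmetric] I_cut_nonneg rI_nonneg mult.assoc)
      also have "\<dots> \<le> ennreal (norm (spectrum F m u v t))"
        by (intro ennreal_leI mult_left_le_one_le I_cut_rI_le) (auto simp: I_cut_nonneg rI_nonneg)
      finally show "(\<integral>\<^sup>+y. ennreal (norm (?f t y)) \<partial>lborel) \<le> ennreal (norm (spectrum F m u v t))" .
    qed
    also have "\<dots> < \<infinity>" using spectrum_integrable by (simp add: integrable_iff_bounded)
    finally show "(\<integral>\<^sup>+t. \<integral>\<^sup>+y. ennreal (norm (?f t y)) \<partial>lborel \<partial>lborel) < \<infinity>" .
  qed
  then have "(LINT y|lborel. LINT t|lborel. ?f t y) = (LINT t|lborel. LINT y|lborel. ?f t y)"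
    by (rule lborel_pair.Fubini_integral)
  also have "\<dots> = (LINT t|lborel. complex_of_real (I_cut m t * rI t) * spectrum F m u v t)"
  proof (rule Bochner_Integration.integral_cong[OF refl])
    fix t
    have "(LINT y|lborel. ?f t y) = (LINT y|lborel. complex_of_real (wt_cut m y * exp (- 4 * pi * (y \<bullet> t))) * (complex_of_real (rI t) * spectrum F m u v t))"
      by (simp only: of_real_mult mult.assoc)
    also have "\<dots> = complex_of_real (I_cut m t) * (complex_of_real (rI t) * spectrum F m u v t)"
      unfolding I_cut_def by (simp only: integral_mult_left_zero integral_complex_of_real)
    finally show "(LINT y|lborel. ?f t y) = complex_of_real (I_cut m t * rI t) * spectrum F m u v t"
      by (simp only: of_real_mult mult.assoc)
  qed
  finally show ?thesis unfolding inner_slice_eq .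
qed

text \<open>On the support of \<open>wt_cut m\<close> the regularizing factor is at most
  \<open>exp 1\<close>, so \<open>exp 1\<close> times the modulus of the uncut integrand dominates.
  Dominated convergence is applied once, on the product space.\<close>

lemma cut_inner_LIMSEQ:
  "(\<lambda>m. LINT y|lborel. LINT x|lborel. slice (regularize F m) y x * cnj (slice K y x) * complex_of_real (wt_cut m y)) \<longlonglongrightarrow> A2_inner B \<rho> F K"
proof -
  define h where "h = (\<lambda>m (y, x). slice (regularize F m) y x * cnj (slice K y x) * complex_of_real (wt_cut m y))"
  define h0 where "h0 = (\<lambda>(y, x). slice F y x * cnj (slice K y x) * complex_of_real (wt y))"
  have h0: "integrable (lborel \<Otimes>\<^sub>M lborel) h0" unfolding h0_def by (rule A2_inner_integrable[OF F K_A2])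
  note [measurable] = measurable_slice_comp[OF sholomorphic_regularize] measurable_slice_comp[OF A2_slice(1)[OF K_A2]]
  have hm: "h m \<in> borel_measurable (lborel \<Otimes>\<^sub>M lborel)" for m
    unfolding h_def by measurable
  have bd: "norm (h m p) \<le> exp 1 * norm (h0 p)" for m p
  proof (cases p)
    case (Pair y x)
    show ?thesis
      using mult_right_mono[OF norm_slice_regularize_le[of F m y x] norm_ge_zero[of "slice K y x"]]
      by (simp add: Pair h_def h0_def norm_mult wt_cut_nonneg wt_nonneg mult_ac)
  qed
  have bi: "integrable (lborel \<Otimes>\<^sub>M lborel) (\<lambda>p. exp 1 * norm (h0 p))" using h0 by simp
  have hi: "integrable (lborel \<Otimes>\<^sub>M lborel) (h m)" for m
    by (rule Bochner_Integration.integrable_bound[OF bi hm]) (use bd in auto)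
  have "(\<lambda>m. integral\<^sup>L (lborel \<Otimes>\<^sub>M lborel) (h m)) \<longlonglongrightarrow> integral\<^sup>L (lborel \<Otimes>\<^sub>M lborel) h0"
  proof (rule integral_dominated_convergence[OF _ hm bi])
    show "h0 \<in> borel_measurable (lborel \<Otimes>\<^sub>M lborel)" using h0 by simp
    show "AE p in lborel \<Otimes>\<^sub>M lborel. (\<lambda>m. h m p) \<longlonglongrightarrow> h0 p"
    proof (rule AE_I2)
      fix p :: "(real ^ 'n) \<times> (real ^ 'n)"
      show "(\<lambda>m. h m p) \<longlonglongrightarrow> h0 p"
        by (cases p) (auto simp: h_def h0_def slice_def intro!: tendsto_intros regularize_LIMSEQ wt_cut_LIMSEQ)
    qed
    show "AE p in lborel \<Otimes>\<^sub>M lborel. norm (h m p) \<le> exp 1 * norm (h0 p)" for m using bd by simp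
  qed
  moreover have "integral\<^sup>L (lborel \<Otimes>\<^sub>M lborel) (h m) = (LINT y|lborel. LINT x|lborel. slice (regularize F m) y x * cnj (slice K y x) * complex_of_real (wt_cut m y))" for m
    using lborel_pair.integral_fst'[OF hi[of m]] by (simp add: h_def)
  moreover have "integral\<^sup>L (lborel \<Otimes>\<^sub>M lborel) h0 = A2_inner B \<rho> F K"
    using lborel_pair.integral_fst'[OF h0] by (simp add: h0_def A2_inner_eq)
  ultimately show ?thesis by simp
qed

text \<open>The right side does not depend on \<open>m\<close>. At each height the rescaled spectrum
  is the transform of a slice, which Bessel's inequality replaces by the slice itself; the
  regularizing factor contributes at most \<open>exp 1\<close> to the modulus, hence
  \<open>exp 2\<close> to its square.\<close>

lemma spectrum_energy_le:
  "(\<integral>\<^sup>+t. ennreal (I_cut m t * (exp (2 * pi * (v \<bullet> t)) * cmod (spectrum F m u v t))\<^sup>2) \<partial>lborel)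
    \<le> ennreal (exp 2) * (\<integral>\<^sup>+y. \<integral>\<^sup>+x. ennreal ((cmod (slice F y x))\<^sup>2 * wt y) \<partial>lborel \<partial>lborel)"
proof -
  let ?\<phi> = "\<lambda>t. (exp (2 * pi * (v \<bullet> t)) * cmod (spectrum F m u v t))\<^sup>2"
  note [measurable] = measurable_slice_comp[OF A2_slice(1)[OF F]]
  have "(\<integral>\<^sup>+t. ennreal (I_cut m t * ?\<phi> t) \<partial>lborel) = (\<integral>\<^sup>+t. \<integral>\<^sup>+y. ennreal (wt_cut m y * exp (- 4 * pi * (y \<bullet> t))) * ennreal (?\<phi> t) \<partial>lborel \<partial>lborel)"
    by (rule nn_integral_cong) (simp add: ennreal_mult I_cut_nonneg ennreal_I_cut nn_integral_multc)
  also have "\<dots> = (\<integral>\<^sup>+y. \<integral>\<^sup>+t. ennreal (wt_cut m y * exp (- 4 * pi * (y \<bullet> t))) * ennreal (?\<phi> t) \<partial>lborel \<partial>lborel)"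
    by (rule lborel_pair.Fubini') measurable
  also have "\<dots> \<le> (\<integral>\<^sup>+y. \<integral>\<^sup>+x. ennreal (exp 2) * ennreal ((cmod (slice F y x))\<^sup>2 * wt y) \<partial>lborel \<partial>lborel)"
  proof (rule nn_integral_mono)
    fix y
    show "(\<integral>\<^sup>+t. ennreal (wt_cut m y * exp (- 4 * pi * (y \<bullet> t))) * ennreal (?\<phi> t) \<partial>lborel) \<le> (\<integral>\<^sup>+x. ennreal (exp 2) * ennreal ((cmod (slice F y x))\<^sup>2 * wt y) \<partial>lborel)"
    proof (cases "wt_cut m y = 0")
      case False
      note y = wt_cut_nonzeroD[OF False]
      note i = reg_slice_integrable[OF y(1), of m]
      note [measurable] = borel_measurable_four[OF i] borel_measurable_integrable[OF i]
      let ?g = "four (\<lambda>x. regularize F m (cvec x y))"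
      have g: "exp (- 4 * pi * (y \<bullet> t)) * ?\<phi> t = (cmod (?g (- t)))\<^sup>2" for t
      proof -
        have "cmod (?g (- t)) = exp (- 2 * pi * (y \<bullet> t)) * (exp (2 * pi * (v \<bullet> t)) * cmod (spectrum F m u v t))"
          unfolding four_slice_eq[OF y(1)] by (simp add: norm_mult)
        moreover have "(exp (- 2 * pi * (y \<bullet> t)))\<^sup>2 = exp (- 4 * pi * (y \<bullet> t))" by (simp flip: exp_double)
        ultimately show ?thesis by (simp add: power_mult_distrib)
      qed
      have "(\<integral>\<^sup>+t. ennreal (wt_cut m y * exp (- 4 * pi * (y \<bullet> t))) * ennreal (?\<phi> t) \<partial>lborel) = (\<integral>\<^sup>+t. ennreal (wt_cut m y) * ennreal ((cmod (?g (- t)))\<^sup>2) \<partial>lborel)"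
        by (rule nn_integral_cong) (simp add: ennreal_mult[symmetric] wt_cut_nonneg mult.assoc g[symmetric])
      also have "\<dots> = ennreal (wt_cut m y) * (\<integral>\<^sup>+t. ennreal ((cmod (?g (- t)))\<^sup>2) \<partial>lborel)"
        by (rule nn_integral_cmult) measurable
      also have "(\<integral>\<^sup>+t. ennreal ((cmod (?g (- t)))\<^sup>2) \<partial>lborel) = (\<integral>\<^sup>+t. ennreal ((cmod (?g t))\<^sup>2) \<partial>lborel)"
        by (rule nn_integral_lborel_reflect) measurable
      also have "ennreal (wt_cut m y) * \<dots> \<le> ennreal (wt_cut m y) * (\<integral>\<^sup>+x. ennreal ((cmod (regularize F m (cvec x y)))\<^sup>2) \<partial>lborel)"
        by (intro mult_left_mono bessel[OF i]) auto
      also have "\<dots> = (\<integral>\<^sup>+x. ennreal (wt_cut m y) * ennreal ((cmod (regularize F m (cvec x y)))\<^sup>2) \<partial>lborel)"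
        by (rule nn_integral_cmult[symmetric]) measurable
      also have "\<dots> \<le> (\<integral>\<^sup>+x. ennreal (exp 2) * ennreal ((cmod (slice F y x))\<^sup>2 * wt y) \<partial>lborel)"
      proof (rule nn_integral_mono)
        fix x
        have "(cmod (regularize F m (cvec x y)))\<^sup>2 \<le> (exp 1 * cmod (slice F y x))\<^sup>2"
          using norm_regularize_le[OF y(2)] y(1) by (intro power_mono) (auto simp: slice_def)
        also have "\<dots> = exp 2 * (cmod (slice F y x))\<^sup>2" by (simp add: power_mult_distrib flip: exp_double)
        finally have "wt_cut m y * (cmod (regularize F m (cvec x y)))\<^sup>2 \<le> wt y * (exp 2 * (cmod (slice F y x))\<^sup>2)"
          by (intro mult_mono wt_cut_le) (auto simp: wt_nonneg)
        then have "ennreal (wt_cut m y * (cmod (regularize F m (cvec x y)))\<^sup>2) \<le> ennreal (exp 2 * ((cmod (slice F y x))\<^sup>2 * wt y))"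
          by (intro ennreal_leI) (simp add: mult_ac)
        then show "ennreal (wt_cut m y) * ennreal ((cmod (regularize F m (cvec x y)))\<^sup>2) \<le> ennreal (exp 2) * ennreal ((cmod (slice F y x))\<^sup>2 * wt y)"
          by (simp add: ennreal_mult wt_cut_nonneg wt_nonneg)
      qed
      finally show ?thesis .
    qed simp
  qed
  also have "\<dots> = ennreal (exp 2) * (\<integral>\<^sup>+y. \<integral>\<^sup>+x. ennreal ((cmod (slice F y x))\<^sup>2 * wt y) \<partial>lborel \<partial>lborel)"
    by (simp add: nn_integral_cmult)
  finally show ?thesis .
qed

end

end

context tube_weight
begin

text \<open>Two mechanisms are at work. Where the uncut integral is infinite,
  \<open>rI t = 0\<close> and the quotient tends to 0; where it is finite, the squared factor tends
  to 0 while the quotient converges, its limiting denominator being positive by the assumption at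
  \<open>m0\<close>.\<close>

lemma I_cut_inverse_LIMSEQ:
  assumes pos: "\<And>m. m \<ge> m0 \<Longrightarrow> I_cut m t > 0"
  shows "(\<lambda>m. (1 - I_cut m t * rI t)\<^sup>2 * (s / I_cut m t)) \<longlonglongrightarrow> 0"
proof (cases "I_weight B \<rho> t = \<infinity>")
  case True
  then have "filterlim (\<lambda>m. I_cut m t) at_top sequentially"
    using I_cut_LIMSEQ[of t] by (simp add: ennreal_tendsto_top_eq_at_top)
  then have "(\<lambda>m. s / I_cut m t) \<longlonglongrightarrow> 0"
    by (rule real_tendsto_divide_at_top[OF tendsto_const])
  then show ?thesis using True by (simp add: I_weight_inv_def)
next
  case False
  define e where "e = enn2real (I_weight B \<rho> t)"
  have "I_weight B \<rho> t < top" using False by (simp add: less_top)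
  then have e: "I_weight B \<rho> t = ennreal e" "e \<ge> 0" by (auto simp: e_def)
  have "I_cut m0 t \<le> e" using I_cut_le_I_weight[of m0 t] e I_cut_nonneg by simp
  then have e0: "e > 0" using pos[of m0] by simp
  have lim: "(\<lambda>m. I_cut m t) \<longlonglongrightarrow> e"
    by (rule tendsto_ennrealD) (use I_cut_LIMSEQ[of t] e I_cut_nonneg in auto)
  have "rI t = 1 / e" using False by (simp add: I_weight_inv_def e_def)
  moreover have "(\<lambda>m. (1 - I_cut m t * (1 / e))\<^sup>2 * (s / I_cut m t)) \<longlonglongrightarrow> (1 - e * (1 / e))\<^sup>2 * (s / e)"
    by (intro tendsto_intros lim) (use e0 in auto)
  ultimately show ?thesis using e0 by simp
qed

lemma reproducing:
  assumes F: "F \<in> A2 B \<rho>" and v: "v \<in> B"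
  shows "F (cvec u v) = A2_inner B \<rho> F (\<lambda>z. kern z (cvec u v))"
proof -
  obtain a C m0 where a: "a > 0" "C > 0"
    and pos: "\<And>m t. m \<ge> m0 \<Longrightarrow> I_cut m t > 0"
    and bd: "\<And>m t. m \<ge> m0 \<Longrightarrow> exp (- 4 * pi * (v \<bullet> t)) / I_cut m t \<le> C * exp (- a * norm t)"
    using inverse_I_cut_bound[OF v] by metis
  note [measurable] = measurable_spectrum[OF F v, where u = u]
  define E where "E t = exp (- 4 * pi * (v \<bullet> t))" for t
  have [measurable]: "E \<in> borel_measurable borel" unfolding E_def[abs_def] by measurable
  have E: "E t > 0" for t by (simp add: E_def)
  define r where "r m t = 1 - I_cut m t * rI t" for m t
  have [measurable]: "r m \<in> borel_measurable borel" for m unfolding r_def[abs_def] by measurable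
  have r: "0 \<le> r m t" "r m t \<le> 1" for m t
    using I_cut_rI_le[of m t] mult_nonneg_nonneg[OF I_cut_nonneg[of m t] rI_nonneg[of t]] by (auto simp: r_def)
  \<comment> \<open>The square of the first factor in the Cauchy--Schwarz inequality: the division
    by \<open>I_cut m t\<close> balances the weight in \<open>spectrum_energy_le\<close>, and
    \<open>E t\<close> balances the square of the factor \<open>exp (2 pi v.t)\<close>
    there.\<close>
  define p where "p m t = (r m t)\<^sup>2 * (E t / I_cut m t)" for m t
  have [measurable]: "p m \<in> borel_measurable borel" for m unfolding p_def[abs_def] by measurable
  have p0: "p m t \<ge> 0" for m t using E[of t] I_cut_nonneg[of m t] by (simp add: p_def less_imp_le)
  have pb: "p m t \<le> C * exp (- a * norm t)" if "m \<ge> m0" for m t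
  proof -
    have "(r m t)\<^sup>2 \<le> 1" using r by (simp add: power_le_one)
    then have "p m t \<le> 1 * (E t / I_cut m t)" unfolding p_def using E[of t] I_cut_nonneg[of m t]
      by (intro mult_right_mono) (auto simp: less_imp_le)
    then show ?thesis using bd[OF that, of t] by (simp add: E_def)
  qed
  have bi: "integrable lborel (\<lambda>t :: real ^ 'n. C * exp (- a * norm t))"
    by (rule integrable_mult_right, rule integrable_exp_neg_norm[OF a(1)])
  have pint: "integrable lborel (p m)" if "m \<ge> m0" for m
    by (rule Bochner_Integration.integrable_bound[OF bi]) (use pb[OF that] p0 a in auto)
  define P where "P m = (LINT t|lborel. p m t)" for m
  have P0: "P m \<ge> 0" for m unfolding P_def by (simp add: p0)
  have P: "P \<longlonglongrightarrow> 0"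
  \<comment> \<open>A small cutoff may leave nothing of the weight; positivity and the exponential
    bound hold from \<open>m0\<close> on, so the sequence is shifted.\<close>
  proof (rule LIMSEQ_offset[where k = m0])
    have "(\<lambda>m. LINT t|lborel. p (m + m0) t) \<longlonglongrightarrow> (LINT t|(lborel :: (real ^ 'n) measure). 0)"
    proof (rule integral_dominated_convergence[OF _ _ bi])
      show "AE t in lborel. (\<lambda>m. p (m + m0) t) \<longlonglongrightarrow> 0"
        unfolding p_def r_def by (intro AE_I2 LIMSEQ_ignore_initial_segment I_cut_inverse_LIMSEQ pos)
      show "AE t in lborel. norm (p (m + m0) t) \<le> C * exp (- a * norm t)" for m
        using pb[of "m + m0"] p0 by (intro AE_I2) simp
    qed measurable
    then show "(\<lambda>m. P (m + m0)) \<longlonglongrightarrow> 0" by (simp add: P_def)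
  qed
  define N where "N = enn2real (\<integral>\<^sup>+y. \<integral>\<^sup>+x. ennreal ((cmod (slice F y x))\<^sup>2 * wt y) \<partial>lborel \<partial>lborel)"
  have N: "(\<integral>\<^sup>+y. \<integral>\<^sup>+x. ennreal ((cmod (slice F y x))\<^sup>2 * wt y) \<partial>lborel \<partial>lborel) = ennreal N" "N \<ge> 0"
    using A2_slice(2)[OF F] by (auto simp: N_def)
  define A where "A m = (LINT y|lborel. LINT x|lborel. slice (regularize F m) y x * cnj (slice (\<lambda>z. kern z (cvec u v)) y x) * complex_of_real (wt_cut m y))" for m
  define D where "D m = regularize F m (cvec u v) - A m" for m
  have D: "cmod (D m) \<le> sqrt (P m * (exp 2 * N))" if m: "m \<ge> m0" for m
  proof -
    note si = spectrum_integrable[OF F v, of m u]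
    have ri: "integrable lborel (\<lambda>t. complex_of_real (I_cut m t * rI t) * spectrum F m u v t)"
    proof (rule Bochner_Integration.integrable_bound[OF si])
      show "AE t in lborel. norm (complex_of_real (I_cut m t * rI t) * spectrum F m u v t) \<le> norm (spectrum F m u v t)"
        by (intro AE_I2) (auto simp: norm_mult abs_of_nonneg I_cut_nonneg rI_nonneg intro!: mult_left_le_one_le I_cut_rI_le)
    qed measurable
    have "D m = (LINT t|lborel. spectrum F m u v t - complex_of_real (I_cut m t * rI t) * spectrum F m u v t)"
      unfolding D_def A_def cut_inner_eq[OF F v] regularize_eq_integral[OF F v]
      by (rule Bochner_Integration.integral_diff[OF si ri, symmetric])
    then have "ennreal (cmod (D m)) \<le> (\<integral>\<^sup>+t. ennreal (norm (spectrum F m u v t - complex_of_real (I_cut m t * rI t) * spectrum F m u v t)) \<partial>lborel)"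
      by (simp only: norm_integral_le_nn_integral)
    also have "\<dots> = (\<integral>\<^sup>+t. ennreal (sqrt (p m t)) * ennreal (sqrt (I_cut m t) * (exp (2 * pi * (v \<bullet> t)) * cmod (spectrum F m u v t))) \<partial>lborel)"
    proof (rule nn_integral_cong)
      fix t
      have "spectrum F m u v t - complex_of_real (I_cut m t * rI t) * spectrum F m u v t = complex_of_real (r m t) * spectrum F m u v t"
        by (simp add: r_def left_diff_distrib)
      then have 1: "norm (spectrum F m u v t - complex_of_real (I_cut m t * rI t) * spectrum F m u v t) = r m t * cmod (spectrum F m u v t)"
        using r[of m t] by (simp only: norm_mult norm_of_real abs_of_nonneg)
      have "sqrt (E t) = exp (- 2 * pi * (v \<bullet> t))"
        by (rule real_sqrt_unique) (simp_all add: E_def flip: exp_double)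
      then have 2: "sqrt (E t) * exp (2 * pi * (v \<bullet> t)) = 1" by (simp add: exp_add[symmetric])
      have "sqrt (p m t) * sqrt (I_cut m t) = r m t * sqrt (E t)"
        using pos[OF m, of t] r[of m t] by (simp add: p_def real_sqrt_mult real_sqrt_divide)
      then have "sqrt (p m t) * (sqrt (I_cut m t) * (exp (2 * pi * (v \<bullet> t)) * cmod (spectrum F m u v t)))
         = r m t * (sqrt (E t) * exp (2 * pi * (v \<bullet> t))) * cmod (spectrum F m u v t)"
        by (simp only: mult.assoc[symmetric])
      then have 3: "sqrt (p m t) * (sqrt (I_cut m t) * (exp (2 * pi * (v \<bullet> t)) * cmod (spectrum F m u v t))) = r m t * cmod (spectrum F m u v t)"
        by (simp only: 2 mult_1_right)
      show "ennreal (norm (spectrum F m u v t - complex_of_real (I_cut m t * rI t) * spectrum F m u v t))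
        = ennreal (sqrt (p m t)) * ennreal (sqrt (I_cut m t) * (exp (2 * pi * (v \<bullet> t)) * cmod (spectrum F m u v t)))"
        unfolding 1 3[symmetric] by (rule ennreal_mult) (auto simp: p0 I_cut_nonneg)
    qed
    finally have "(ennreal (cmod (D m)))\<^sup>2 \<le> (\<integral>\<^sup>+t. ennreal (sqrt (p m t)) * ennreal (sqrt (I_cut m t) * (exp (2 * pi * (v \<bullet> t)) * cmod (spectrum F m u v t))) \<partial>lborel)\<^sup>2"
      by (intro power_mono) auto
    also have "\<dots> \<le> (\<integral>\<^sup>+t. (ennreal (sqrt (p m t)))\<^sup>2 \<partial>lborel) * (\<integral>\<^sup>+t. (ennreal (sqrt (I_cut m t) * (exp (2 * pi * (v \<bullet> t)) * cmod (spectrum F m u v t))))\<^sup>2 \<partial>lborel)"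
      by (rule Cauchy_Schwarz_nn_integral) measurable
    also have "(\<integral>\<^sup>+t. (ennreal (sqrt (p m t)))\<^sup>2 \<partial>lborel) = ennreal (P m)"
    proof -
      have "(\<integral>\<^sup>+t. (ennreal (sqrt (p m t)))\<^sup>2 \<partial>lborel) = (\<integral>\<^sup>+t. ennreal (p m t) \<partial>lborel)"
        by (rule nn_integral_cong) (simp add: ennreal_power p0)
      then show ?thesis unfolding P_def by (simp add: nn_integral_eq_integral[OF pint[OF m]] p0)
    qed
    also have "(\<integral>\<^sup>+t. (ennreal (sqrt (I_cut m t) * (exp (2 * pi * (v \<bullet> t)) * cmod (spectrum F m u v t))))\<^sup>2 \<partial>lborel)
      = (\<integral>\<^sup>+t. ennreal (I_cut m t * (exp (2 * pi * (v \<bullet> t)) * cmod (spectrum F m u v t))\<^sup>2) \<partial>lborel)"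
      by (rule nn_integral_cong) (simp add: ennreal_power I_cut_nonneg power_mult_distrib)
    also have "ennreal (P m) * \<dots> \<le> ennreal (P m) * (ennreal (exp 2) * ennreal N)"
      using spectrum_energy_le[OF F v, of m u] N(1) by (intro mult_left_mono) auto
    also have "\<dots> = ennreal (P m * (exp 2 * N))"
      using N(2) P0[of m] by (simp add: ennreal_mult)
    finally have "(cmod (D m))\<^sup>2 \<le> P m * (exp 2 * N)"
    proof -
      assume "(ennreal (cmod (D m)))\<^sup>2 \<le> ennreal (P m * (exp 2 * N))"
      then show ?thesis using N(2) P0[of m] by (simp add: ennreal_power)
    qed
    then show ?thesis by (rule real_le_rsqrt)
  qed
  have "D \<longlonglongrightarrow> 0"
  proof (rule Lim_null_comparison)
    show "\<forall>\<^sub>F m in sequentially. norm (D m) \<le> sqrt (P m * (exp 2 * N))"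
      using D by (rule eventually_sequentiallyI)
    have "(\<lambda>m. sqrt (P m * (exp 2 * N))) \<longlonglongrightarrow> sqrt (0 * (exp 2 * N))"
      by (intro tendsto_intros P)
    then show "(\<lambda>m. sqrt (P m * (exp 2 * N))) \<longlonglongrightarrow> 0" by simp
  qed
  moreover have "D \<longlonglongrightarrow> F (cvec u v) - A2_inner B \<rho> F (\<lambda>z. kern z (cvec u v))"
    unfolding D_def A_def by (intro tendsto_diff regularize_LIMSEQ cut_inner_LIMSEQ[OF F v])
  ultimately have "F (cvec u v) - A2_inner B \<rho> F (\<lambda>z. kern z (cvec u v)) = 0"
    by (rule LIMSEQ_unique[symmetric])
  then show ?thesis by simp
qed

section \<open>Values off the tube and uniqueness of the kernel\<close>

lemma open_tube: "open (tube B)"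
proof -
  have "tube B = (\<lambda>z :: complex ^ 'n. \<chi> k. Im (z $ k)) -` B"
  proof (intro set_eqI iffI)
    fix z :: "complex ^ 'n"
    assume "z \<in> (\<lambda>z. \<chi> k. Im (z $ k)) -` B"
    moreover have "z = cvec (\<chi> k. Re (z $ k)) (\<chi> k. Im (z $ k))" by (simp add: vec_eq_iff)
    ultimately show "z \<in> tube B" unfolding tube_def by blast
  next
    fix z :: "complex ^ 'n"
    assume "z \<in> tube B"
    then show "z \<in> (\<lambda>z. \<chi> k. Im (z $ k)) -` B" by (auto elim!: tubeE)
  qed
  moreover have "continuous_on UNIV (\<lambda>z :: complex ^ 'n. \<chi> k. Im (z $ k))"
    by (intro continuous_intros)
  ultimately show ?thesis using open_vimage[OF open_B] by simp
qed

text \<open>The tube is open, so a derivative at one of its points does not see values outside. This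
  allows the kernel to be reset to 0 there.\<close>

lemma A2_cong:
  assumes eq: "\<And>z. z \<in> tube B \<Longrightarrow> F z = G z" and F: "F \<in> A2 B \<rho>"
  shows "G \<in> A2 B \<rho>"
  unfolding A2_def
proof (intro CollectI conjI)
  show "sholomorphic_on G (tube B)"
    unfolding sholomorphic_on_def
  proof
    fix z assume z: "z \<in> tube B"
    then obtain c :: "complex ^ 'n" where "(F has_derivative (\<lambda>h. \<Sum>k\<in>UNIV. c $ k * h $ k)) (at z)"
      using F unfolding A2_def sholomorphic_on_def by blast
    then have "(G has_derivative (\<lambda>h. \<Sum>k\<in>UNIV. c $ k * h $ k)) (at z)"
      by (rule has_derivative_transform_within_open[OF _ open_tube z]) (rule eq)
    then show "\<exists>c :: complex ^ 'n. (G has_derivative (\<lambda>h. \<Sum>k\<in>UNIV. c $ k * h $ k)) (at z)" by blast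
  qed
  have "(\<integral>\<^sup>+y\<in>B. (\<integral>\<^sup>+x. ennreal ((cmod (G (cvec x y)))\<^sup>2 * \<rho> (cvec 0 y)) \<partial>lborel) \<partial>lborel)
      = (\<integral>\<^sup>+y\<in>B. (\<integral>\<^sup>+x. ennreal ((cmod (F (cvec x y)))\<^sup>2 * \<rho> (cvec 0 y)) \<partial>lborel) \<partial>lborel)"
    by (rule nn_integral_cong) (auto simp: indicator_def eq)
  then show "(\<integral>\<^sup>+y\<in>B. (\<integral>\<^sup>+x. ennreal ((cmod (G (cvec x y)))\<^sup>2 * \<rho> (cvec 0 y)) \<partial>lborel) \<partial>lborel) < \<infinity>"
    using F by (simp add: A2_def)
qed

lemma A2_inner_cong:
  assumes "\<And>z. z \<in> tube B \<Longrightarrow> G z = G' z" shows "A2_inner B \<rho> F G = A2_inner B \<rho> F G'"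
proof -
  have "slice G = slice G'" by (auto simp: slice_def fun_eq_iff indicator_def assms)
  then show ?thesis by (simp only: A2_inner_eq)
qed

lemma is_weighted_bergman_kernel_kern:
  "is_weighted_bergman_kernel B \<rho> (\<lambda>z w. if z \<in> tube B \<and> w \<in> tube B then kern z w else 0)"
  unfolding is_weighted_bergman_kernel_def
proof (intro conjI ballI allI impI)
  fix w assume w: "w \<in> tube B"
  show "(\<lambda>z. if z \<in> tube B \<and> w \<in> tube B then kern z w else 0) \<in> A2 B \<rho>"
    by (rule A2_cong[OF _ kern_in_A2[OF w]]) (simp add: w)
  fix F assume F: "F \<in> A2 B \<rho>"
  obtain u v where uv: "w = cvec u v" "v \<in> B" using w by (rule tubeE)
  have "F w = A2_inner B \<rho> F (\<lambda>z. kern z w)" unfolding uv(1) by (rule reproducing[OF F uv(2)])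
  also have "\<dots> = A2_inner B \<rho> F (\<lambda>z. if z \<in> tube B \<and> w \<in> tube B then kern z w else 0)"
    by (rule A2_inner_cong) (simp add: w)
  finally show "F w = A2_inner B \<rho> F (\<lambda>z. if z \<in> tube B \<and> w \<in> tube B then kern z w else 0)" .
qed auto

text \<open>Applying each of two reproducing kernels to a section of the other gives
  \<open>K z w = cnj (K' w z)\<close> on the tube. Used for \<open>K1\<close> against
  \<open>K2\<close> and for \<open>K2\<close> against itself, this identifies both kernels with the
  same conjugate transpose.\<close>

lemma weighted_bergman_kernel_unique:
  assumes K1: "is_weighted_bergman_kernel B \<rho> K1" and K2: "is_weighted_bergman_kernel B \<rho> K2"
  shows "K1 = K2"
proof (intro ext)
  have sym: "K z w = cnj (K' w z)"
    if K: "is_weighted_bergman_kernel B \<rho> K" and K': "is_weighted_bergman_kernel B \<rho> K'" and zw: "z \<in> tube B" "w \<in> tube B"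
    for K K' :: "complex ^ 'n \<Rightarrow> complex ^ 'n \<Rightarrow> complex" and z w
  proof -
    have K2: "(\<lambda>z. K z w) \<in> A2 B \<rho>" "\<And>F. F \<in> A2 B \<rho> \<Longrightarrow> F w = A2_inner B \<rho> F (\<lambda>z. K z w)"
      using K zw unfolding is_weighted_bergman_kernel_def by auto
    have K2': "(\<lambda>w. K' w z) \<in> A2 B \<rho>" "\<And>F. F \<in> A2 B \<rho> \<Longrightarrow> F z = A2_inner B \<rho> F (\<lambda>w. K' w z)"
      using K' zw unfolding is_weighted_bergman_kernel_def by auto
    have "K z w = A2_inner B \<rho> (\<lambda>z. K z w) (\<lambda>w. K' w z)"
      by (rule K2'(2)[OF K2(1)])
    also have "\<dots> = cnj (A2_inner B \<rho> (\<lambda>w. K' w z) (\<lambda>z. K z w))" by (rule A2_inner_cnj)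
    also have "A2_inner B \<rho> (\<lambda>w. K' w z) (\<lambda>z. K z w) = K' w z"
      by (rule K2(2)[OF K2'(1), symmetric])
    finally show ?thesis .
  qed
  fix z w
  show "K1 z w = K2 z w"
  proof (cases "z \<in> tube B \<and> w \<in> tube B")
    case True
    then show ?thesis using sym[OF K1 K2, of z w] sym[OF K2 K2, of z w] by simp
  next
    case False
    then show ?thesis using K1 K2 unfolding is_weighted_bergman_kernel_def by metis
  qed
qed

end

theorem theorem1:
  fixes B :: "(real ^ 'n) set" and \<rho> :: "complex ^ 'n \<Rightarrow> real"
  assumes "B \<noteq> {}" and "open B" and "connected B"
    and "continuous_on (tube B) \<rho>"
    and "\<And>z. z \<in> tube B \<Longrightarrow> \<rho> z > 0"
    and "\<And>x y. y \<in> B \<Longrightarrow> \<rho> (cvec x y) = \<rho> (cvec 0 y)"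
  shows "(\<exists>!K. is_weighted_bergman_kernel B \<rho> K) \<and>
    (\<forall>z\<in>tube B. \<forall>w\<in>tube B.
       integrable lborel (\<lambda>t. exp (2 * complex_of_real pi * \<i> * cdot (z - vcnj w) t)
                              * complex_of_real (I_weight_inv B \<rho> t)) \<and>
       weighted_bergman_kernel B \<rho> z w =
         (LINT t|lborel. exp (2 * complex_of_real pi * \<i> * cdot (z - vcnj w) t)
                         * complex_of_real (I_weight_inv B \<rho> t)))"
proof -
  interpret tube_weight B \<rho> by standard (fact assms)+
  have "\<exists>!K. is_weighted_bergman_kernel B \<rho> K"
    using is_weighted_bergman_kernel_kern weighted_bergman_kernel_unique by blast
  moreover from this have "weighted_bergman_kernel B \<rho> = (\<lambda>z w. if z \<in> tube B \<and> w \<in> tube B then kern z w else 0)"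
    unfolding weighted_bergman_kernel_def by (rule the1_equality) (rule is_weighted_bergman_kernel_kern)
  ultimately show ?thesis using integrable_kern by (simp add: kern_def)
qed

end
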